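(* Assume that $U\in H^{q+3}_\rho(\mathbb R;H)$. Then there exists $C\ge0$ depending on $\|M_0\|$, $\|M_1\|$, $\rho$, $T$, $\gamma$, $q$ such that $$\sup_{t\in[0,T]}\langle M_0(U-U^\tau)(t),(U-U^\tau)(t)\rangle_H+|||U-U^\tau|||_{Q,\rho}^2\le C\,\tau^{2(q+1)}\,|\partial_t^{q+3}U|_\rho^2 .$$
   Context: $H$ is a real Hilbert space with inner product $\langle\cdot,\cdot\rangle_H$ and norm $|\cdot|_H$. For $\rho>0$, $H_\rho(\mathbb R;H)$ is the Hilbert space of (classes of) measurable $f:\mathbb R\to H$ with $|f|_\rho^2:=\int_{\mathbb R}|f(t)|_H^2e^{-2\rho t}\,dt<\infty$; $\partial_t$ is the closure in $H_\rho(\mathbb R;H)$ of $\phi\mapsto\phi'$ on $C_c^\infty(\mathbb R;H)$, and $H^k_\rho(\mathbb R;H)$ is the domain of $\partial_t^k$ (its elements are identified with continuous representatives for $k\ge1$). $M_0,M_1:H\to H$ are bounded linear operators, $M_0$ is selfadjoint, and $A:D(A)\subseteq H\to H$ is skew-selfadjoint, i.e. $A^*=-A$. There are $\rho_0>0$, $\gamma>0$ such that $\langle(\rho M_0+M_1)x,x\rangle_H\ge\gamma\langle x,x\rangle_H$ for all $\rho\ge\rho_0$, $x\in H$. Fix $\rho\ge\rho_0$, $T>0$, $q\in\mathbb N$, and a partition $0=t_0<\dots<t_M=T$; $I_m=(t_{m-1},t_m]$, $\tau_m=t_m-t_{m-1}$, and $\tau=\max_{1\le m\le M}\tau_m$.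 $\mathcal U^\tau$ is the space of functions $u:(0,T]\to H$ such that $u|_{I_m}$ is an $H$-valued polynomial of degree at most $q$ for each $m$; $\partial_t$ acts piecewise on each $I_m$ on such functions, and $M_0,M_1,A$ act pointwise in $t$. Quadrature: $-1<\hat t^m_0<\dots<\hat t^m_q=1$ and $\omega^m_i$ are the nodes and weights of the right-sided weighted Gauss–Radau rule: $\int_{-1}^1 e^{-\rho\tau_m(t+1)}p(t)\,dt=\sum_{i=0}^q\omega^m_ip(\hat t^m_i)$ for all polynomials $p$ of degree at most $2q$. With $t_{m,i}=\frac{t_{m-1}+t_m}{2}+\frac{\tau_m}{2}\hat t^m_i$ set $Q_m[v]=\frac{\tau_m}{2}\sum_{i=0}^q\omega_i^mv(t_{m,i})$, $Q_m[a,b]_\rho=Q_m[\langle a,b\rangle_H]$, and $|||v|||_{Q,\rho}^2=\sum_{m=1}^M Q_m[v,v]_\rho\,e^{-2\rho t_{m-1}}$. Interpolation: for continuous $v:[0,T]\to H$, $Pv$ satisfies $(Pv)(0)=v(0)$ and on $I_m$ it is the polynomial of degree at most $q$ interpolating $v$ at $t_{m,0},\dots,t_{m,q}$. Exact and discrete solutions: $F\in H_\rho^2(\mathbb R;H)$ is fixed, and $U\in H^2_\rho(\mathbb R;H)$ is the unique solution of $(\partial_tM_0+M_1+A)U=F$ (then $U$ is continuous with values in $D(A)$). $U^\tau\in\mathcal U^\tau$ is the unique function (with values in $D(A)$) satisfying, with $x_0=U(0+)$, for all $\Phi\in\mathcal U^\tau$ and $m\in\{1,\dots,M\}$, $$Q_m[(\partial_tM_0+M_1+A)U^\tau,\Phi]_\rho+\langle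 M_0[[U^\tau]]_{m-1}^{x_0},\Phi(t_{m-1}+)\rangle_H=Q_m[PF,\Phi]_\rho,$$ where $[[V]]_{m-1}^{x}=V(t_{m-1}+)-V(t_{m-1}-)$ for $m\ge2$ and $[[V]]_0^{x}=V(t_0+)-x$. At $t=0$ one uses $U^\tau(0):=x_0$. The constant $C$ does not depend on the partition. *)

theory Defs
  imports "HOL-Analysis.Analysis" "HOL-Computational_Algebra.Polynomial"
begin

section \<open>Weighted spaces and the time derivative\<close>

text \<open>
  The Hilbert space is not assumed to be separable, so Bochner (strong) measurability, and not
  Borel measurability, is the appropriate notion. Equivalence classes are represented by
  their members; all notions below except pointwise values are invariant under modification on
  null sets.
\<close>

definition strongly_measurable :: "(real \<Rightarrow> 'h::real_normed_vector) \<Rightarrow> bool" where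
  "strongly_measurable f \<longleftrightarrow>
     (\<exists>s. (\<forall>n::nat. simple_function lebesgue (s n)) \<and>
          (AE x in lebesgue. (\<lambda>n. s n x) \<longlonglongrightarrow> f x))"

definition H_space :: "real \<Rightarrow> (real \<Rightarrow> 'h::real_normed_vector) set" where
  "H_space \<rho> = {f. strongly_measurable f \<and>
                   integrable lebesgue (\<lambda>t. (norm (f t))\<^sup>2 * exp (- 2 * \<rho> * t))}"

definition H_norm :: "real \<Rightarrow> (real \<Rightarrow> 'h::real_normed_vector) \<Rightarrow> real" where
  "H_norm \<rho> f = sqrt (LINT t|lebesgue. (norm (f t))\<^sup>2 * exp (- 2 * \<rho> * t))"

definition Cc_infty :: "(real \<Rightarrow> 'h::real_normed_vector) set" where
  "Cc_infty = {\<phi>. compact (closure {t. \<phi> t \<noteq> 0}) \<and>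
      (\<forall>k t. ((\<lambda>g s. vector_derivative g (at s)) ^^ k) \<phi> differentiable (at t))}"

text \<open>
  The graph of the closure of \<open>\<phi> \<mapsto> \<phi>'\<close> on test functions. Its powers are the
  relational powers, so \<open>H\<^sup>k\<close> is the domain of the \<open>k\<close>-th relational power (\<open>k \<ge> 1\<close>).
\<close>

definition dt :: "real \<Rightarrow> ((real \<Rightarrow> 'h::real_normed_vector) \<times> (real \<Rightarrow> 'h)) set" where
  "dt \<rho> = {(f, g). f \<in> H_space \<rho> \<and> g \<in> H_space \<rho> \<and>
     (\<exists>\<phi>. (\<forall>n::nat. \<phi> n \<in> Cc_infty) \<and>
          (\<lambda>n. H_norm \<rho> (\<lambda>t. \<phi> n t - f t)) \<longlonglongrightarrow> 0 \<and>
          (\<lambda>n. H_norm \<rho> (\<lambda>t. vector_derivative (\<phi> n) (at t) - g t)) \<longlonglongrightarrow> 0)}"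

definition Hk_space :: "nat \<Rightarrow> real \<Rightarrow> (real \<Rightarrow> 'h::real_normed_vector) set" where
  "Hk_space k \<rho> = Domain (dt \<rho> ^^ k)"


section \<open>Operators\<close>

definition selfadjoint_bounded :: "('h::real_inner \<Rightarrow> 'h) \<Rightarrow> bool" where
  "selfadjoint_bounded B \<longleftrightarrow> bounded_linear B \<and> (\<forall>x y. inner (B x) y = inner x (B y))"

text \<open>
  An unbounded operator is given by its domain \<open>D\<close> and a total function \<open>A\<close> of which only the
  values on \<open>D\<close> are relevant.
\<close>

definition densely_defined_linear :: "'h::real_inner set \<Rightarrow> ('h \<Rightarrow> 'h) \<Rightarrow> bool" where
  "densely_defined_linear D A \<longleftrightarrow> subspace D \<and> closure D = UNIV \<and>
     (\<forall>x\<in>D. \<forall>y\<in>D. A (x + y) = A x + A y) \<and> (\<forall>c. \<forall>x\<in>D. A (c *\<^sub>R x) = c *\<^sub>R A x)"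

definition adjoint_graph :: "'h::real_inner set \<Rightarrow> ('h \<Rightarrow> 'h) \<Rightarrow> ('h \<times> 'h) set" where
  "adjoint_graph D A = {(y, z). \<forall>x\<in>D. inner (A x) y = inner x z}"

definition skew_selfadjoint :: "'h::real_inner set \<Rightarrow> ('h \<Rightarrow> 'h) \<Rightarrow> bool" where
  "skew_selfadjoint D A \<longleftrightarrow>
     densely_defined_linear D A \<and> adjoint_graph D A = {(x, - A x) | x. x \<in> D}"

text \<open>The graph of the operator that \<open>A\<close> induces on the weighted space by pointwise action.\<close>

definition lifted_graph ::
  "real \<Rightarrow> 'h::real_normed_vector set \<Rightarrow> ('h \<Rightarrow> 'h) \<Rightarrow> ((real \<Rightarrow> 'h) \<times> (real \<Rightarrow> 'h)) set" where
  "lifted_graph \<rho> D A = {(u, w). u \<in> H_space \<rho> \<and> w \<in> H_space \<rho> \<and>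
     (AE t in lebesgue. u t \<in> D \<and> w t = A (u t))}"

text \<open>\<open>U\<close> is taken to be the continuous representative of its class.\<close>

definition exact_solution ::
  "real \<Rightarrow> ('h::real_normed_vector \<Rightarrow> 'h) \<Rightarrow> ('h \<Rightarrow> 'h) \<Rightarrow> 'h set \<Rightarrow> ('h \<Rightarrow> 'h) \<Rightarrow>
   (real \<Rightarrow> 'h) \<Rightarrow> (real \<Rightarrow> 'h) \<Rightarrow> bool" where
  "exact_solution \<rho> M0 M1 D A F U \<longleftrightarrow>
     U \<in> Hk_space 2 \<rho> \<and> continuous_on UNIV U \<and>
     (\<exists>g w. (\<lambda>t. M0 (U t), g) \<in> dt \<rho> \<and> (U, w) \<in> lifted_graph \<rho> D A \<and>
            (AE t in lebesgue. g t + M1 (U t) + w t = F t))"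


section \<open>Time partition and quadrature\<close>

definition time_partition :: "real \<Rightarrow> nat \<Rightarrow> (nat \<Rightarrow> real) \<Rightarrow> bool" where
  "time_partition T M t \<longleftrightarrow> t 0 = 0 \<and> t M = T \<and> (\<forall>m\<in>{1..M}. t (m - 1) < t m)"

definition ivl :: "(nat \<Rightarrow> real) \<Rightarrow> nat \<Rightarrow> real set" where
  "ivl t m = {t (m - 1)<..t m}"

definition step :: "(nat \<Rightarrow> real) \<Rightarrow> nat \<Rightarrow> real" where
  "step t m = t m - t (m - 1)"

definition max_step :: "nat \<Rightarrow> (nat \<Rightarrow> real) \<Rightarrow> real" where
  "max_step M t = Max (step t ` {1..M})"

text \<open>Only the values on \<open>(0,T]\<close> of the elements of this space are constrained.\<close>

definition pw_poly ::
  "nat \<Rightarrow> nat \<Rightarrow> (nat \<Rightarrow> real) \<Rightarrow> (real \<Rightarrow> 'h::real_normed_vector) set" where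
  "pw_poly q M t = {u. \<forall>m\<in>{1..M}. \<exists>c::nat \<Rightarrow> 'h. \<forall>s\<in>ivl t m. u s = (\<Sum>k\<le>q. s ^ k *\<^sub>R c k)}"

text \<open>
  \<open>x i\<close> and \<open>w i\<close> are the nodes and weights of the weighted Gauss--Radau rule on the reference
  interval belonging to a step of size \<open>h\<close>.
\<close>

definition gauss_radau :: "real \<Rightarrow> nat \<Rightarrow> real \<Rightarrow> (nat \<Rightarrow> real) \<Rightarrow> (nat \<Rightarrow> real) \<Rightarrow> bool" where
  "gauss_radau \<rho> q h x w \<longleftrightarrow>
     -1 < x 0 \<and> (\<forall>i<q. x i < x (Suc i)) \<and> x q = 1 \<and>
     (\<forall>p::real poly. degree p \<le> 2 * q \<longrightarrow>
        integral {-1..1} (\<lambda>s. exp (- \<rho> * h * (s + 1)) * poly p s) = (\<Sum>i\<le>q. w i * poly p (x i)))"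

definition node :: "(nat \<Rightarrow> real) \<Rightarrow> (nat \<Rightarrow> nat \<Rightarrow> real) \<Rightarrow> nat \<Rightarrow> nat \<Rightarrow> real" where
  "node t x m i = (t (m - 1) + t m) / 2 + step t m / 2 * x m i"

definition quad ::
  "nat \<Rightarrow> (nat \<Rightarrow> real) \<Rightarrow> (nat \<Rightarrow> nat \<Rightarrow> real) \<Rightarrow> (nat \<Rightarrow> nat \<Rightarrow> real) \<Rightarrow> nat \<Rightarrow>
   (real \<Rightarrow> real) \<Rightarrow> real" where
  "quad q t x w m v = step t m / 2 * (\<Sum>i\<le>q. w m i * v (node t x m i))"

definition quad_norm_sq ::
  "real \<Rightarrow> nat \<Rightarrow> nat \<Rightarrow> (nat \<Rightarrow> real) \<Rightarrow> (nat \<Rightarrow> nat \<Rightarrow> real) \<Rightarrow> (nat \<Rightarrow> nat \<Rightarrow> real) \<Rightarrow>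
   (real \<Rightarrow> 'h::real_inner) \<Rightarrow> real" where
  "quad_norm_sq \<rho> q M t x w v =
     (\<Sum>m=1..M. quad q t x w m (\<lambda>s. inner (v s) (v s)) * exp (- 2 * \<rho> * t (m - 1)))"

text \<open>\<open>p\<close> is the interpolant \<open>Pv\<close>; this determines \<open>p\<close> on \<open>[0,T]\<close>.\<close>

definition interpolant ::
  "nat \<Rightarrow> nat \<Rightarrow> (nat \<Rightarrow> real) \<Rightarrow> (nat \<Rightarrow> nat \<Rightarrow> real) \<Rightarrow>
   (real \<Rightarrow> 'h::real_normed_vector) \<Rightarrow> (real \<Rightarrow> 'h) \<Rightarrow> bool" where
  "interpolant q M t x v p \<longleftrightarrow> p 0 = v 0 \<and> p \<in> pw_poly q M t \<and>
     (\<forall>m\<in>{1..M}. \<forall>i\<le>q. p (node t x m i) = v (node t x m i))"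


section \<open>The discrete problem\<close>

text \<open>\<open>jump t V a m\<close> is the jump of \<open>V\<close> at \<open>t (m - 1)\<close>, with \<open>a\<close> as left value at the initial time.\<close>

definition jump :: "(nat \<Rightarrow> real) \<Rightarrow> (real \<Rightarrow> 'h::real_normed_vector) \<Rightarrow> 'h \<Rightarrow> nat \<Rightarrow> 'h" where
  "jump t V a m = Lim (at_right (t (m - 1))) V -
     (if m = 1 then a else Lim (at_left (t (m - 1))) V)"

text \<open>
  The derivative is taken within the half-open interval \<open>ivl t m\<close>, i.e. piecewise; at the node
  \<open>t m\<close> it is the left derivative.
\<close>

definition discrete_solution ::
  "nat \<Rightarrow> nat \<Rightarrow> (nat \<Rightarrow> real) \<Rightarrow> (nat \<Rightarrow> nat \<Rightarrow> real) \<Rightarrow> (nat \<Rightarrow> nat \<Rightarrow> real) \<Rightarrow>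
   real \<Rightarrow> ('h::real_inner \<Rightarrow> 'h) \<Rightarrow> ('h \<Rightarrow> 'h) \<Rightarrow> 'h set \<Rightarrow> ('h \<Rightarrow> 'h) \<Rightarrow>
   (real \<Rightarrow> 'h) \<Rightarrow> 'h \<Rightarrow> (real \<Rightarrow> 'h) \<Rightarrow> bool" where
  "discrete_solution q M t x w T M0 M1 D A PF x0 V \<longleftrightarrow>
     V \<in> pw_poly q M t \<and> (\<forall>s\<in>{0<..T}. V s \<in> D) \<and>
     (\<forall>\<Phi>\<in>pw_poly q M t. \<forall>m\<in>{1..M}.
        quad q t x w m (\<lambda>s. inner
          (vector_derivative (\<lambda>r. M0 (V r)) (at s within ivl t m) + M1 (V s) + A (V s)) (\<Phi> s))
        + inner (M0 (jump t V x0 m)) (Lim (at_right (t (m - 1))) \<Phi>)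
        = quad q t x w m (\<lambda>s. inner (PF s) (\<Phi> s)))"

end

theory Submission
  imports Defs
begin

text \<open>
  Let \<open>PU\<close> interpolate \<open>U\<close> at the quadrature nodes. The discrete error \<open>PU - U\<tau>\<close> solves the
  discrete equation with residual \<open>Q[M0 (PU - U)', \<Phi>] + \<langle>M0 (PU - U)(t (m - 1)), \<Phi>\<rangle>\<close>, which is of order
  \<open>q + 1\<close> because integration by parts is exact for the quadrature rule. Testing with the discrete
  error itself bounds its quadrature norm and its values at the partition points; testing with the
  interpolant of \<open>step t m / (s - t (m - 1))\<close> times the discrete error bounds it in between. All
  constants are independent of the position of the nodes: interpolation errors are estimated by
  Rolle's theorem, and the Radau rule overestimates the one integral of too high degree. Since \<open>H\<close>
  need not be separable, the regularity of \<open>U\<close> is extracted from the approximating test functions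
  and from scalar integrals only.
\<close>

section \<open>Vector-valued polynomials\<close>

text \<open>\<open>M0\<close> may have a kernel and \<open>A\<close> is unbounded, so the choice of
  test functions is narrow: if the test function is, node by node, a nonnegative multiple of the
  discrete error, then \<open>A\<close> drops out and coercivity survives. The error itself
  qualifies, but between the partition points it gives too little: an inverse estimate turns a
  quadrature sum into a point value at the price of a factor 1 / step, and the incoming error would
  be divided by the step. The factor \<open>step t m / (s - t (m - 1))\<close> keeps the multiples
  positive, and integration by parts then produces a quadrature sum that is already divided by the
  step. Multiplication by \<open>s - t (m - 1)\<close> raises the degree to 2q + 1, one beyond
  exactness, which is why the sign of the Radau error matters. The order q + 3 of regularity arises
  because consistency uses sup bounds for the derivatives of order q + 1 and q + 2, and a sup bound
  in the weighted space costs one further derivative.\<close>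

text \<open>
  The index counts coefficients and exceeds the degree bound by one, so that \<open>vpoly 0\<close> is the zero
  function and the derivative of a constant needs no separate treatment when \<open>q = 0\<close>.
\<close>

definition vpoly :: "nat \<Rightarrow> (real \<Rightarrow> 'a::real_normed_vector) \<Rightarrow> bool" where
  "vpoly n f \<longleftrightarrow> (\<exists>c. \<forall>s. f s = (\<Sum>k<n. s ^ k *\<^sub>R c k))"

lemma vpoly_mono:
  assumes "vpoly m f" "m \<le> n"
  shows "vpoly n f"
proof -
  obtain c where c: "\<And>s. f s = (\<Sum>k<m. s ^ k *\<^sub>R c k)"
    using assms(1) unfolding vpoly_def by blast
  have "f s = (\<Sum>k<n. s ^ k *\<^sub>R (if k < m then c k else 0))" for s
  proof -
    have "(\<Sum>k<n. s ^ k *\<^sub>R (if k < m then c k else 0)) = (\<Sum>k<m. s ^ k *\<^sub>R (if k < m then c k else 0))"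
      using assms(2) by (intro sum.mono_neutral_right) auto
    then show ?thesis
      using c by simp
  qed
  then show ?thesis
    unfolding vpoly_def by (intro exI[of _ "\<lambda>k. if k < m then c k else 0"] allI)
qed

lemma vpoly_0: "vpoly n (\<lambda>s. 0)"
  unfolding vpoly_def by (intro exI[of _ "\<lambda>_. 0"]) simp

lemma vpoly_add:
  assumes "vpoly n f" "vpoly n g"
  shows "vpoly n (\<lambda>s. f s + g s)"
proof -
  obtain c d where "\<And>s. f s = (\<Sum>k<n. s ^ k *\<^sub>R c k)" "\<And>s. g s = (\<Sum>k<n. s ^ k *\<^sub>R d k)"
    using assms unfolding vpoly_def by blast
  then show ?thesis
    unfolding vpoly_def
    by (intro exI[of _ "\<lambda>k. c k + d k"]) (simp add: scaleR_add_right sum.distrib)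
qed

lemma vpoly_bounded_linear:
  assumes "vpoly n f" "bounded_linear B"
  shows "vpoly n (\<lambda>s. B (f s))"
proof -
  obtain c where c: "\<And>s. f s = (\<Sum>k<n. s ^ k *\<^sub>R c k)"
    using assms(1) unfolding vpoly_def by blast
  interpret bounded_linear B by fact
  show ?thesis
    unfolding vpoly_def by (intro exI[of _ "\<lambda>k. B (c k)"]) (simp add: c sum scaleR)
qed

lemma vpoly_scaleR: "vpoly n f \<Longrightarrow> vpoly n (\<lambda>s. r *\<^sub>R f s)"
  by (rule vpoly_bounded_linear[OF _ bounded_linear_scaleR_right])

lemma vpoly_diff: "vpoly n f \<Longrightarrow> vpoly n g \<Longrightarrow> vpoly n (\<lambda>s. f s - g s)"
  using vpoly_add[of n f "\<lambda>s. (-1) *\<^sub>R g s"] vpoly_scaleR[of n g "-1"] by simp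

lemma vpoly_sum:
  "(\<And>i. i \<in> I \<Longrightarrow> vpoly n (f i)) \<Longrightarrow> vpoly n (\<lambda>s. \<Sum>i\<in>I. f i s)"
  by (induction I rule: infinite_finite_induct) (auto intro: vpoly_0 vpoly_add)

lemma vpoly_monomial: "k < n \<Longrightarrow> vpoly n (\<lambda>s. s ^ k *\<^sub>R c)"
  unfolding vpoly_def
  by (intro exI[of _ "\<lambda>j. if j = k then c else 0"]) (simp add: if_distrib cong: if_cong)

lemma vpoly_const: "0 < n \<Longrightarrow> vpoly n (\<lambda>s. c)"
  using vpoly_monomial[of 0 n c] by simp

text \<open>In terms of degrees the bound is (m - 1) + (n - 1), that is, m + n - 1 coefficients. If
  one factor has no coefficients, the product vanishes, so truncated subtraction does no
  harm.\<close>

lemma vpoly_bilinear: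
  assumes "vpoly m f" "vpoly n g" "bounded_bilinear B"
  shows "vpoly (m + n - 1) (\<lambda>s. B (f s) (g s))"
proof -
  obtain c d where c: "\<And>s. f s = (\<Sum>k<m. s ^ k *\<^sub>R c k)" and d: "\<And>s. g s = (\<Sum>k<n. s ^ k *\<^sub>R d k)"
    using assms(1,2) unfolding vpoly_def by blast
  interpret bounded_bilinear B by fact
  have "(\<lambda>s. B (f s) (g s)) = (\<lambda>s. \<Sum>k<m. \<Sum>l<n. s ^ (k + l) *\<^sub>R B (c k) (d l))"
    by (simp only: c d sum_left) (simp add: sum_right scaleR_left scaleR_right power_add mult.commute)
  moreover have "vpoly (m + n - 1) \<dots>"
    by (intro vpoly_sum vpoly_monomial) auto
  ultimately show ?thesis
    by simp
qed

lemma vpoly_mult: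
  fixes f g :: "real \<Rightarrow> real"
  shows "vpoly m f \<Longrightarrow> vpoly n g \<Longrightarrow> vpoly (m + n - 1) (\<lambda>s. f s * g s)"
  by (rule vpoly_bilinear[OF _ _ bounded_bilinear_mult])

lemma vpoly_scaleR_fun:
  "vpoly m f \<Longrightarrow> vpoly n g \<Longrightarrow> vpoly (m + n - 1) (\<lambda>s. f s *\<^sub>R g s)"
  by (rule vpoly_bilinear[OF _ _ bounded_bilinear_scaleR])

lemma vpoly_linear_factor: "vpoly 2 (\<lambda>s::real. (s - r) * c)"
proof -
  have "vpoly 2 (\<lambda>s. s ^ 1 *\<^sub>R c - s ^ 0 *\<^sub>R (r * c))"
    by (intro vpoly_diff vpoly_monomial) auto
  then show ?thesis
    by (simp add: algebra_simps)
qed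

lemma vpoly_prod_linear:
  assumes "finite I" "card I < n"
  shows "vpoly n (\<lambda>s::real. \<Prod>i\<in>I. (s - r i) * c i)"
  using assms
proof (induction I arbitrary: n rule: finite_induct)
  case empty
  then show ?case by (simp add: vpoly_const)
next
  case (insert i I)
  then obtain n' where n: "n = Suc n'" "card I < n'"
    by (cases n) auto
  have "vpoly (2 + n' - 1) (\<lambda>s. ((s - r i) * c i) * (\<Prod>i\<in>I. (s - r i) * c i))"
    using insert n by (intro vpoly_mult vpoly_linear_factor) auto
  then show ?case
    using insert n by simp
qed

lemma vpoly_has_derivative:
  assumes "vpoly n f"
  obtains f' where "vpoly (n - 1) f'" "\<And>t. (f has_vector_derivative f' t) (at t)"
proof -
  obtain c where c: "f = (\<lambda>s. \<Sum>k<n. s ^ k *\<^sub>R c k)"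
    using assms unfolding vpoly_def by blast
  let ?f' = "\<lambda>t. \<Sum>k<n. (real k * t ^ (k - 1)) *\<^sub>R c k"
  have "(f has_vector_derivative ?f' t) (at t)" for t
    unfolding c
    by (rule has_vector_derivative_sum) (auto intro!: derivative_eq_intros simp: has_real_derivative_iff_has_vector_derivative[symmetric])
  moreover have "vpoly (n - 1) ?f'"
  proof (rule vpoly_sum)
    fix k assume "k \<in> {..<n}"
    then have "k = 0 \<or> k - 1 < n - 1"
      by auto
    then show "vpoly (n - 1) (\<lambda>t. (real k * t ^ (k - 1)) *\<^sub>R c k)"
    proof
      assume "k = 0"
      then show ?thesis
        using vpoly_0 by simp
    next
      assume "k - 1 < n - 1"
      then show ?thesis
        using vpoly_monomial[of "k - 1" "n - 1" "real k *\<^sub>R c k"] by (simp add: mult.commute)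
    qed
  qed
  ultimately show ?thesis
    using that by blast
qed

text \<open>This tower is subtracted from the derivatives of a smooth function in the Rolle
  argument. At j = n no coefficient is left, so there the polynomial drops out.\<close>

lemma vpoly_chain:
  assumes "vpoly n f"
  obtains P where "P 0 = f" "\<And>j. vpoly (n - j) (P j)"
    "\<And>j t. (P j has_vector_derivative P (Suc j) t) (at t)"
proof -
  define d where "d g = (\<lambda>t. vector_derivative g (at t))" for g :: "real \<Rightarrow> 'a"
  have d: "vpoly (m - 1) (d g) \<and> (g has_vector_derivative d g t) (at t)" if g: "vpoly m g" for g m t
  proof -
    obtain g' where g': "vpoly (m - 1) g'" "\<And>t. (g has_vector_derivative g' t) (at t)"
      using vpoly_has_derivative[OF g] by blast
    then have "d g = g'"
      by (auto simp: d_def vector_derivative_at)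
    then show ?thesis
      using g' by simp
  qed
  have P: "vpoly (n - j) ((d ^^ j) f)" for j
  proof (induction j)
    case 0
    then show ?case using assms by simp
  next
    case (Suc j)
    then show ?case using d[of "n - j" "(d ^^ j) f"] by simp
  qed
  show ?thesis
  proof (rule that[of "\<lambda>j. (d ^^ j) f"])
    show "((d ^^ j) f has_vector_derivative (d ^^ Suc j) f t) (at t)" for j t
      using d[OF P[of j]] by simp
  qed (use P in auto)
qed

lemma vpoly_continuous_on:
  assumes "vpoly n f"
  shows "continuous_on S f"
proof -
  obtain c where "f = (\<lambda>s. \<Sum>k<n. s ^ k *\<^sub>R c k)"
    using assms unfolding vpoly_def by blast
  then show ?thesis
    by (auto intro!: continuous_intros)
qed

text \<open>The bridge to the library type, in which root counting and the exactness of the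
  quadrature rule are stated.\<close>

lemma vpoly_real_poly:
  fixes f :: "real \<Rightarrow> real"
  assumes "vpoly (Suc n) f"
  obtains p where "degree p \<le> n" "f = poly p"
proof -
  obtain c where c: "f = (\<lambda>s. \<Sum>k<Suc n. s ^ k *\<^sub>R c k)"
    using assms unfolding vpoly_def by blast
  show ?thesis
  proof (rule that[of "\<Sum>k<Suc n. monom (c k) k"])
    show "degree (\<Sum>k<Suc n. monom (c k) k) \<le> n"
      by (rule degree_sum_le) (auto intro: order.trans[OF degree_monom_le])
    show "f = poly (\<Sum>k<Suc n. monom (c k) k)"
      by (auto simp: c poly_sum poly_monom mult.commute)
  qed
qed

text \<open>Pairing with the fixed vector \<open>f t\<close>, whose vanishing is claimed, leaves the
  root bound for one real polynomial.\<close>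

lemma vpoly_zero_at_nodes:
  fixes f :: "real \<Rightarrow> 'a::real_inner"
  assumes f: "vpoly n f" and N: "finite N" "n \<le> card N" and z: "\<And>x. x \<in> N \<Longrightarrow> f x = 0"
  shows "f t = 0"
proof (cases n)
  case 0
  then show ?thesis using f by (simp add: vpoly_def)
next
  case (Suc m)
  have "vpoly n (\<lambda>s. inner (f s) (f t))"
    using vpoly_bounded_linear[OF f bounded_linear_inner_left] .
  then obtain p where p: "degree p \<le> m" "(\<lambda>s. inner (f s) (f t)) = poly p"
    using vpoly_real_poly Suc by metis
  have "p = 0"
  proof (rule ccontr)
    assume "p \<noteq> 0"
    have "poly p x = 0" if "x \<in> N" for x
      using z[OF that] p(2)[symmetric] by simp
    then have "N \<subseteq> {x. poly p x = 0}"
      by blast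
    then have "card N \<le> card {x. poly p x = 0}"
      by (rule card_mono[OF poly_roots_finite[OF \<open>p \<noteq> 0\<close>]])
    also have "\<dots> \<le> degree p"
      using \<open>p \<noteq> 0\<close> by (rule card_poly_roots_bound)
    finally show False
      using p N Suc by simp
  qed
  then have "inner (f t) (f t) = 0"
    using p(2) by (metis poly_0)
  then show ?thesis
    by simp
qed

section \<open>Interpolation errors\<close>

lemma rolle_many:
  fixes f f' :: "real \<Rightarrow> real"
  assumes f: "\<And>t. (f has_real_derivative f' t) (at t)"
    and x: "\<And>i. i < n \<Longrightarrow> x i < x (Suc i)" "\<And>i. i \<le> n \<Longrightarrow> x i \<in> {a..b} \<and> f (x i) = 0"
  shows "\<exists>y. (\<forall>i. Suc i < n \<longrightarrow> y i < y (Suc i)) \<and> (\<forall>i<n. y i \<in> {a..b} \<and> f' (y i) = 0)"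
proof -
  have "\<exists>z. x i < z \<and> z < x (Suc i) \<and> f' z = 0" if "i < n" for i
  proof -
    have "\<exists>z>x i. z < x (Suc i) \<and> f' z = 0"
    proof (rule Rolle_deriv[of "x i" "x (Suc i)" f "\<lambda>t h. f' t * h", THEN exE])
      show "x i < x (Suc i)" "f (x i) = f (x (Suc i))"
        using x that by auto
      show "continuous_on {x i..x (Suc i)} f"
        using f by (meson DERIV_isCont continuous_at_imp_continuous_on)
      show "(f has_derivative (\<lambda>h. f' t * h)) (at t)" for t
        using f[of t] by (simp add: has_field_derivative_def)
    qed (metis mult_1_right)
    then show ?thesis by blast
  qed
  then obtain y where y: "\<And>i. i < n \<Longrightarrow> x i < y i \<and> y i < x (Suc i) \<and> f' (y i) = 0"
    by metis
  show ?thesis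
  proof (intro exI[of _ y] conjI allI impI)
    show "y i < y (Suc i)" if "Suc i < n" for i
      using y[of i] y[of "Suc i"] that by auto
    show "y i \<in> {a..b}" "f' (y i) = 0" if "i < n" for i
      using y[of i] x(2)[of i] x(2)[of "Suc i"] that by auto
  qed
qed

text \<open>Every differentiation costs one zero: the n zeros of \<open>g 0\<close> leave n - j
  distinct zeros of \<open>g j\<close>.\<close>

lemma rolle_chain:
  fixes g :: "nat \<Rightarrow> real \<Rightarrow> real"
  assumes g: "\<And>j t. j < n \<Longrightarrow> (g j has_real_derivative g (Suc j) t) (at t)"
    and x: "\<And>i. Suc i < n \<Longrightarrow> x i < x (Suc i)" "\<And>i. i < n \<Longrightarrow> x i \<in> {a..b} \<and> g 0 (x i) = 0"
    and "j < n"
  shows "\<exists>z\<in>{a..b}. g j z = 0"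
proof -
  have "\<exists>y. (\<forall>i. Suc i < n - j \<longrightarrow> y i < y (Suc i)) \<and> (\<forall>i<n - j. y i \<in> {a..b} \<and> g j (y i) = 0)"
    using \<open>j < n\<close>
  proof (induction j)
    case 0
    then show ?case using x by auto
  next
    case (Suc j)
    then obtain y where y: "\<And>i. Suc i < n - j \<Longrightarrow> y i < y (Suc i)"
        "\<And>i. i < n - j \<Longrightarrow> y i \<in> {a..b} \<and> g j (y i) = 0"
      by auto
    show ?case
    proof (rule rolle_many[of "g j" "g (Suc j)" "n - Suc j" y a b])
      show "(g j has_real_derivative g (Suc j) t) (at t)" for t
        using g[of j] Suc by simp
      show "y i < y (Suc i)" if "i < n - Suc j" for i
        using y(1)[of i] that by simp
      show "y i \<in> {a..b} \<and> g j (y i) = 0" if "i \<le> n - Suc j" for i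
        using y(2)[of i] that Suc.prems by simp
    qed
  qed
  then show ?thesis
    using \<open>j < n\<close> by (metis zero_less_diff)
qed

text \<open>Going down from order n, each derivative is estimated by the mean value theorem from a
  zero supplied by Rolle, at the price of one factor b - a. Rolle fails for vector values, so
  everything is paired with the fixed vector \<open>G j t\<close>. The zeros may depend on this
  vector and on the nodes, the bound does not.\<close>

lemma interpolation_error:
  fixes G :: "nat \<Rightarrow> real \<Rightarrow> 'a::real_inner"
  assumes G: "\<And>j t. j < n \<Longrightarrow> (G j has_vector_derivative G (Suc j) t) (at t)"
    and x: "\<And>i. Suc i < n \<Longrightarrow> x i < x (Suc i)" "\<And>i. i < n \<Longrightarrow> x i \<in> {a..b} \<and> G 0 (x i) = 0"
    and K: "\<And>t. t \<in> {a..b} \<Longrightarrow> norm (G n t) \<le> K"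
    and j: "j \<le> n" and t: "t \<in> {a..b}"
  shows "norm (G j t) \<le> (b - a) ^ (n - j) * K"
proof -
  define y where "y = G j t"
  define g where "g i t = inner (G i t) y" for i t
  have g: "(g i has_real_derivative g (Suc i) t) (at t)" if "i < n" for i t
    unfolding has_real_derivative_iff_has_vector_derivative g_def
    by (rule bounded_linear.has_vector_derivative[OF bounded_linear_inner_left G[OF that]])
  have K0: "0 \<le> K"
    using K[OF t] norm_ge_zero order_trans by blast
  have "\<forall>t\<in>{a..b}. \<bar>g (n - d) t\<bar> \<le> (b - a) ^ d * (K * norm y)" if "d \<le> n" for d
    using that
  proof (induction d)
    case 0
    have "\<bar>g n t\<bar> \<le> K * norm y" if "t \<in> {a..b}" for t
      unfolding g_def using K[OF that] Cauchy_Schwarz_ineq2[of "G n t" y]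
      by (meson mult_right_mono norm_ge_zero order_trans)
    then show ?case by simp
  next
    case (Suc d)
    let ?j = "n - Suc d"
    have Sj: "Suc ?j = n - d" "?j < n"
      using Suc.prems by auto
    obtain z where z: "z \<in> {a..b}" "g ?j z = 0"
      using rolle_chain[of n g x a b ?j] g x Sj by (auto simp: g_def)
    show ?case
    proof
      fix t assume t: "t \<in> {a..b}"
      have "\<bar>g ?j t - g ?j z\<bar> \<le> (b - a) ^ d * (K * norm y) * \<bar>t - z\<bar>"
      proof (rule field_differentiable_bound[of "{a..b}" "g ?j" "g (n - d)", unfolded real_norm_def])
        show "(g ?j has_real_derivative g (n - d) u) (at u within {a..b})" for u
          using g[OF Sj(2)] Sj(1) has_field_derivative_at_within by metis
        show "\<bar>g (n - d) u\<bar> \<le> (b - a) ^ d * (K * norm y)" if "u \<in> {a..b}" for u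
          using Suc that by simp
      qed (use t z in auto)
      also have "\<dots> \<le> (b - a) ^ d * (K * norm y) * (b - a)"
        using t z(1) K0 by (intro mult_left_mono) auto
      finally show "\<bar>g ?j t\<bar> \<le> (b - a) ^ Suc d * (K * norm y)"
        using z(2) by (simp add: mult_ac)
    qed
  qed
  from this[of "n - j"] t j have "\<bar>g j t\<bar> \<le> (b - a) ^ (n - j) * K * norm y"
    by (simp add: mult.assoc)
  then have "norm y * norm y \<le> (b - a) ^ (n - j) * K * norm y"
    by (simp add: g_def y_def flip: power2_norm_eq_inner power2_eq_square)
  then have "norm y \<le> (b - a) ^ (n - j) * K"
    using t K0 by (cases "norm y = 0") auto
  then show ?thesis
    by (simp add: y_def)
qed

section \<open>Lagrange interpolation of vector values\<close>

text \<open>Each factor is a linear polynomial times a constant, the form expected by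
  \<open>vpoly_prod_linear\<close>.\<close>

definition lagrange :: "(nat \<Rightarrow> real) \<Rightarrow> nat \<Rightarrow> nat \<Rightarrow> real \<Rightarrow> real" where
  "lagrange s n i t = (\<Prod>j\<in>{..<n} - {i}. (t - s j) * (1 / (s i - s j)))"

lemma vpoly_lagrange: "i < n \<Longrightarrow> vpoly n (lagrange s n i)"
  unfolding lagrange_def by (rule vpoly_prod_linear) auto

lemma lagrange_at_node:
  assumes "inj_on s {..<n}" "i < n" "k < n"
  shows "lagrange s n i (s k) = (if k = i then 1 else 0)"
proof (cases "k = i")
  case True
  have "(s i - s j) * (1 / (s i - s j)) = 1" if "j \<in> {..<n} - {i}" for j
    using that assms by (auto simp: inj_on_def)
  then show ?thesis
    using True by (simp add: lagrange_def)
next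
  case False
  then show ?thesis
    using assms unfolding lagrange_def by (auto intro!: prod_zero)
qed

lemma interpolating_vpoly_exists:
  assumes "inj_on s {..<n}"
  obtains f where "vpoly n f" "\<And>i. i < n \<Longrightarrow> f (s i) = v i"
proof (rule that)
  show "vpoly n (\<lambda>t. \<Sum>i<n. lagrange s n i t *\<^sub>R v i)"
  proof (rule vpoly_sum)
    show "vpoly n (\<lambda>t. lagrange s n i t *\<^sub>R v i)" if "i \<in> {..<n}" for i
      using that by (intro vpoly_bounded_linear[OF vpoly_lagrange bounded_linear_scaleR_left]) auto
  qed
  show "(\<Sum>i<n. lagrange s n i (s k) *\<^sub>R v i) = v k" if "k < n" for k
  proof -
    have "(\<Sum>i<n. lagrange s n i (s k) *\<^sub>R v i) = (\<Sum>i<n. if i = k then v k else 0)"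
      using that by (intro sum.cong) (auto simp: lagrange_at_node[OF assms])
    then show ?thesis using that by simp
  qed
qed

lemma lagrange_interpolation:
  fixes f :: "real \<Rightarrow> 'a::real_inner"
  assumes f: "vpoly n f" and s: "inj_on s {..<n}"
  shows "f t = (\<Sum>i<n. lagrange s n i t *\<^sub>R f (s i))"
proof -
  let ?g = "\<lambda>t. f t - (\<Sum>i<n. lagrange s n i t *\<^sub>R f (s i))"
  have "?g t = 0"
  proof (rule vpoly_zero_at_nodes)
    show "vpoly n ?g"
    proof (intro vpoly_diff f vpoly_sum)
      show "vpoly n (\<lambda>t. lagrange s n i t *\<^sub>R f (s i))" if "i \<in> {..<n}" for i
        using that by (intro vpoly_bounded_linear[OF vpoly_lagrange bounded_linear_scaleR_left]) auto
    qed
    show "n \<le> card (s ` {..<n})"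
      using s by (simp add: card_image)
    show "?g x = 0" if "x \<in> s ` {..<n}" for x
    proof -
      obtain k where k: "k < n" "x = s k" using \<open>x \<in> s ` {..<n}\<close> by auto
      have "(\<Sum>i<n. lagrange s n i (s k) *\<^sub>R f (s i)) = (\<Sum>i<n. if i = k then f (s k) else 0)"
        using k by (intro sum.cong) (auto simp: lagrange_at_node[OF s])
      then show ?thesis using k by simp
    qed
  qed simp
  then show ?thesis by simp
qed

section \<open>An inverse estimate\<close>

text \<open>The first factor is the ratio of the interval to one of its sample intervals. The
  squared factor bounds the sum of n Lagrange polynomials, each of modulus at most
  \<open>(2 * real n) ^ (n - 1)\<close>.\<close>

definition inverse_const :: "nat \<Rightarrow> real" where
  "inverse_const n = 2 * real n * (real n * (2 * real n) ^ (n - 1))\<^sup>2"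

text \<open>
  Interpolating at points that minimise the modulus over well separated subintervals makes the
  constant explicit.
\<close>

lemma inverse_estimate:
  fixes p :: "real \<Rightarrow> real"
  assumes p: "vpoly n p" and n: "0 < n" and ab: "a < b" and x: "x \<in> {a..b}"
  shows "(p x)\<^sup>2 \<le> inverse_const n / (b - a) * integral {a..b} (\<lambda>t. (p t)\<^sup>2)"
proof -
  define h where "h = (b - a) / (2 * real n)"
  have h: "h > 0" "b - a = 2 * real n * h"
    using ab n by (auto simp: h_def)
  \<comment> \<open>The sample intervals \<open>{l j..r j}\<close> have length h and gaps of length
    h between them, so points of different ones are at least h apart.\<close>
  define l r where "l j = a + 2 * real j * h" and "r j = a + (2 * real j + 1) * h" for j
  have lr: "l j \<le> r j" "r j - l j = h" for j
    using h by (auto simp: l_def r_def algebra_simps)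
  have sub: "a \<le> l j" "r j \<le> b" if "j < n" for j
  proof -
    show "a \<le> l j" using h by (simp add: l_def)
    have "(2 * real j + 1) * h \<le> 2 * real n * h"
      using that h by (intro mult_right_mono) auto
    then show "r j \<le> b" using h(2) by (simp add: r_def)
  qed
  have cont: "continuous_on S (\<lambda>t. (p t)\<^sup>2)" for S
    by (intro continuous_intros vpoly_continuous_on[OF p])
  have "\<exists>y\<in>{l j..r j}. \<forall>t\<in>{l j..r j}. (p y)\<^sup>2 \<le> (p t)\<^sup>2" for j
    using lr[of j] by (intro continuous_attains_inf cont) auto
  then obtain y where y: "\<And>j. y j \<in> {l j..r j}" "\<And>j t. t \<in> {l j..r j} \<Longrightarrow> (p (y j))\<^sup>2 \<le> (p t)\<^sup>2"
    by metis
  define J where "J = integral {a..b} (\<lambda>t. (p t)\<^sup>2) / h"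
  have J0: "0 \<le> J"
    using h by (simp add: J_def integral_nonneg integrable_continuous_real cont)
  have py: "(p (y j))\<^sup>2 \<le> J" if "j < n" for j
  proof -
    have "h * (p (y j))\<^sup>2 = integral {l j..r j} (\<lambda>t. (p (y j))\<^sup>2)"
      using lr[of j] by simp
    also have "\<dots> \<le> integral {l j..r j} (\<lambda>t. (p t)\<^sup>2)"
      using y(2) by (intro integral_le integrable_continuous_real cont continuous_intros) auto
    also have "\<dots> \<le> integral {a..b} (\<lambda>t. (p t)\<^sup>2)"
      using sub[OF that] by (intro integral_subset_le integrable_continuous_real cont) auto
    finally show ?thesis
      using h by (simp add: J_def field_simps)
  qed
  have sep: "h \<le> \<bar>y i - y j\<bar>" if "i \<noteq> j" for i j
  proof -
    have *: "h \<le> y i - y j" if "j < i" for i j :: nat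
    proof -
      have "(real j + 1) * h \<le> real i * h"
        using that h by (intro mult_right_mono) auto
      then have "r j + h \<le> l i"
        by (simp add: l_def r_def algebra_simps)
      then show ?thesis
        using y(1)[of i] y(1)[of j] by auto
    qed
    show ?thesis
      using *[of i j] *[of j i] that by (cases "i < j") auto
  qed
  have inj: "inj_on y {..<n}"
  proof (rule inj_onI, rule ccontr)
    fix i j assume "y i = y j" "i \<noteq> j"
    then show False using sep[of i j] h by simp
  qed
  have lag: "\<bar>lagrange y n i x\<bar> \<le> (2 * real n) ^ (n - 1)" if i: "i < n" for i
  proof -
    have "\<bar>lagrange y n i x\<bar> = (\<Prod>j\<in>{..<n} - {i}. \<bar>(x - y j) * (1 / (y i - y j))\<bar>)"
      unfolding lagrange_def by (rule abs_prod)
    also have "\<dots> \<le> (\<Prod>j\<in>{..<n} - {i}. 2 * real n)"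
    proof (rule prod_mono)
      fix j assume j: "j \<in> {..<n} - {i}"
      have "\<bar>x - y j\<bar> \<le> 2 * real n * h"
        using x y(1)[of j] sub[of j] j h(2) by auto
      also have "\<dots> \<le> 2 * real n * \<bar>y i - y j\<bar>"
        using sep[of i j] j by (intro mult_left_mono) auto
      finally have "\<bar>x - y j\<bar> / \<bar>y i - y j\<bar> \<le> 2 * real n"
        using sep[of i j] j h by (simp add: divide_le_eq)
      then show "0 \<le> \<bar>(x - y j) * (1 / (y i - y j))\<bar> \<and> \<bar>(x - y j) * (1 / (y i - y j))\<bar> \<le> 2 * real n"
        by (simp add: abs_mult)
    qed
    also have "\<dots> = (2 * real n) ^ (n - 1)"
      using i by simp
    finally show ?thesis .
  qed
  have "\<bar>p x\<bar> = \<bar>\<Sum>i<n. lagrange y n i x * p (y i)\<bar>"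
    by (subst lagrange_interpolation[OF p inj, of x]) simp
  also have "\<dots> \<le> (\<Sum>i<n. \<bar>lagrange y n i x\<bar> * \<bar>p (y i)\<bar>)"
    using sum_abs[of "\<lambda>i. lagrange y n i x * p (y i)" "{..<n}"] by (simp only: abs_mult)
  also have "\<dots> \<le> (\<Sum>i<n. (2 * real n) ^ (n - 1) * sqrt J)"
  proof (intro sum_mono mult_mono lag)
    show "\<bar>p (y i)\<bar> \<le> sqrt J" if "i \<in> {..<n}" for i
      using real_sqrt_le_mono[OF py[of i]] that by simp
  qed auto
  also have "\<dots> = real n * (2 * real n) ^ (n - 1) * sqrt J"
    by simp
  finally have "\<bar>p x\<bar>\<^sup>2 \<le> (real n * (2 * real n) ^ (n - 1) * sqrt J)\<^sup>2"
    by (rule power_mono) simp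
  also have "\<dots> = (real n * (2 * real n) ^ (n - 1))\<^sup>2 * J"
    using J0 by (simp add: power_mult_distrib)
  also have "\<dots> = inverse_const n / (b - a) * integral {a..b} (\<lambda>t. (p t)\<^sup>2)"
    using h n by (simp add: J_def inverse_const_def)
  finally show ?thesis
    by simp
qed

section \<open>The form induced by \<open>M0\<close>\<close>

text \<open>Only semidefiniteness is available. Where the form degenerates, the error is controlled
  by coercivity together with \<open>M1\<close>.\<close>

locale psd_operator =
  fixes M0 :: "'h::real_inner \<Rightarrow> 'h"
  assumes selfadjoint: "selfadjoint_bounded M0"
    and nonneg: "0 \<le> inner (M0 x) x"
begin

abbreviation sqn :: "'h \<Rightarrow> real" where
  "sqn x \<equiv> inner (M0 x) x"

lemma bounded_linear_M0: "bounded_linear M0"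
  using selfadjoint by (simp add: selfadjoint_bounded_def)

lemma form_sym: "inner (M0 x) y = inner (M0 y) x"
  using selfadjoint by (simp add: selfadjoint_bounded_def inner_commute)

lemma bounded_bilinear_form: "bounded_bilinear (\<lambda>x y. inner (M0 x) y)"
  by (rule bounded_bilinear.comp1[OF bounded_bilinear_inner bounded_linear_M0])

sublocale form: bounded_bilinear "\<lambda>x y. inner (M0 x) y"
  by (rule bounded_bilinear_form)

lemma sqn_le: "sqn x \<le> onorm M0 * (norm x)\<^sup>2"
proof -
  have "sqn x \<le> norm (M0 x) * norm x"
    by (rule norm_cauchy_schwarz)
  also have "\<dots> \<le> (onorm M0 * norm x) * norm x"
    by (intro mult_right_mono onorm[OF bounded_linear_M0]) simp
  finally show ?thesis
    by (simp add: power2_eq_square mult_ac)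
qed

lemma sqn_add: "sqn (x + y) = sqn x + 2 * inner (M0 x) y + sqn y"
  by (simp add: form.add_left form.add_right form_sym[of y x])

lemma sqn_scaleR: "sqn (c *\<^sub>R x) = c\<^sup>2 * sqn x"
  by (simp add: form.scaleR_left form.scaleR_right power2_eq_square)

text \<open>Nonnegativity of the form at x - 2 l y. The free \<open>l\<close> decides how much of
  \<open>y\<close> can be absorbed elsewhere.\<close>

lemma form_young:
  assumes "l > 0"
  shows "inner (M0 x) y \<le> l * sqn y + sqn x / (4 * l)"
proof -
  have "0 \<le> sqn (x + (- 2 * l) *\<^sub>R y)"
    by (rule nonneg)
  also have "\<dots> = sqn x - 4 * l * inner (M0 x) y + 4 * l\<^sup>2 * sqn y"
    unfolding sqn_add sqn_scaleR by (simp add: form.scaleR_right)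
  finally have "4 * l * inner (M0 x) y \<le> 4 * l * (l * sqn y + sqn x / (4 * l))"
    using assms by (simp add: distrib_left power2_eq_square)
  then show ?thesis
    using assms by simp
qed

text \<open>The usual test vector makes the discriminant appear multiplied by \<open>sqn y\<close>,
  which is divided out; hence the strict hypothesis.\<close>

lemma form_Cauchy_Schwarz:
  assumes "sqn y > 0"
  shows "(inner (M0 x) y)\<^sup>2 \<le> sqn x * sqn y"
proof -
  have "0 \<le> sqn (sqn y *\<^sub>R x + (- inner (M0 x) y) *\<^sub>R y)"
    by (rule nonneg)
  also have "\<dots> = sqn y * (sqn x * sqn y - (inner (M0 x) y)\<^sup>2)"
    unfolding sqn_add sqn_scaleR
    by (simp add: form.scaleR_left form.scaleR_right power2_eq_square algebra_simps form_sym[of y x])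
  finally show ?thesis
    using assms by (simp add: zero_le_mult_iff)
qed

lemma sqn_add_le: "sqn (x + y) \<le> 2 * sqn x + 2 * sqn y"
  using form_young[of 1 "x" "y"] form_young[of "1/2" x y] by (simp add: sqn_add)

lemma vpoly_form: "vpoly m f \<Longrightarrow> vpoly n g \<Longrightarrow> vpoly (m + n - 1) (\<lambda>t. inner (M0 (f t)) (g t))"
  by (rule vpoly_bilinear[OF _ _ bounded_bilinear_form])

lemma form_has_derivative:
  assumes "(f has_vector_derivative f') (at t within S)" "(g has_vector_derivative g') (at t within S)"
  shows "((\<lambda>t. inner (M0 (f t)) (g t)) has_real_derivative inner (M0 (f t)) g' + inner (M0 f') (g t))
    (at t within S)"
  unfolding has_real_derivative_iff_has_vector_derivative
  by (rule form.has_vector_derivative[OF assms])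

text \<open>With y = \<open>f x\<close> frozen, the scalar estimate applies to the pairing of
  \<open>f t\<close> with y. Cauchy-Schwarz splits its square, and one factor \<open>sqn y\<close>
  cancels.\<close>

lemma sqn_inverse_estimate:
  assumes f: "vpoly (Suc n) f" and ab: "a < b" and x: "x \<in> {a..b}"
  shows "sqn (f x) \<le> inverse_const (Suc n) / (b - a) * integral {a..b} (\<lambda>t. sqn (f t))"
proof -
  define y where "y = f x"
  have C: "0 \<le> inverse_const (Suc n) / (b - a)"
    using ab by (simp add: inverse_const_def)
  have int: "(\<lambda>t. sqn (f t)) integrable_on {a..b}"
    by (intro integrable_continuous_real vpoly_continuous_on[OF vpoly_form[OF f f]])
  have p: "vpoly (Suc n) (\<lambda>t. inner (M0 (f t)) y)"
    using vpoly_form[OF f vpoly_const[of 1 y]] by simp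
  show ?thesis
  proof (cases "sqn y > 0")
    case True
    have "(sqn y)\<^sup>2 \<le> inverse_const (Suc n) / (b - a) * integral {a..b} (\<lambda>t. (inner (M0 (f t)) y)\<^sup>2)"
      using inverse_estimate[OF p _ ab x] by (simp add: y_def)
    also have "\<dots> \<le> inverse_const (Suc n) / (b - a) * integral {a..b} (\<lambda>t. sqn (f t) * sqn y)"
      using form_Cauchy_Schwarz[OF True] C int
      by (intro mult_left_mono integral_le integrable_continuous_real continuous_intros
          vpoly_continuous_on[OF p] vpoly_continuous_on[OF vpoly_form[OF f f]]) auto
    also have "\<dots> = inverse_const (Suc n) / (b - a) * integral {a..b} (\<lambda>t. sqn (f t)) * sqn y"
      by simp
    finally have "sqn y \<le> inverse_const (Suc n) / (b - a) * integral {a..b} (\<lambda>t. sqn (f t))"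
      using True unfolding power2_eq_square by (rule mult_right_le_imp_le)
    then show ?thesis
      by (simp add: y_def)
  next
    case False
    then have "sqn y \<le> 0" by simp
    also have "0 \<le> inverse_const (Suc n) / (b - a) * integral {a..b} (\<lambda>t. sqn (f t))"
      using C int by (intro mult_nonneg_nonneg integral_nonneg nonneg)
    finally show ?thesis
      by (simp add: y_def)
  qed
qed

end

section \<open>One time step\<close>

text \<open>The rule on the actual time step: \<open>W\<close> contains the factor step / 2, the
  weight is normalised to 1 at \<open>a\<close>, and 2q + 1 coefficients mean degree 2q.\<close>

locale radau =
  fixes \<rho> a b :: real and q :: nat and s W :: "nat \<Rightarrow> real"
  assumes rho: "0 < \<rho>"
    and ab: "a < b"
    and first_node: "a < s 0"
    and nodes_less: "i < q \<Longrightarrow> s i < s (Suc i)"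
    and last_node: "s q = b"
    and exact: "vpoly (2 * q + 1) p \<Longrightarrow>
      ((\<lambda>t. exp (- 2 * \<rho> * (t - a)) * p t) has_integral (\<Sum>i\<le>q. W i * p (s i))) {a..b}"
begin

abbreviation e :: "real \<Rightarrow> real" where
  "e t \<equiv> exp (- 2 * \<rho> * (t - a))"

abbreviation Q :: "(real \<Rightarrow> real) \<Rightarrow> real" where
  "Q v \<equiv> \<Sum>i\<le>q. W i * v (s i)"

lemma nodes_strict: "i < j \<Longrightarrow> j \<le> q \<Longrightarrow> s i < s j"
proof (induction j)
  case (Suc j)
  then show ?case
    using nodes_less[of j] by (cases "i = j") auto
qed simp

lemma node_in: "i \<le> q \<Longrightarrow> s i \<in> {a<..b}"
  using nodes_strict[of 0 i] nodes_strict[of i q] first_node last_node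
  by (cases "i = 0"; cases "i = q") auto

lemma inj_nodes: "inj_on s {..<Suc q}"
  by (rule inj_onI) (metis lessThan_iff less_Suc_eq_le nodes_strict less_irrefl linorder_neqE_nat)

lemma e_le_1: "t \<in> {a..b} \<Longrightarrow> e t \<le> 1"
  using rho by simp

lemma e_ge: "t \<in> {a..b} \<Longrightarrow> e b \<le> e t"
  using rho by simp

text \<open>The square of a Lagrange polynomial has degree 2q, so it is integrated exactly, and its
  quadrature sum reduces to the single weight \<open>W i\<close>.\<close>

lemma weight_nonneg:
  assumes i: "i \<le> q"
  shows "0 \<le> W i"
proof -
  let ?l = "lagrange s (Suc q) i"
  have "vpoly (2 * q + 1) (\<lambda>t. ?l t * ?l t)"
    using vpoly_mult[OF vpoly_lagrange[of i "Suc q" s] vpoly_lagrange[of i "Suc q" s]] i by (simp add: mult_2)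
  from exact[OF this] have "0 \<le> Q (\<lambda>t. ?l t * ?l t)"
    by (rule has_integral_nonneg) simp
  also have "\<dots> = (\<Sum>k\<le>q. if k = i then W i else 0)"
    using i by (intro sum.cong) (auto simp: lagrange_at_node[OF inj_nodes])
  also have "\<dots> = W i"
    using i by simp
  finally show ?thesis .
qed

lemma Q_mono: "(\<And>i. i \<le> q \<Longrightarrow> f (s i) \<le> g (s i)) \<Longrightarrow> Q f \<le> Q g"
  by (intro sum_mono mult_left_mono weight_nonneg) auto

lemma sum_weights: "(\<Sum>i\<le>q. W i) \<le> b - a"
proof -
  have "vpoly (2 * q + 1) (\<lambda>t. 1::real)"
    by (rule vpoly_const) simp
  from exact[OF this] have "(e has_integral (\<Sum>i\<le>q. W i)) {a..b}"
    by simp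
  moreover have "((\<lambda>t. 1) has_integral (b - a)) {a..b}"
    using has_integral_const_real[of "1::real" a b] ab by simp
  ultimately show ?thesis
    by (rule has_integral_le) (use e_le_1 in auto)
qed

lemma weighted_ftc:
  assumes "\<And>t. (f has_real_derivative f' t) (at t)"
  shows "((\<lambda>t. e t * (f' t - 2 * \<rho> * f t)) has_integral e b * f b - f a) {a..b}"
proof -
  have "((\<lambda>t. e t * (f' t - 2 * \<rho> * f t)) has_integral e b * f b - e a * f a) {a..b}"
    by (rule fundamental_theorem_of_calculus)
      (use ab in \<open>auto intro!: derivative_eq_intros has_field_derivative_at_within[OF assms] simp: has_real_derivative_iff_has_vector_derivative[symmetric] algebra_simps\<close>)
  then show ?thesis
    by simp
qed

end

locale radau_step = radau \<rho> a b q s W + psd_operator M0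
  for \<rho> a b :: real and q s W and M0 :: "'h::real_inner \<Rightarrow> 'h"
begin

lemma vpoly_form':
  "vpoly m f \<Longrightarrow> vpoly n g \<Longrightarrow> m + n \<le> 2 * q + 2 \<Longrightarrow> vpoly (2 * q + 1) (\<lambda>t. inner (M0 (f t)) (g t))"
  by (rule vpoly_mono[OF vpoly_form]) auto

lemma exact_form:
  "vpoly m f \<Longrightarrow> vpoly n g \<Longrightarrow> m + n \<le> 2 * q + 2 \<Longrightarrow>
    ((\<lambda>t. e t * inner (M0 (f t)) (g t)) has_integral Q (\<lambda>t. inner (M0 (f t)) (g t))) {a..b}"
  by (rule exact[OF vpoly_form'])

text \<open>\<open>D\<close> vanishes at every node, in particular at \<open>b\<close>. The pairing
  of \<open>D\<close> with the derivative of \<open>f\<close> has degree 2q, so its integral equals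
  its quadrature sum, which is zero. The pairing of \<open>D\<close> with \<open>f\<close> has
  degree 2q + 1 and therefore stays an integral.\<close>

lemma quadrature_by_parts:
  assumes D: "vpoly (q + 2) D" "\<And>t. (D has_vector_derivative D' t) (at t)" "vpoly (q + 1) D'"
    and D0: "\<And>i. i \<le> q \<Longrightarrow> D (s i) = 0"
    and f: "vpoly (q + 1) f"
  shows "((\<lambda>t. e t * (2 * \<rho> * inner (M0 (D t)) (f t))) has_integral
    Q (\<lambda>t. inner (M0 (D' t)) (f t)) + inner (M0 (D a)) (f a)) {a..b}"
proof -
  obtain f' where f': "vpoly q f'" "\<And>t. (f has_vector_derivative f' t) (at t)"
    using vpoly_has_derivative[OF f] by auto
  have "((\<lambda>t. e t * (inner (M0 (D t)) (f' t) + inner (M0 (D' t)) (f t) - 2 * \<rho> * inner (M0 (D t)) (f t)))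
      has_integral e b * inner (M0 (D b)) (f b) - inner (M0 (D a)) (f a)) {a..b}"
    by (rule weighted_ftc[OF form_has_derivative[OF D(2) f'(2)]])
  moreover have "D b = 0"
    using D0[of q] last_node by simp
  moreover have "((\<lambda>t. e t * inner (M0 (D t)) (f' t)) has_integral 0) {a..b}"
    using exact_form[OF D(1) f'(1)] D0 by (simp add: form.zero_left)
  moreover have "((\<lambda>t. e t * inner (M0 (D' t)) (f t)) has_integral Q (\<lambda>t. inner (M0 (D' t)) (f t))) {a..b}"
    using exact_form[OF D(3) f] by simp
  ultimately have "((\<lambda>t. e t * inner (M0 (D t)) (f' t) + e t * inner (M0 (D' t)) (f t) -
      e t * (inner (M0 (D t)) (f' t) + inner (M0 (D' t)) (f t) - 2 * \<rho> * inner (M0 (D t)) (f t))) has_integral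
      0 + Q (\<lambda>t. inner (M0 (D' t)) (f t)) - (e b * 0 - inner (M0 (D a)) (f a))) {a..b}"
    by (intro has_integral_add has_integral_diff) (simp_all add: form.zero_left)
  then show ?thesis
    by (simp add: algebra_simps)
qed

text \<open>The pairing of the derivative with \<open>f\<close> is half the derivative of
  \<open>sqn (f t)\<close>, and both have degree at most 2q. So the energy identity of the
  continuous problem holds for the quadrature without error; the \<rho> term comes from
  differentiating the weight.\<close>

lemma quadrature_energy:
  assumes f: "vpoly (q + 1) f" "\<And>t. (f has_vector_derivative f' t) (at t)" "vpoly q f'"
  shows "Q (\<lambda>t. inner (M0 (f' t)) (f t)) = (e b * sqn (f b) - sqn (f a)) / 2 + \<rho> * Q (\<lambda>t. sqn (f t))"
proof -
  have "((\<lambda>t. e t * (inner (M0 (f t)) (f' t) + inner (M0 (f' t)) (f t) - 2 * \<rho> * sqn (f t)))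
      has_integral e b * sqn (f b) - sqn (f a)) {a..b}"
    by (rule weighted_ftc[OF form_has_derivative[OF f(2) f(2)]])
  moreover have "((\<lambda>t. 2 * (e t * inner (M0 (f' t)) (f t)) - 2 * \<rho> * (e t * sqn (f t))) has_integral
      2 * Q (\<lambda>t. inner (M0 (f' t)) (f t)) - 2 * \<rho> * Q (\<lambda>t. sqn (f t))) {a..b}"
    using exact_form[OF f(3) f(1)] exact_form[OF f(1) f(1)]
    by (intro has_integral_diff has_integral_mult_right) auto
  moreover have "e t * (inner (M0 (f t)) (f' t) + inner (M0 (f' t)) (f t) - 2 * \<rho> * sqn (f t)) =
      2 * (e t * inner (M0 (f' t)) (f t)) - 2 * \<rho> * (e t * sqn (f t))" for t
    by (simp add: form_sym[of "f t" "f' t"] algebra_simps)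
  ultimately have "e b * sqn (f b) - sqn (f a) =
      2 * Q (\<lambda>t. inner (M0 (f' t)) (f t)) - 2 * \<rho> * Q (\<lambda>t. sqn (f t))"
    by (metis (no_types, lifting) has_integral_unique has_integral_eq)
  then show ?thesis
    by (simp add: field_simps)
qed

end

context radau_step begin

text \<open>The weight is smallest at \<open>b\<close>, hence the division by \<open>e b\<close>;
  the degree 2q still allows the integral to be replaced by the quadrature sum.\<close>

lemma weighted_inverse_estimate:
  assumes f: "vpoly (q + 1) f" and t: "t \<in> {a..b}"
  shows "sqn (f t) \<le> inverse_const (q + 1) / e b / (b - a) * Q (\<lambda>t. sqn (f t))"
proof -
  have ex: "((\<lambda>t. e t * sqn (f t)) has_integral Q (\<lambda>t. sqn (f t))) {a..b}"
    by (rule exact_form[OF f f]) simp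
  have C: "0 \<le> inverse_const (q + 1) / (b - a)"
    using ab by (simp add: inverse_const_def)
  have "integral {a..b} (\<lambda>t. sqn (f t)) \<le> integral {a..b} (\<lambda>t. (e t * sqn (f t)) * (1 / e b))"
  proof (rule integral_le)
    show "(\<lambda>t. sqn (f t)) integrable_on {a..b}"
      by (intro integrable_continuous_real vpoly_continuous_on[OF vpoly_form[OF f f]])
    show "(\<lambda>t. (e t * sqn (f t)) * (1 / e b)) integrable_on {a..b}"
      using ex by (intro integrable_on_mult_left) auto
    fix t assume "t \<in> {a..b}"
    then have "sqn (f t) * e b \<le> sqn (f t) * e t"
      by (intro mult_left_mono e_ge nonneg)
    then show "sqn (f t) \<le> (e t * sqn (f t)) * (1 / e b)"
      by (simp add: pos_le_divide_eq mult.commute)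
  qed
  also have "\<dots> = Q (\<lambda>t. sqn (f t)) / e b"
    using integral_unique[OF ex] by simp
  finally have "inverse_const (q + 1) / (b - a) * integral {a..b} (\<lambda>t. sqn (f t)) \<le>
      inverse_const (q + 1) / (b - a) * (Q (\<lambda>t. sqn (f t)) / e b)"
    using C by (rule mult_left_mono)
  then show ?thesis
    using sqn_inverse_estimate[of q f a b t] f ab t by (simp add: mult_ac)
qed

text \<open>
  The degree is one too large for exactness. Splitting off the interpolant at all nodes but the
  last one leaves a remainder that vanishes at the nodes and is nonpositive in between.
\<close>

lemma radau_overestimates:
  assumes f: "vpoly (q + 1) f"
  shows "integral {a..b} (\<lambda>t. e t * ((t - a) * sqn (f t))) \<le> Q (\<lambda>t. (t - a) * sqn (f t))"
proof -
  have "inj_on s {..<q}"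
    by (rule inj_on_subset[OF inj_nodes]) auto
  then obtain g where g: "vpoly q g" "\<And>i. i < q \<Longrightarrow> g (s i) = f (s i)"
    using interpolating_vpoly_exists[of s q "\<lambda>i. f (s i)"] by blast
  define d where "d t = f t - g t" for t
  have d: "vpoly (q + 1) d"
    unfolding d_def by (rule vpoly_diff[OF f vpoly_mono[OF g(1)]]) simp
  have f_eq: "f t = g t + d t" for t
    by (simp add: d_def)
  \<comment> \<open>With t - a = (b - a) + (t - b), only the second summand can raise the degree
    beyond 2q. There the terms containing \<open>g\<close> have degree at most 2q - 1 before
    multiplication, so the excess sits in \<open>(t - b) * sqn (d t)\<close>.\<close>
  define p where "p t = (b - a) * sqn (f t) + (t - b) * inner (M0 (g t)) (g t + 2 *\<^sub>R d t)" for t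
  have split: "(t - a) * sqn (f t) = p t + (t - b) * sqn (d t)" for t
    unfolding p_def f_eq sqn_add by (simp add: form.add_right form.scaleR_right algebra_simps)
  have p: "vpoly (2 * q + 1) p"
  proof -
    have h: "vpoly (q + 1) (\<lambda>t. g t + 2 *\<^sub>R d t)"
      by (intro vpoly_add vpoly_mono[OF g(1)] vpoly_scaleR d) simp
    have "vpoly (q + (q + 1) - 1) (\<lambda>t. inner (M0 (g t)) (g t + 2 *\<^sub>R d t))"
      by (rule vpoly_form[OF g(1) h])
    then have "vpoly (2 + (q + (q + 1) - 1) - 1) (\<lambda>t. ((t - b) * 1) * inner (M0 (g t)) (g t + 2 *\<^sub>R d t))"
      by (intro vpoly_mult vpoly_linear_factor)
    moreover have "vpoly (2 * q + 1) (\<lambda>t. (b - a) *\<^sub>R sqn (f t))"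
      by (rule vpoly_scaleR[OF vpoly_form'[OF f f]]) simp
    ultimately show ?thesis
      unfolding p_def by (intro vpoly_add) (simp_all add: mult_2)
  qed
  have cont: "continuous_on {a..b} (\<lambda>t. sqn (f t))"
    by (rule vpoly_continuous_on[OF vpoly_form[OF f f]])
  have "integral {a..b} (\<lambda>t. e t * ((t - a) * sqn (f t))) \<le> integral {a..b} (\<lambda>t. e t * p t)"
  proof (rule integral_le)
    show "(\<lambda>t. e t * ((t - a) * sqn (f t))) integrable_on {a..b}"
      by (intro integrable_continuous_real continuous_intros cont)
    show "(\<lambda>t. e t * p t) integrable_on {a..b}"
      using exact[OF p] by blast
    fix t assume "t \<in> {a..b}"
    then have "(t - b) * sqn (d t) \<le> 0"
      using nonneg by (intro mult_nonpos_nonneg) auto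
    then show "e t * ((t - a) * sqn (f t)) \<le> e t * p t"
      unfolding split by simp
  qed
  also have "\<dots> = Q p"
    by (rule integral_unique[OF exact[OF p]])
  also have "\<dots> = Q (\<lambda>t. (t - a) * sqn (f t))"
  proof (rule sum.cong)
    fix i assume "i \<in> {..q}"
    then have "i < q \<or> s i = b"
      using last_node by (cases "i = q") auto
    then have "(s i - b) * sqn (d (s i)) = 0"
      using g(2) by (auto simp: d_def form.zero_left)
    then show "W i * p (s i) = W i * ((s i - a) * sqn (f (s i)))"
      by (simp add: split)
  qed simp
  finally show ?thesis .
qed

end

section \<open>Stability of the discrete equation on one step\<close>

text \<open>Here \<open>f\<close> is the discrete error, \<open>z\<close> the error arriving from
  the left, and \<open>B\<close> the nodal values of \<open>M1\<close> and \<open>A\<close> on the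
  error, known only through coercivity. The residual bound leaves \<open>l\<close> open because it
  is absorbed on different scales: \<open>l\<close> of order 1 in the energy estimate, of order 1 /
  step in the sup estimate.\<close>

locale radau_equation = radau_step +
  fixes f f' :: "real \<Rightarrow> 'a" and z :: 'a and B :: "nat \<Rightarrow> 'a" and \<gamma> \<delta> :: real
  assumes f: "vpoly (q + 1) f"
    and f': "\<And>t. (f has_vector_derivative f' t) (at t)" "vpoly q f'"
    and gamma: "0 < \<gamma>"
    and coercive: "i \<le> q \<Longrightarrow> \<gamma> * (norm (f (s i)))\<^sup>2 \<le> \<rho> * sqn (f (s i)) + inner (B i) (f (s i))"
    and delta: "0 \<le> \<delta>"
    and residual: "vpoly (q + 1) g \<Longrightarrow> 0 < l \<Longrightarrow>
      (\<Sum>i\<le>q. W i * inner (M0 (f' (s i)) + B i) (g (s i))) + inner (M0 (f a - z)) (g a)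
        \<le> l * Q (\<lambda>t. sqn (g t)) + (b - a) * \<delta> / l"
begin

text \<open>The test function is \<open>f\<close> itself. The term in \<open>sqn (f a)\<close> from
  the energy identity cancels against the jump term, and \<open>sqn z\<close> is left with factor 1,
  so the estimate can be iterated without growth beyond that of the weight.\<close>

lemma step_energy:
  assumes N: "onorm M0 \<le> N" "0 \<le> N"
  shows "e b * sqn (f b) + \<gamma> * Q (\<lambda>t. (norm (f t))\<^sup>2) \<le> sqn z + 4 * (N + 1) * ((b - a) * \<delta>) / \<gamma>"
proof -
  let ?n = "Q (\<lambda>t. (norm (f t))\<^sup>2)" and ?B = "\<Sum>i\<le>q. W i * inner (B i) (f (s i))"
  \<comment> \<open>Since \<open>sqn\<close> is at most N times the squared norm, this
    \<open>l\<close> spends at most half of the coercive term on the residual; N + 1 avoids a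
    division by zero.\<close>
  define l where "l = \<gamma> / (2 * (N + 1))"
  have l: "0 < l" and lN: "l * N \<le> \<gamma> / 2"
    using gamma N by (auto simp: l_def field_simps)
  have n0: "0 \<le> ?n"
    by (intro sum_nonneg mult_nonneg_nonneg weight_nonneg) auto
  have "l * Q (\<lambda>t. sqn (f t)) \<le> l * Q (\<lambda>t. N * (norm (f t))\<^sup>2)"
  proof (intro mult_left_mono Q_mono)
    show "sqn (f (s i)) \<le> N * (norm (f (s i)))\<^sup>2" for i
      using sqn_le[of "f (s i)"] N by (meson mult_right_mono order_trans zero_le_power2)
  qed (use l in simp)
  also have "\<dots> = (l * N) * ?n"
    by (simp add: sum_distrib_left mult_ac)
  also have "\<dots> \<le> \<gamma> / 2 * ?n"
    by (rule mult_right_mono[OF lN n0])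
  finally have 1: "l * Q (\<lambda>t. sqn (f t)) \<le> (\<gamma> * ?n) / 2"
    by simp
  have 2: "4 * (N + 1) * ((b - a) * \<delta>) / \<gamma> = 2 * ((b - a) * \<delta> / l)"
    using gamma N by (simp add: l_def)
  have 3: "inner (M0 (f a - z)) (f a) \<ge> sqn (f a) / 2 - sqn z / 2"
    using form_young[of "1/2" z "f a"] by (simp add: form.diff_left)
  have 4: "(\<Sum>i\<le>q. W i * inner (M0 (f' (s i)) + B i) (f (s i))) =
      (e b * sqn (f b) - sqn (f a)) / 2 + \<rho> * Q (\<lambda>t. sqn (f t)) + ?B"
    using quadrature_energy[OF f f'] by (simp add: inner_add_left distrib_left sum.distrib)
  have "\<gamma> * ?n \<le> \<rho> * Q (\<lambda>t. sqn (f t)) + ?B"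
  proof -
    have "(\<Sum>i\<le>q. W i * (\<gamma> * (norm (f (s i)))\<^sup>2)) \<le> (\<Sum>i\<le>q. W i * (\<rho> * sqn (f (s i)) + inner (B i) (f (s i))))"
      by (intro sum_mono mult_left_mono coercive weight_nonneg) auto
    then show ?thesis
      by (simp add: sum_distrib_left distrib_left sum.distrib mult_ac)
  qed
  note 0 = this
  have arith: "x + u \<le> y + 2 * d"
    if "u \<le> r + v" "S + J \<le> L + d" "L \<le> u / 2" "w / 2 - y / 2 \<le> J" "S = (x - w) / 2 + r + v"
    for x u y d r v S J L w :: real
    using that by argo
  show ?thesis
    unfolding 2 by (rule arith[OF 0 residual[OF f l] 1 3 4])
qed

text \<open>
  The test function is the interpolant \<open>g\<close> of \<open>(b - a) / (t - a) * f t\<close>. Since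
  \<open>(b - a) f - (t - a) g\<close> vanishes at the nodes, the jump term at \<open>a\<close> cancels, and
  \<open>(1 / (b - a)) \<integral> e \<langle>M0 g, g\<rangle>\<close> is controlled; it dominates \<open>\<langle>M0 f, f\<rangle>\<close> by the inverse estimate.
\<close>

lemma step_sup:
  assumes t: "t \<in> {a..b}"
  defines "c \<equiv> inverse_const (q + 1) / e b"
  shows "sqn (f t) \<le> 4 * c * (8 * (b - a)\<^sup>2 * \<delta> + 2 * c * sqn z)"
proof -
  define \<tau> where "\<tau> = b - a"
  have tau: "0 < \<tau>" using ab by (simp add: \<tau>_def)
  have c: "0 < c" by (simp add: c_def inverse_const_def)
  obtain g where g: "vpoly (Suc q) g" "\<And>i. i < Suc q \<Longrightarrow> g (s i) = (\<tau> / (s i - a)) *\<^sub>R f (s i)"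
    using interpolating_vpoly_exists[OF inj_nodes, of "\<lambda>i. (\<tau> / (s i - a)) *\<^sub>R f (s i)"] by blast
  then have g1: "vpoly (q + 1) g" by simp
  obtain g' where g': "vpoly q g'" "\<And>t. (g has_vector_derivative g' t) (at t)"
    using vpoly_has_derivative[OF g(1)] by auto
  have gs: "(s i - a) *\<^sub>R g (s i) = \<tau> *\<^sub>R f (s i)" if "i \<le> q" for i
    using g(2)[of i] node_in[OF that] that by simp
  define E where "E t = (t - a) *\<^sub>R g' t + g t" for t
  define D where "D t = \<tau> *\<^sub>R f t - (t - a) *\<^sub>R g t" for t
  define D' where "D' t = \<tau> *\<^sub>R f' t - E t" for t
  have lin: "vpoly 2 (\<lambda>t. t - a)"
    using vpoly_linear_factor[of a 1] by simp
  have E: "vpoly (q + 1) E"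
    unfolding E_def using vpoly_scaleR_fun[OF lin g'(1)] g1 by (intro vpoly_add) simp_all
  have D: "vpoly (q + 2) D"
    unfolding D_def using vpoly_scaleR_fun[OF lin g1]
    by (intro vpoly_diff vpoly_scaleR vpoly_mono[OF f]) simp_all
  have D': "vpoly (q + 1) D'"
    unfolding D'_def by (intro vpoly_diff vpoly_scaleR E vpoly_mono[OF f'(2)]) simp
  have dD: "(D has_vector_derivative D' t) (at t)" for t
    unfolding D_def D'_def E_def
    by (auto intro!: derivative_eq_intros f'(1) g'(2) simp: algebra_simps)
  have D0: "D (s i) = 0" if "i \<le> q" for i
    using gs[OF that] by (simp add: D_def)
  define S where "S = Q (\<lambda>t. sqn (g t))"
  define Y where "Y = Q (\<lambda>t. inner (M0 (f t)) (g t))"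
  define X where "X = integral {a..b} (\<lambda>t. e t * ((t - a) * sqn (g t)))"
  have "continuous_on {a..b} (\<lambda>t. e t * ((t - a) * sqn (g t)))"
    by (intro continuous_intros vpoly_continuous_on[OF vpoly_form[OF g1 g1]])
  then have X: "((\<lambda>t. e t * ((t - a) * sqn (g t))) has_integral X) {a..b}"
    unfolding X_def by (rule integrable_integral[OF integrable_continuous_real])
  \<comment> \<open>The integrand of \<open>X\<close> has degree 2q + 1 apart from the weight, so
    there is only an inequality. Its direction is the right one, as \<open>X\<close> enters the
    lower bound for \<open>G\<close> with a negative sign.\<close>
  have "X \<le> Q (\<lambda>t. (t - a) * sqn (g t))"
    unfolding X_def by (rule radau_overestimates[OF g1])
  also have "\<dots> = \<tau> * Y"
  proof -
    have "(s i - a) * sqn (g (s i)) = \<tau> * inner (M0 (f (s i))) (g (s i))" if "i \<le> q" for i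
    proof -
      have "inner (M0 ((s i - a) *\<^sub>R g (s i))) (g (s i)) = inner (M0 (\<tau> *\<^sub>R f (s i))) (g (s i))"
        using gs[OF that] by simp
      then show ?thesis
        by (simp only: form.scaleR_left real_scaleR_def)
    qed
    then show ?thesis
      by (simp add: Y_def sum_distrib_left mult.left_commute)
  qed
  finally have XY: "X \<le> \<tau> * Y" .
  have eq1: "Q (\<lambda>t. inner (M0 (D' t)) (g t)) + \<tau> * inner (M0 (f a)) (g a) = 2 * \<rho> * (\<tau> * Y - X)"
  proof -
    have "((\<lambda>t. \<tau> * (e t * inner (M0 (f t)) (g t)) - e t * ((t - a) * sqn (g t))) has_integral \<tau> * Y - X) {a..b}"
      unfolding Y_def by (intro has_integral_diff has_integral_mult_right X exact_form[OF f g1]) simp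
    then have "((\<lambda>t. 2 * \<rho> * (\<tau> * (e t * inner (M0 (f t)) (g t)) - e t * ((t - a) * sqn (g t))))
        has_integral 2 * \<rho> * (\<tau> * Y - X)) {a..b}"
      by (rule has_integral_mult_right)
    moreover have "(\<lambda>t. e t * (2 * \<rho> * inner (M0 (D t)) (g t))) =
        (\<lambda>t. 2 * \<rho> * (\<tau> * (e t * inner (M0 (f t)) (g t)) - e t * ((t - a) * sqn (g t))))"
      by (intro ext, simp only: D_def form.diff_left form.scaleR_left, simp add: algebra_simps)
    ultimately have "Q (\<lambda>t. inner (M0 (D' t)) (g t)) + inner (M0 (D a)) (g a) = 2 * \<rho> * (\<tau> * Y - X)"
      using has_integral_unique[OF quadrature_by_parts[OF D dD D' D0 g1]] by simp
    moreover have "D a = \<tau> *\<^sub>R f a"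
      by (simp add: D_def)
    ultimately show ?thesis
      by (simp only: form.scaleR_left real_scaleR_def)
  qed
  \<comment> \<open>\<open>E\<close> is the derivative of (t - a) g. Twice its pairing with
    \<open>g\<close> is the derivative of \<open>(t - a) * sqn (g t)\<close> plus another
    \<open>sqn (g t)\<close>; the latter yields \<open>S\<close>, and the boundary term at
    \<open>a\<close> vanishes.\<close>
  have eq2: "2 * Q (\<lambda>t. inner (M0 (E t)) (g t)) = e b * (\<tau> * sqn (g b)) + 2 * \<rho> * X + S"
  proof -
    have d: "((\<lambda>t. (t - a) * sqn (g t)) has_real_derivative
        sqn (g t) + (t - a) * (2 * inner (M0 (g' t)) (g t))) (at t)" for t
      using form_has_derivative[OF g'(2) g'(2), of t]
      by (auto intro!: derivative_eq_intros simp: form_sym[of "g t" "g' t"])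
    have "((\<lambda>t. e t * (sqn (g t) + (t - a) * (2 * inner (M0 (g' t)) (g t)) - 2 * \<rho> * ((t - a) * sqn (g t)))
        + 2 * \<rho> * (e t * ((t - a) * sqn (g t))) + e t * sqn (g t)) has_integral
        (e b * ((b - a) * sqn (g b)) - (a - a) * sqn (g a)) + 2 * \<rho> * X + S) {a..b}"
      unfolding S_def
      by (intro has_integral_add has_integral_mult_right X weighted_ftc[OF d] exact_form[OF g1 g1]) simp
    moreover have "(\<lambda>t. e t * (sqn (g t) + (t - a) * (2 * inner (M0 (g' t)) (g t)) - 2 * \<rho> * ((t - a) * sqn (g t)))
        + 2 * \<rho> * (e t * ((t - a) * sqn (g t))) + e t * sqn (g t)) = (\<lambda>t. 2 * (e t * inner (M0 (E t)) (g t)))"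
      by (intro ext, simp only: E_def form.add_left form.scaleR_left, simp add: algebra_simps)
    moreover have "((\<lambda>t. 2 * (e t * inner (M0 (E t)) (g t))) has_integral 2 * Q (\<lambda>t. inner (M0 (E t)) (g t))) {a..b}"
      by (intro has_integral_mult_right exact_form[OF E g1]) simp
    ultimately show ?thesis
      by (simp add: \<tau>_def has_integral_unique)
  qed
  have eq3: "Q (\<lambda>t. inner (M0 (D' t)) (g t)) =
      \<tau> * Q (\<lambda>t. inner (M0 (f' t)) (g t)) - Q (\<lambda>t. inner (M0 (E t)) (g t))"
    by (simp add: D'_def form.diff_left form.scaleR_left right_diff_distrib sum_subtractf sum_distrib_left mult_ac)
  let ?B = "\<Sum>i\<le>q. W i * inner (B i) (g (s i))"
  \<comment> \<open>\<open>g (s i)\<close> is a positive multiple of \<open>f (s i)\<close>, so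
    coercivity may be used node by node although \<open>g\<close> differs from
    \<open>f\<close>.\<close>
  have "0 \<le> (\<Sum>i\<le>q. W i * (\<tau> / (s i - a) * (\<rho> * sqn (f (s i)) + inner (B i) (f (s i)))))"
  proof (intro sum_nonneg mult_nonneg_nonneg weight_nonneg)
    fix i assume i: "i \<in> {..q}"
    then show "0 \<le> \<tau> / (s i - a)"
      using node_in[of i] tau by simp
    show "0 \<le> \<rho> * sqn (f (s i)) + inner (B i) (f (s i))"
      using i coercive[of i] gamma by (auto intro: order_trans[rotated])
  qed auto
  also have "\<dots> = \<rho> * Y + ?B"
    unfolding Y_def by (simp add: g(2) form.scaleR_right sum_distrib_left flip: sum.distrib)
      (simp add: algebra_simps add_divide_distrib)
  finally have pos: "0 \<le> \<rho> * Y + ?B" .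
  define G where "G = Q (\<lambda>t. inner (M0 (f' t)) (g t)) + inner (M0 (f a)) (g a)"
  have "\<tau> * G \<ge> \<rho> * (\<tau> * Y) + S / 2"
  proof -
    have "\<tau> * G = 2 * \<rho> * (\<tau> * Y - X) + Q (\<lambda>t. inner (M0 (E t)) (g t))"
      unfolding G_def using eq1 eq3 by (simp add: algebra_simps)
    also have "\<dots> = 2 * \<rho> * (\<tau> * Y) - \<rho> * X + e b * (\<tau> * sqn (g b)) / 2 + S / 2"
      using eq2 by (simp add: algebra_simps)
    also have "\<dots> \<ge> 2 * \<rho> * (\<tau> * Y) - \<rho> * X + 0 + S / 2"
      using tau nonneg by (intro add_mono) auto
    moreover have "\<rho> * X \<le> \<rho> * (\<tau> * Y)"
      using XY rho by simp
    ultimately show ?thesis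
      by linarith
  qed
  then have "\<tau> * (\<rho> * Y + S / (2 * \<tau>)) \<le> \<tau> * G"
    using tau by (simp add: distrib_left mult_ac)
  then have G: "\<rho> * Y + S / (2 * \<tau>) \<le> G"
    using tau by simp
  have "(\<Sum>i\<le>q. W i * inner (M0 (f' (s i)) + B i) (g (s i))) + inner (M0 (f a - z)) (g a) =
      G + ?B - inner (M0 z) (g a)"
    unfolding G_def by (simp add: inner_add_left distrib_left sum.distrib form.diff_left)
  \<comment> \<open>Of the available S / (2\<tau>), this \<open>l\<close> gives one eighth of S /
    \<tau> to the residual. The pairing with \<open>z\<close> takes another eighth, and a quarter
    remains for the final bound.\<close>
  then have 1: "S / (2 * \<tau>) \<le> S / (8 * \<tau>) + 8 * \<tau>\<^sup>2 * \<delta> + inner (M0 z) (g a)"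
    using residual[OF g1, of "1 / (8 * \<tau>)"] tau G pos
    by (simp add: S_def \<tau>_def[symmetric] power2_eq_square mult_ac)
  have zz: "sqn z / (4 * (1 / (8 * c))) = 2 * c * sqn z"
    using c by simp
  have "inner (M0 z) (g a) \<le> (1 / (8 * c)) * sqn (g a) + sqn z / (4 * (1 / (8 * c)))"
    using c by (intro form_young) simp
  also have "(1 / (8 * c)) * sqn (g a) \<le> (1 / (8 * c)) * (c / \<tau> * S)"
  proof (rule mult_left_mono)
    show "sqn (g a) \<le> c / \<tau> * S"
      using weighted_inverse_estimate[OF g1, of a] ab by (simp add: c_def \<tau>_def S_def)
  qed (use c in simp)
  also have "\<dots> = S / (8 * \<tau>)"
    using c by simp
  finally have "inner (M0 z) (g a) \<le> S / (8 * \<tau>) + 2 * c * sqn z"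
    unfolding zz by simp
  with 1 have 2: "S / (2 * \<tau>) \<le> S / (8 * \<tau>) + 8 * \<tau>\<^sup>2 * \<delta> + S / (8 * \<tau>) + 2 * c * sqn z"
    by argo
  have "sqn (f t) \<le> c / \<tau> * Q (\<lambda>t. sqn (f t))"
    using weighted_inverse_estimate[OF f t] by (simp add: c_def \<tau>_def)
  also have "\<dots> \<le> c / \<tau> * S"
    unfolding S_def
  proof (intro mult_left_mono Q_mono)
    fix i assume i: "i \<le> q"
    have "1 \<le> \<tau> / (s i - a)"
      using node_in[OF i] by (simp add: \<tau>_def)
    then have "1 * sqn (f (s i)) \<le> (\<tau> / (s i - a))\<^sup>2 * sqn (f (s i))"
      by (intro mult_right_mono nonneg) simp
    moreover have "g (s i) = (\<tau> / (s i - a)) *\<^sub>R f (s i)"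
      using g(2) i by simp
    ultimately show "sqn (f (s i)) \<le> sqn (g (s i))"
      by (simp only: sqn_scaleR mult_1_left)
  qed (use c tau in simp)
  also have "\<dots> = 4 * c * (S / (4 * \<tau>))"
    by simp
  also have "\<dots> \<le> 4 * c * (8 * \<tau>\<^sup>2 * \<delta> + 2 * c * sqn z)"
    using 2 c by (intro mult_left_mono) (auto simp: field_simps)
  finally show ?thesis
    by (simp add: \<tau>_def)
qed

end

section \<open>Regularity in the weighted spaces\<close>

text \<open>Only what the energy estimates use of a test function is kept. With the derivative as a
  second argument, differences can be formed without the iterated derivatives of
  \<open>Cc_infty\<close>.\<close>

definition C1c :: "(real \<Rightarrow> 'h::real_normed_vector) \<Rightarrow> (real \<Rightarrow> 'h) \<Rightarrow> bool" where
  "C1c \<phi> \<phi>' \<longleftrightarrow> (\<forall>t. (\<phi> has_vector_derivative \<phi>' t) (at t)) \<and> continuous_on UNIV \<phi>' \<and>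
     (\<exists>R. \<forall>t. R \<le> \<bar>t\<bar> \<longrightarrow> \<phi> t = 0 \<and> \<phi>' t = 0)"

lemma Cc_infty_C1c:
  assumes "\<phi> \<in> Cc_infty"
  shows "C1c \<phi> (\<lambda>t. vector_derivative \<phi> (at t))"
proof -
  let ?d = "\<lambda>g s. vector_derivative g (at s)"
  have smooth: "((?d ^^ k) \<phi>) differentiable (at t)" for k t
    using assms by (simp add: Cc_infty_def)
  have deriv: "(\<phi> has_vector_derivative ?d \<phi> t) (at t)" for t
    using smooth[of 0 t] by (simp add: vector_derivative_works)
  have "continuous_on UNIV (?d \<phi>)"
    using smooth[of 1] by (auto intro!: differentiable_imp_continuous_on simp: differentiable_on_def)
  moreover obtain R where R: "\<And>t. \<phi> t \<noteq> 0 \<Longrightarrow> \<bar>t\<bar> \<le> R"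
  proof -
    have "bounded {t. \<phi> t \<noteq> 0}"
      using assms compact_imp_bounded bounded_subset closure_subset unfolding Cc_infty_def by blast
    then show ?thesis
      using that unfolding bounded_iff by auto
  qed
  have "?d \<phi> t = 0" if "R < \<bar>t\<bar>" for t
  proof -
    have "open {t. R < \<bar>t\<bar>}"
      by (intro open_Collect_less continuous_intros)
    then have "(\<phi> has_vector_derivative 0) (at t)"
      using that R by (intro has_vector_derivative_transform_within_open[OF has_vector_derivative_const[of 0], of "{t. R < \<bar>t\<bar>}"])
        (auto simp: not_less[symmetric])
    then show ?thesis
      by (rule vector_derivative_at)
  qed
  then have "\<forall>t. R + 1 \<le> \<bar>t\<bar> \<longrightarrow> \<phi> t = 0 \<and> ?d \<phi> t = 0"
    using R by force
  ultimately show ?thesis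
    unfolding C1c_def using deriv by blast
qed

lemma C1c_diff:
  assumes "C1c \<phi> \<phi>'" "C1c \<psi> \<psi>'"
  shows "C1c (\<lambda>t. \<phi> t - \<psi> t) (\<lambda>t. \<phi>' t - \<psi>' t)"
proof -
  obtain R S where "\<And>t. R \<le> \<bar>t\<bar> \<Longrightarrow> \<phi> t = 0 \<and> \<phi>' t = 0" "\<And>t. S \<le> \<bar>t\<bar> \<Longrightarrow> \<psi> t = 0 \<and> \<psi>' t = 0"
    using assms unfolding C1c_def by blast
  then have "\<forall>t. max R S \<le> \<bar>t\<bar> \<longrightarrow> \<phi> t - \<psi> t = 0 \<and> \<phi>' t - \<psi>' t = 0"
    by simp
  then show ?thesis
    using assms unfolding C1c_def
    by (auto intro!: has_vector_derivative_diff continuous_on_diff exI[of _ "max R S"])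
qed

lemma C1c_continuous: "C1c \<phi> \<phi>' \<Longrightarrow> continuous_on UNIV \<phi>"
  unfolding C1c_def
  by (meson continuous_at_imp_continuous_on has_vector_derivative_continuous)

lemma integrable_compact_support:
  fixes h :: "real \<Rightarrow> real"
  assumes h: "continuous_on UNIV h" and R: "\<And>t. R \<le> \<bar>t\<bar> \<Longrightarrow> h t = 0"
  shows "integrable lebesgue h"
proof -
  have "set_integrable lborel {-R..R} h"
    using h by (intro borel_integrable_atLeastAtMost') (rule continuous_on_subset, auto)
  moreover have "(\<lambda>t. indicat_real {-R..R} t *\<^sub>R h t) = h"
  proof
    show "indicat_real {-R..R} t *\<^sub>R h t = h t" for t
      using R[of t] by (cases "R \<le> \<bar>t\<bar>") (auto simp: indicator_def)
  qed
  ultimately have "integrable lborel h"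
    by (simp add: set_integrable_def)
  then show ?thesis
    by (subst integrable_completion) (auto intro: borel_measurable_integrable)
qed

lemma H_norm_sq: "(H_norm \<rho> f)\<^sup>2 = (LINT t|lebesgue. (norm (f t))\<^sup>2 * exp (- 2 * \<rho> * t))"
  unfolding H_norm_def by (intro real_sqrt_pow2 integral_nonneg_AE) auto

lemma C1c_square_integrable:
  assumes "C1c \<phi> \<phi>'"
  shows "integrable lebesgue (\<lambda>t. (norm (\<phi> t))\<^sup>2 * exp (- 2 * \<rho> * t))"
    and "integrable lebesgue (\<lambda>t. (norm (\<phi>' t))\<^sup>2 * exp (- 2 * \<rho> * t))"
proof -
  obtain R where R: "\<And>t. R \<le> \<bar>t\<bar> \<Longrightarrow> \<phi> t = 0 \<and> \<phi>' t = 0"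
    using assms unfolding C1c_def by blast
  have "continuous_on UNIV \<phi>'"
    using assms by (simp add: C1c_def)
  then show "integrable lebesgue (\<lambda>t. (norm (\<phi> t))\<^sup>2 * exp (- 2 * \<rho> * t))"
    "integrable lebesgue (\<lambda>t. (norm (\<phi>' t))\<^sup>2 * exp (- 2 * \<rho> * t))"
    using R C1c_continuous[OF assms]
    by (auto intro!: integrable_compact_support[of _ R] continuous_intros)
qed

lemma integral_le_LINT:
  fixes g :: "real \<Rightarrow> real"
  assumes "integrable lebesgue g" "\<And>t. 0 \<le> g t" "g integrable_on S"
  shows "integral S g \<le> (LINT t|lebesgue. g t)"
proof -
  have g: "(g has_integral (LINT t|lebesgue. g t)) UNIV"
    by (rule has_integral_integral_lebesgue[OF assms(1)])
  have "integral S g \<le> integral UNIV g"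
    using assms g by (intro integral_subset_le) auto
  then show ?thesis
    using g by (simp add: integral_unique)
qed

text \<open>Differentiating the weighted square of the norm produces - 2\<rho> times this square.
  Young's inequality for the cross term takes half of it and leaves the squared derivative over
  \<rho>. Integration from the left of the support bounds a point value and an integral at once; the
  second claim takes the point to the right of the support.\<close>

lemma C1c_energy:
  fixes \<phi> :: "real \<Rightarrow> 'h::real_inner"
  assumes phi: "C1c \<phi> \<phi>'" and rho: "\<rho> > 0"
  shows "(norm (\<phi> t))\<^sup>2 * exp (- 2 * \<rho> * t) \<le> (H_norm \<rho> \<phi>')\<^sup>2 / \<rho>"
    and "(H_norm \<rho> \<phi>)\<^sup>2 \<le> (H_norm \<rho> \<phi>')\<^sup>2 / \<rho>\<^sup>2"
proof -
  let ?w = "\<lambda>t. exp (- 2 * \<rho> * t)"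
  obtain R where R: "\<And>t. R \<le> \<bar>t\<bar> \<Longrightarrow> \<phi> t = 0 \<and> \<phi>' t = 0"
    using phi unfolding C1c_def by blast
  have d: "(\<phi> has_vector_derivative \<phi>' t) (at t)" for t
    using phi unfolding C1c_def by blast
  have c: "continuous_on S \<phi>" "continuous_on S \<phi>'" for S
    using phi C1c_continuous[OF phi] unfolding C1c_def by (auto intro: continuous_on_subset)
  have est: "(norm (\<phi> t))\<^sup>2 * ?w t + \<rho> * integral {- R..t} (\<lambda>t. (norm (\<phi> t))\<^sup>2 * ?w t) \<le> (H_norm \<rho> \<phi>')\<^sup>2 / \<rho>"
    if t: "- R \<le> t" for t
  proof -
    let ?d = "\<lambda>t. (2 * inner (\<phi> t) (\<phi>' t) - 2 * \<rho> * inner (\<phi> t) (\<phi> t)) * ?w t"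
    have D: "((\<lambda>t. inner (\<phi> t) (\<phi> t) * ?w t) has_real_derivative ?d t) (at t within S)" for t S
    proof -
      have "((\<lambda>t. inner (\<phi> t) (\<phi> t)) has_real_derivative 2 * inner (\<phi> t) (\<phi>' t)) (at t within S)"
        using bounded_bilinear.has_vector_derivative[OF bounded_bilinear_inner d d, of t]
        unfolding has_real_derivative_iff_has_vector_derivative
        by (auto intro: has_vector_derivative_at_within simp: inner_commute)
      then show ?thesis
        by (auto intro!: derivative_eq_intros simp: algebra_simps)
    qed
    have "(?d has_integral inner (\<phi> t) (\<phi> t) * ?w t - inner (\<phi> (- R)) (\<phi> (- R)) * ?w (- R)) {- R..t}"
      using t D by (intro fundamental_theorem_of_calculus) (auto simp: has_real_derivative_iff_has_vector_derivative)
    then have I1: "(?d has_integral (norm (\<phi> t))\<^sup>2 * ?w t) {- R..t}"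
      using R[of "- R"] by (simp add: power2_norm_eq_inner)
    have I2: "((\<lambda>t. (norm (\<phi> t))\<^sup>2 * ?w t) has_integral integral {- R..t} (\<lambda>t. (norm (\<phi> t))\<^sup>2 * ?w t)) {- R..t}"
      by (intro integrable_integral integrable_continuous_real continuous_intros c)
    have i3: "(\<lambda>t. (norm (\<phi>' t))\<^sup>2 * ?w t) integrable_on {- R..t}"
      by (intro integrable_continuous_real continuous_intros c)
    have le: "?d t + \<rho> * ((norm (\<phi> t))\<^sup>2 * ?w t) \<le> 1 / \<rho> * ((norm (\<phi>' t))\<^sup>2 * ?w t)" for t
    proof -
      have "0 \<le> inner (\<rho> *\<^sub>R \<phi> t - \<phi>' t) (\<rho> *\<^sub>R \<phi> t - \<phi>' t)"
        by simp
      then have "\<rho> * (2 * inner (\<phi> t) (\<phi>' t) - \<rho> * (norm (\<phi> t))\<^sup>2) \<le> (norm (\<phi>' t))\<^sup>2"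
        by (simp add: inner_diff_left inner_diff_right inner_commute power2_norm_eq_inner algebra_simps)
      then have "2 * inner (\<phi> t) (\<phi>' t) - \<rho> * (norm (\<phi> t))\<^sup>2 \<le> 1 / \<rho> * (norm (\<phi>' t))\<^sup>2"
        using rho by (simp add: field_simps)
      then have "(2 * inner (\<phi> t) (\<phi>' t) - \<rho> * (norm (\<phi> t))\<^sup>2) * ?w t \<le> 1 / \<rho> * (norm (\<phi>' t))\<^sup>2 * ?w t"
        by (intro mult_right_mono) auto
      then show ?thesis
        by (simp add: power2_norm_eq_inner algebra_simps)
    qed
    have "(norm (\<phi> t))\<^sup>2 * ?w t + \<rho> * integral {- R..t} (\<lambda>t. (norm (\<phi> t))\<^sup>2 * ?w t) \<le>
        1 / \<rho> * integral {- R..t} (\<lambda>t. (norm (\<phi>' t))\<^sup>2 * ?w t)"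
      by (rule has_integral_le[OF has_integral_add[OF I1 has_integral_mult_right[OF I2]]
          has_integral_mult_right[OF integrable_integral[OF i3]] le])
    also have "\<dots> \<le> 1 / \<rho> * (H_norm \<rho> \<phi>')\<^sup>2"
      unfolding H_norm_sq using rho i3
      by (intro mult_left_mono integral_le_LINT C1c_square_integrable[OF phi]) auto
    finally show ?thesis by simp
  qed
  show "(norm (\<phi> t))\<^sup>2 * ?w t \<le> (H_norm \<rho> \<phi>')\<^sup>2 / \<rho>"
  proof (cases "- R \<le> t")
    case True
    have "0 \<le> \<rho> * integral {- R..t} (\<lambda>t. (norm (\<phi> t))\<^sup>2 * ?w t)"
      using rho by (intro mult_nonneg_nonneg integral_nonneg integrable_continuous_real continuous_intros c) auto
    then show ?thesis using est[OF True] by linarith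
  next
    case False
    then have "\<phi> t = 0" using R[of t] by linarith
    then show ?thesis using rho by simp
  qed
  have "(H_norm \<rho> \<phi>)\<^sup>2 = integral UNIV (\<lambda>t. (norm (\<phi> t))\<^sup>2 * ?w t)"
    unfolding H_norm_sq
    using has_integral_integral_lebesgue[OF C1c_square_integrable(1)[OF phi, of \<rho>]] by (simp add: integral_unique)
  also have "\<dots> = integral {- R..\<bar>R\<bar>} (\<lambda>t. (norm (\<phi> t))\<^sup>2 * ?w t)"
  proof (rule integral_unique, rule has_integral_on_superset)
    show "((\<lambda>t. (norm (\<phi> t))\<^sup>2 * ?w t) has_integral integral {- R..\<bar>R\<bar>} (\<lambda>t. (norm (\<phi> t))\<^sup>2 * ?w t)) {- R..\<bar>R\<bar>}"
      by (intro integrable_integral integrable_continuous_real continuous_intros c)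
    show "(norm (\<phi> t))\<^sup>2 * ?w t = 0" if "t \<notin> {- R..\<bar>R\<bar>}" for t
      using that R[of t] by fastforce
  qed simp
  finally have "\<rho> * (H_norm \<rho> \<phi>)\<^sup>2 \<le> (H_norm \<rho> \<phi>')\<^sup>2 / \<rho>"
    using est[of "\<bar>R\<bar>"] abs_ge_minus_self[of R]
    by (smt (verit) mult_nonneg_nonneg exp_ge_zero zero_le_power2)
  then show "(H_norm \<rho> \<phi>)\<^sup>2 \<le> (H_norm \<rho> \<phi>')\<^sup>2 / \<rho>\<^sup>2"
    using rho by (simp add: field_simps power2_eq_square)
qed

section \<open>Square integrability by scalar measurability only\<close>

text \<open>Without separability, Borel measurability of vector-valued functions is not stable under
  differences. The distance to a simple function, however, is a finite sum of measurable real
  functions, and the passage to the limit is one of real functions.\<close>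

lemma strongly_measurable_dist:
  fixes f :: "real \<Rightarrow> 'h::real_normed_vector"
  assumes f: "strongly_measurable f" and \<phi>: "continuous_on UNIV \<phi>"
  shows "(\<lambda>t. norm (\<phi> t - f t)) \<in> borel_measurable lebesgue"
proof -
  obtain s where s: "\<And>n. simple_function lebesgue (s n)" "AE x in lebesgue. (\<lambda>n. s n x) \<longlonglongrightarrow> f x"
    using f unfolding strongly_measurable_def by blast
  have sm: "(\<lambda>t. norm (\<phi> t - s n t)) \<in> borel_measurable lebesgue" for n
  proof -
    have ms: "s n -` {y} \<in> sets lebesgue" if "y \<in> range (s n)" for y
      using s(1)[of n] that unfolding simple_function_def by auto
    have fin: "finite (range (s n))"
      using s(1)[of n] unfolding simple_function_def by auto
    have "(\<lambda>t. norm (\<phi> t - s n t)) = (\<lambda>t. \<Sum>y\<in>range (s n). indicator (s n -` {y}) t * norm (\<phi> t - y))"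
    proof
      fix t
      have "(\<Sum>y\<in>range (s n). indicator (s n -` {y}) t * norm (\<phi> t - y)) =
          (\<Sum>y\<in>range (s n). if y = s n t then norm (\<phi> t - s n t) else 0)"
        by (intro sum.cong) (auto simp: indicator_def)
      then show "norm (\<phi> t - s n t) = (\<Sum>y\<in>range (s n). indicator (s n -` {y}) t * norm (\<phi> t - y))"
        using fin by simp
    qed
    moreover have "(\<lambda>t. norm (\<phi> t - y)) \<in> borel_measurable lebesgue" for y
      by (rule measurable_completion) (simp add: borel_measurable_continuous_onI continuous_intros \<phi>)
    ultimately show ?thesis
      using ms by (auto intro!: borel_measurable_sum borel_measurable_times borel_measurable_indicator)
  qed
  obtain N where N: "N \<in> null_sets lebesgue" "{x. \<not> (\<lambda>n. s n x) \<longlonglongrightarrow> f x} \<subseteq> N"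
    using s(2) unfolding eventually_ae_filter by auto
  \<comment> \<open>The value 0 on the exceptional set makes the convergence hold everywhere;
    completeness of the measure removes the change afterwards.\<close>
  have "(\<lambda>t. if t \<in> N then 0 else norm (\<phi> t - f t)) \<in> borel_measurable lebesgue"
  proof (rule borel_measurable_LIMSEQ_real)
    show "(\<lambda>t. if t \<in> N then 0 else norm (\<phi> t - s n t)) \<in> borel_measurable lebesgue" for n
      using N(1) by (intro measurable_If_set sm) (auto simp: null_sets_def)
    show "(\<lambda>n. if t \<in> N then 0 else norm (\<phi> t - s n t)) \<longlonglongrightarrow> (if t \<in> N then 0 else norm (\<phi> t - f t))" for t
      using N(2) by (auto intro!: tendsto_intros)
  qed
  moreover have "AE t in lebesgue. (if t \<in> N then 0 else norm (\<phi> t - f t)) = norm (\<phi> t - f t)"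
    using N(1) by (auto dest: AE_not_in)
  ultimately show ?thesis
    by (rule borel_measurable_AE)
qed

lemma norm_sq_le_twice:
  fixes x y z :: real
  assumes "0 \<le> x" "x \<le> y + z"
  shows "x\<^sup>2 \<le> 2 * y\<^sup>2 + 2 * z\<^sup>2"
proof -
  have "x\<^sup>2 \<le> (y + z)\<^sup>2"
    using assms by (intro power_mono) auto
  also have "\<dots> \<le> 2 * y\<^sup>2 + 2 * z\<^sup>2"
    using sum_squares_bound[of y z] by (simp add: power2_sum)
  finally show ?thesis .
qed

abbreviation sq_integrable :: "real \<Rightarrow> (real \<Rightarrow> 'h::real_normed_vector) \<Rightarrow> bool" where
  "sq_integrable \<rho> f \<equiv> integrable lebesgue (\<lambda>t. (norm (f t))\<^sup>2 * exp (- 2 * \<rho> * t))"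

lemma sq_integrable_diff:
  assumes "f \<in> H_space \<rho>" "continuous_on UNIV \<phi>" "sq_integrable \<rho> \<phi>"
  shows "sq_integrable \<rho> (\<lambda>t. \<phi> t - f t)"
proof (rule Bochner_Integration.integrable_bound)
  show "integrable lebesgue (\<lambda>t. 2 * ((norm (\<phi> t))\<^sup>2 * exp (- 2 * \<rho> * t)) + 2 * ((norm (f t))\<^sup>2 * exp (- 2 * \<rho> * t)))"
    using assms by (simp add: H_space_def)
  have "(\<lambda>t::real. exp (- 2 * \<rho> * t)) \<in> borel_measurable lebesgue"
    by (rule measurable_completion) simp
  then show "(\<lambda>t. (norm (\<phi> t - f t))\<^sup>2 * exp (- 2 * \<rho> * t)) \<in> borel_measurable lebesgue"
    using assms strongly_measurable_dist[of f \<phi>]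
    by (intro borel_measurable_times borel_measurable_power) (auto simp: H_space_def)
  have "(norm (\<phi> t - f t))\<^sup>2 \<le> 2 * (norm (\<phi> t))\<^sup>2 + 2 * (norm (f t))\<^sup>2" for t
    by (rule norm_sq_le_twice) (auto intro: norm_triangle_ineq4)
  then have "(norm (\<phi> t - f t))\<^sup>2 * exp (- 2 * \<rho> * t) \<le>
      (2 * (norm (\<phi> t))\<^sup>2 + 2 * (norm (f t))\<^sup>2) * exp (- 2 * \<rho> * t)" for t
    by (rule mult_right_mono) simp
  then show "AE t in lebesgue. norm ((norm (\<phi> t - f t))\<^sup>2 * exp (- 2 * \<rho> * t)) \<le>
      norm (2 * ((norm (\<phi> t))\<^sup>2 * exp (- 2 * \<rho> * t)) + 2 * ((norm (f t))\<^sup>2 * exp (- 2 * \<rho> * t)))"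
    by (intro AE_I2) (simp add: algebra_simps)
qed

text \<open>Replaces the triangle inequality of the weighted norm; the factors 2 only enlarge
  constants.\<close>

lemma H_norm_sq_le_twice:
  assumes "sq_integrable \<rho> u" "sq_integrable \<rho> v" "sq_integrable \<rho> w"
    and le: "\<And>t. norm (u t) \<le> norm (v t) + norm (w t)"
  shows "(H_norm \<rho> u)\<^sup>2 \<le> 2 * (H_norm \<rho> v)\<^sup>2 + 2 * (H_norm \<rho> w)\<^sup>2"
proof -
  have "(LINT t|lebesgue. (norm (u t))\<^sup>2 * exp (- 2 * \<rho> * t)) \<le>
      (LINT t|lebesgue. 2 * ((norm (v t))\<^sup>2 * exp (- 2 * \<rho> * t)) + 2 * ((norm (w t))\<^sup>2 * exp (- 2 * \<rho> * t)))"
  proof (rule integral_mono)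
    fix t
    have "(norm (u t))\<^sup>2 * exp (- 2 * \<rho> * t) \<le> (2 * (norm (v t))\<^sup>2 + 2 * (norm (w t))\<^sup>2) * exp (- 2 * \<rho> * t)"
      by (intro mult_right_mono norm_sq_le_twice le) auto
    then show "(norm (u t))\<^sup>2 * exp (- 2 * \<rho> * t) \<le>
        2 * ((norm (v t))\<^sup>2 * exp (- 2 * \<rho> * t)) + 2 * ((norm (w t))\<^sup>2 * exp (- 2 * \<rho> * t))"
      by (simp add: algebra_simps)
  qed (use assms in simp_all)
  then show ?thesis
    using assms by (simp add: H_norm_sq)
qed

section \<open>Continuous representatives and pointwise bounds\<close>

text \<open>By \<open>C1c_energy\<close>, applied to differences, the test functions are Cauchy at
  each point, and uniformly on bounded intervals, where the weight is bounded below. So their limit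
  \<open>F\<close> is continuous, and convergence in the weighted norm identifies it with
  \<open>f\<close> off a null set.\<close>

lemma dt_approximation:
  fixes f g :: "real \<Rightarrow> 'h::{real_inner, complete_space}"
  assumes dt: "(f, g) \<in> dt \<rho>" and rho: "\<rho> > 0"
  obtains \<phi> \<phi>' F where "\<And>n. C1c (\<phi> n) (\<phi>' n)"
    "(\<lambda>n. (H_norm \<rho> (\<lambda>t. \<phi> n t - f t))\<^sup>2) \<longlonglongrightarrow> 0" "(\<lambda>n. (H_norm \<rho> (\<lambda>t. \<phi>' n t - g t))\<^sup>2) \<longlonglongrightarrow> 0"
    "\<And>n t. (norm (\<phi> n t - F t))\<^sup>2 * exp (- 2 * \<rho> * t) \<le> 2 * (H_norm \<rho> (\<lambda>t. \<phi>' n t - g t))\<^sup>2 / \<rho>"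
    "\<And>t. (\<lambda>n. \<phi> n t) \<longlonglongrightarrow> F t" "continuous_on UNIV F" "AE t in lebesgue. f t = F t"
proof -
  obtain \<phi> where \<phi>: "\<And>n. \<phi> n \<in> Cc_infty" "(\<lambda>n. H_norm \<rho> (\<lambda>t. \<phi> n t - f t)) \<longlonglongrightarrow> 0"
    "(\<lambda>n. H_norm \<rho> (\<lambda>t. vector_derivative (\<phi> n) (at t) - g t)) \<longlonglongrightarrow> 0"
    and fg: "f \<in> H_space \<rho>" "g \<in> H_space \<rho>"
    using dt unfolding dt_def by blast
  define \<phi>' where "\<phi>' n t = vector_derivative (\<phi> n) (at t)" for n t
  have C1: "C1c (\<phi> n) (\<phi>' n)" for n
    using Cc_infty_C1c[OF \<phi>(1)] unfolding \<phi>'_def .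
  define h where "h n = (H_norm \<rho> (\<lambda>t. \<phi>' n t - g t))\<^sup>2" for n
  have h: "h \<longlonglongrightarrow> 0"
    using tendsto_power[OF \<phi>(3), of 2] by (simp add: h_def[abs_def] \<phi>'_def)
  have c': "continuous_on UNIV (\<phi>' n)" for n
    using C1 by (simp add: C1c_def)
  have cau: "(norm (\<phi> n t - \<phi> m t))\<^sup>2 * exp (- 2 * \<rho> * t) \<le> (2 * h n + 2 * h m) / \<rho>" for n m t
  proof -
    have "(norm (\<phi> n t - \<phi> m t))\<^sup>2 * exp (- 2 * \<rho> * t) \<le> (H_norm \<rho> (\<lambda>t. \<phi>' n t - \<phi>' m t))\<^sup>2 / \<rho>"
      by (rule C1c_energy(1)[OF C1c_diff[OF C1 C1] rho])
    also have "(H_norm \<rho> (\<lambda>t. \<phi>' n t - \<phi>' m t))\<^sup>2 \<le> 2 * h n + 2 * h m"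
      unfolding h_def
    proof (rule H_norm_sq_le_twice)
      show "sq_integrable \<rho> (\<lambda>t. \<phi>' n t - \<phi>' m t)"
        by (rule C1c_square_integrable(2)[OF C1c_diff[OF C1 C1]])
      show "sq_integrable \<rho> (\<lambda>t. \<phi>' n t - g t)" for n
        by (rule sq_integrable_diff[OF fg(2) c' C1c_square_integrable(2)[OF C1]])
      then show "sq_integrable \<rho> (\<lambda>t. \<phi>' m t - g t)" .
      show "norm (\<phi>' n t - \<phi>' m t) \<le> norm (\<phi>' n t - g t) + norm (\<phi>' m t - g t)" for t
        using norm_triangle_ineq4[of "\<phi>' n t - g t" "\<phi>' m t - g t"] by simp
    qed
    finally show ?thesis
      using rho by (simp add: divide_right_mono)
  qed
  have "convergent (\<lambda>n. \<phi> n t)" for t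
  proof (rule Cauchy_convergent, rule CauchyI)
    fix r :: real assume r: "0 < r"
    define d where "d = r\<^sup>2 * exp (- 2 * \<rho> * t) * \<rho> / 4"
    have "0 < d" using r rho by (simp add: d_def)
    from order_tendstoD(2)[OF h this] obtain N where N: "\<And>n. n \<ge> N \<Longrightarrow> h n < d"
      unfolding eventually_sequentially by blast
    have "norm (\<phi> m t - \<phi> n t) < r" if "m \<ge> N" "n \<ge> N" for m n
    proof -
      have "(norm (\<phi> m t - \<phi> n t))\<^sup>2 * exp (- 2 * \<rho> * t) \<le> (2 * h m + 2 * h n) / \<rho>"
        by (rule cau)
      also have "\<dots> < (2 * d + 2 * d) / \<rho>"
        using N[OF that(1)] N[OF that(2)] rho by (intro divide_strict_right_mono) auto
      also have "\<dots> = r\<^sup>2 * exp (- 2 * \<rho> * t)"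
        using rho by (simp add: d_def)
      finally have "(norm (\<phi> m t - \<phi> n t))\<^sup>2 < r\<^sup>2"
        by simp
      then show ?thesis
        by (rule power_less_imp_less_base) (use r in simp)
    qed
    then show "\<exists>M. \<forall>m\<ge>M. \<forall>n\<ge>M. norm (\<phi> m t - \<phi> n t) < r"
      by blast
  qed
  then obtain F where F: "\<And>t. (\<lambda>n. \<phi> n t) \<longlonglongrightarrow> F t"
    unfolding convergent_def by metis
  have bound: "(norm (\<phi> n t - F t))\<^sup>2 * exp (- 2 * \<rho> * t) \<le> 2 * h n / \<rho>" for n t
  proof (rule LIMSEQ_le)
    show "(\<lambda>m. (norm (\<phi> n t - \<phi> m t))\<^sup>2 * exp (- 2 * \<rho> * t)) \<longlonglongrightarrow> (norm (\<phi> n t - F t))\<^sup>2 * exp (- 2 * \<rho> * t)"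
      by (intro tendsto_intros F)
    have "(\<lambda>m. (2 * h n + 2 * h m) / \<rho>) \<longlonglongrightarrow> (2 * h n + 2 * 0) / \<rho>"
      using rho by (intro tendsto_intros h) auto
    then show "(\<lambda>m. (2 * h n + 2 * h m) / \<rho>) \<longlonglongrightarrow> 2 * h n / \<rho>"
      by simp
  qed (use cau in blast)
  have contR: "continuous_on {- R..R} F" for R
  proof (rule uniform_limit_theorem[where f = \<phi> and F = sequentially])
    show "\<forall>\<^sub>F n in sequentially. continuous_on {- R..R} (\<phi> n)"
      by (intro always_eventually allI continuous_on_subset[OF C1c_continuous[OF C1]]) auto
    show "uniform_limit {- R..R} \<phi> F sequentially"
    proof (rule uniform_limitI)
      fix r :: real assume r: "0 < r"
      define d where "d = r\<^sup>2 * exp (- 2 * \<rho> * R) * \<rho> / 2"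
      have "0 < d" using r rho by (simp add: d_def)
      show "\<forall>\<^sub>F n in sequentially. \<forall>t\<in>{- R..R}. dist (\<phi> n t) (F t) < r"
      proof (rule eventually_mono[OF order_tendstoD(2)[OF h \<open>0 < d\<close>]], intro ballI)
        fix n t assume n: "h n < d" and t: "t \<in> {- R..R}"
        have "(norm (\<phi> n t - F t))\<^sup>2 * exp (- 2 * \<rho> * R) \<le> (norm (\<phi> n t - F t))\<^sup>2 * exp (- 2 * \<rho> * t)"
          using t rho by (intro mult_left_mono) auto
        also have "\<dots> \<le> 2 * h n / \<rho>"
          by (rule bound)
        also have "\<dots> < 2 * d / \<rho>"
          using n rho by (intro divide_strict_right_mono) auto
        also have "\<dots> = r\<^sup>2 * exp (- 2 * \<rho> * R)"
          using rho by (simp add: d_def)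
        finally have "(norm (\<phi> n t - F t))\<^sup>2 < r\<^sup>2"
          by simp
        then show "dist (\<phi> n t) (F t) < r"
          unfolding dist_norm by (rule power_less_imp_less_base) (use r in simp)
      qed
    qed
  qed simp
  have "isCont F t" for t
    using contR[of "\<bar>t\<bar> + 1"] by (rule continuous_on_interior) (auto simp: interior_atLeastAtMost_real)
  then have cont: "continuous_on UNIV F"
    by (simp add: continuous_at_imp_continuous_on)
  define u where "u n t = (norm (\<phi> n t - f t))\<^sup>2 * exp (- 2 * \<rho> * t)" for n t
  have lim: "(\<lambda>n. (H_norm \<rho> (\<lambda>t. \<phi> n t - f t))\<^sup>2) \<longlonglongrightarrow> 0"
    using tendsto_power[OF \<phi>(2), of 2] by simp
  \<comment> \<open>Norm convergence gives almost everywhere convergence along a subsequence only;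
    this suffices, because the whole sequence tends to \<open>F\<close> at every point.\<close>
  have "\<exists>r::nat \<Rightarrow> nat. strict_mono r \<and> (AE t in lebesgue. (\<lambda>n. u (r n) t) \<longlonglongrightarrow> 0)"
  proof (rule tendsto_L1_AE_subseq)
    show "integrable lebesgue (u n)" for n
      unfolding u_def
      by (rule sq_integrable_diff[OF fg(1) C1c_continuous[OF C1] C1c_square_integrable(1)[OF C1]])
    show "(\<lambda>n. LINT t|lebesgue. norm (u n t)) \<longlonglongrightarrow> 0"
      using lim unfolding H_norm_sq u_def by simp
  qed
  then obtain r :: "nat \<Rightarrow> nat" where r: "strict_mono r" "AE t in lebesgue. (\<lambda>n. u (r n) t) \<longlonglongrightarrow> 0"
    by blast
  have "f t = F t" if "(\<lambda>n. u (r n) t) \<longlonglongrightarrow> 0" for t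
  proof -
    have "(\<lambda>n. u (r n) t) \<longlonglongrightarrow> (norm (F t - f t))\<^sup>2 * exp (- 2 * \<rho> * t)"
      unfolding u_def using LIMSEQ_subseq_LIMSEQ[OF F r(1)] by (intro tendsto_intros) (simp add: o_def)
    from LIMSEQ_unique[OF that this] show ?thesis
      by simp
  qed
  then have "AE t in lebesgue. f t = F t"
    using r(2) by auto
  from that[OF C1 lim h[unfolded h_def] bound[unfolded h_def] F cont this] show ?thesis .
qed

text \<open>The limits of the two bounds in \<open>C1c_energy\<close>; the last one says that
  \<open>dt\<close> is bounded below. The factors 2 and 4 are the price of one and two uses of
  \<open>H_norm_sq_le_twice\<close>.\<close>

lemma dt_bounds:
  fixes f g :: "real \<Rightarrow> 'h::{real_inner, complete_space}"
  assumes dt: "(f, g) \<in> dt \<rho>" and rho: "\<rho> > 0"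
  obtains F where "continuous_on UNIV F" "AE t in lebesgue. f t = F t"
    "\<And>t. (norm (F t))\<^sup>2 * exp (- 2 * \<rho> * t) \<le> 2 / \<rho> * (H_norm \<rho> g)\<^sup>2"
    "(H_norm \<rho> f)\<^sup>2 \<le> 4 / \<rho>\<^sup>2 * (H_norm \<rho> g)\<^sup>2"
proof -
  obtain \<phi> \<phi>' F where C1: "\<And>n. C1c (\<phi> n) (\<phi>' n)"
    and lim: "(\<lambda>n. (H_norm \<rho> (\<lambda>t. \<phi> n t - f t))\<^sup>2) \<longlonglongrightarrow> 0" "(\<lambda>n. (H_norm \<rho> (\<lambda>t. \<phi>' n t - g t))\<^sup>2) \<longlonglongrightarrow> 0"
    and F: "\<And>t. (\<lambda>n. \<phi> n t) \<longlonglongrightarrow> F t" "continuous_on UNIV F" "AE t in lebesgue. f t = F t"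
    by (rule dt_approximation[OF dt rho], rule that)
  have fg: "f \<in> H_space \<rho>" "g \<in> H_space \<rho>"
    using dt unfolding dt_def by auto
  have c': "continuous_on UNIV (\<phi>' n)" for n
    using C1 by (simp add: C1c_def)
  have H': "(H_norm \<rho> (\<phi>' n))\<^sup>2 \<le> 2 * (H_norm \<rho> (\<lambda>t. \<phi>' n t - g t))\<^sup>2 + 2 * (H_norm \<rho> g)\<^sup>2" for n
  proof (rule H_norm_sq_le_twice)
    show "sq_integrable \<rho> (\<phi>' n)"
      by (rule C1c_square_integrable(2)[OF C1])
    show "sq_integrable \<rho> (\<lambda>t. \<phi>' n t - g t)"
      by (rule sq_integrable_diff[OF fg(2) c' C1c_square_integrable(2)[OF C1]])
    show "sq_integrable \<rho> g"
      using fg by (simp add: H_space_def)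
    show "norm (\<phi>' n t) \<le> norm (\<phi>' n t - g t) + norm (g t)" for t
      using norm_triangle_ineq[of "\<phi>' n t - g t" "g t"] by simp
  qed
  have H: "(H_norm \<rho> f)\<^sup>2 \<le> 2 * (H_norm \<rho> (\<lambda>t. \<phi> n t - f t))\<^sup>2 + 2 * (H_norm \<rho> (\<phi> n))\<^sup>2" for n
  proof (rule H_norm_sq_le_twice)
    show "sq_integrable \<rho> (\<phi> n)"
      by (rule C1c_square_integrable(1)[OF C1])
    show "sq_integrable \<rho> (\<lambda>t. \<phi> n t - f t)"
      by (rule sq_integrable_diff[OF fg(1) C1c_continuous[OF C1] C1c_square_integrable(1)[OF C1]])
    show "sq_integrable \<rho> f"
      using fg by (simp add: H_space_def)
    show "norm (f t) \<le> norm (\<phi> n t - f t) + norm (\<phi> n t)" for t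
      using norm_triangle_ineq4[of "\<phi> n t" "\<phi> n t - f t"] by (simp add: add.commute)
  qed
  have "(norm (F t))\<^sup>2 * exp (- 2 * \<rho> * t) \<le> (2 * 0 + 2 * (H_norm \<rho> g)\<^sup>2) / \<rho>" for t
  proof (rule LIMSEQ_le)
    show "(\<lambda>n. (norm (\<phi> n t))\<^sup>2 * exp (- 2 * \<rho> * t)) \<longlonglongrightarrow> (norm (F t))\<^sup>2 * exp (- 2 * \<rho> * t)"
      by (intro tendsto_intros F)
    show "(\<lambda>n. (2 * (H_norm \<rho> (\<lambda>t. \<phi>' n t - g t))\<^sup>2 + 2 * (H_norm \<rho> g)\<^sup>2) / \<rho>) \<longlonglongrightarrow> (2 * 0 + 2 * (H_norm \<rho> g)\<^sup>2) / \<rho>"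
      using rho by (intro tendsto_intros lim) auto
    have "(norm (\<phi> n t))\<^sup>2 * exp (- 2 * \<rho> * t) \<le> (2 * (H_norm \<rho> (\<lambda>t. \<phi>' n t - g t))\<^sup>2 + 2 * (H_norm \<rho> g)\<^sup>2) / \<rho>" for n
      using C1c_energy(1)[OF C1 rho, of n t] H'[of n] rho
      by (meson divide_right_mono less_imp_le order_trans)
    then show "\<exists>N. \<forall>n\<ge>N. (norm (\<phi> n t))\<^sup>2 * exp (- 2 * \<rho> * t) \<le> (2 * (H_norm \<rho> (\<lambda>t. \<phi>' n t - g t))\<^sup>2 + 2 * (H_norm \<rho> g)\<^sup>2) / \<rho>"
      by blast
  qed
  moreover have "(H_norm \<rho> f)\<^sup>2 \<le> 2 * 0 + 2 * ((2 * 0 + 2 * (H_norm \<rho> g)\<^sup>2) / \<rho>\<^sup>2)"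
  proof (rule LIMSEQ_le_const)
    show "(\<lambda>n. 2 * (H_norm \<rho> (\<lambda>t. \<phi> n t - f t))\<^sup>2 + 2 * ((2 * (H_norm \<rho> (\<lambda>t. \<phi>' n t - g t))\<^sup>2 + 2 * (H_norm \<rho> g)\<^sup>2) / \<rho>\<^sup>2))
        \<longlonglongrightarrow> 2 * 0 + 2 * ((2 * 0 + 2 * (H_norm \<rho> g)\<^sup>2) / \<rho>\<^sup>2)"
      using rho by (intro tendsto_intros lim) auto
    have "(H_norm \<rho> f)\<^sup>2 \<le> 2 * (H_norm \<rho> (\<lambda>t. \<phi> n t - f t))\<^sup>2 +
        2 * ((2 * (H_norm \<rho> (\<lambda>t. \<phi>' n t - g t))\<^sup>2 + 2 * (H_norm \<rho> g)\<^sup>2) / \<rho>\<^sup>2)" for n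
    proof -
      have "(H_norm \<rho> (\<phi>' n))\<^sup>2 / \<rho>\<^sup>2 \<le> (2 * (H_norm \<rho> (\<lambda>t. \<phi>' n t - g t))\<^sup>2 + 2 * (H_norm \<rho> g)\<^sup>2) / \<rho>\<^sup>2"
        using H' by (rule divide_right_mono) simp
      then show ?thesis
        using H[of n] C1c_energy(2)[OF C1 rho, of n] by linarith
    qed
    then show "\<exists>N. \<forall>n\<ge>N. (H_norm \<rho> f)\<^sup>2 \<le> 2 * (H_norm \<rho> (\<lambda>t. \<phi> n t - f t))\<^sup>2 +
        2 * ((2 * (H_norm \<rho> (\<lambda>t. \<phi>' n t - g t))\<^sup>2 + 2 * (H_norm \<rho> g)\<^sup>2) / \<rho>\<^sup>2)"
      by blast
  qed
  ultimately show ?thesis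
    by (intro that[OF F(2,3)]) simp_all
qed

lemma continuous_AE_eq:
  fixes f g :: "real \<Rightarrow> 'h::real_normed_vector"
  assumes "continuous_on UNIV f" "continuous_on UNIV g" "AE t in lebesgue. f t = g t"
  shows "f = g"
proof -
  have "{t. f t \<noteq> g t} \<in> null_sets lebesgue"
    using assms(3) by (simp add: completion.AE_iff_null_sets)
  then have "negligible {t. f t \<noteq> g t}"
    by (simp add: negligible_iff_null_sets)
  moreover have "{t. f t \<noteq> g t} = {t. 0 < norm (f t - g t)}"
    by auto
  moreover have "open {t. 0 < norm (f t - g t)}"
    using assms by (intro open_Collect_less continuous_intros)
  ultimately have "{t. f t \<noteq> g t} = {}"
    using open_not_negligible by metis
  then show ?thesis by auto
qed

lemma has_integral_imp_has_vector_derivative: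
  fixes f k :: "real \<Rightarrow> 'b::banach"
  assumes k: "continuous_on UNIV k"
    and f: "\<And>a b. a \<le> b \<Longrightarrow> (k has_integral f b - f a) {a..b}"
  shows "(f has_vector_derivative k t) (at t)"
proof -
  have "((\<lambda>u. integral {t - 1..u} k) has_vector_derivative k t) (at t within {t - 1..t + 1})"
    by (rule integral_has_vector_derivative) (auto intro: continuous_on_subset[OF k])
  then have "((\<lambda>u. integral {t - 1..u} k) has_vector_derivative k t) (at t)"
    by (simp add: at_within_Icc_at)
  then have "((\<lambda>u. f (t - 1) + integral {t - 1..u} k) has_vector_derivative 0 + k t) (at t)"
    by (intro has_vector_derivative_add has_vector_derivative_const)
  then have "(f has_vector_derivative 0 + k t) (at t)"
  proof (rule has_vector_derivative_transform_within_open[of _ _ _ "{t - 1<..}"])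
    fix u assume "u \<in> {t - 1<..}"
    then show "f (t - 1) + integral {t - 1..u} k = f u"
      using integral_unique[OF f[of "t - 1" u]] by simp
  qed auto
  then show ?thesis by simp
qed

text \<open>
  The operator \<open>B\<close> makes this usable when only \<open>B \<circ> g\<close> is known to have a continuous
  representative.
\<close>

lemma dt_has_integral:
  fixes f g :: "real \<Rightarrow> 'h::{real_inner, complete_space}" and k :: "real \<Rightarrow> 'b::banach"
  assumes dt: "(f, g) \<in> dt \<rho>" and rho: "\<rho> > 0"
    and f: "continuous_on UNIV f0" "AE t in lebesgue. f t = f0 t"
    and B: "bounded_linear B" and k: "continuous_on UNIV k" "AE t in lebesgue. B (g t) = k t"
    and ab: "a \<le> b"
  shows "(k has_integral B (f0 b) - B (f0 a)) {a..b}"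
proof -
  obtain \<phi> \<phi>' F where C1: "\<And>n. C1c (\<phi> n) (\<phi>' n)"
    and lim: "(\<lambda>n. (H_norm \<rho> (\<lambda>t. \<phi> n t - f t))\<^sup>2) \<longlonglongrightarrow> 0" "(\<lambda>n. (H_norm \<rho> (\<lambda>t. \<phi>' n t - g t))\<^sup>2) \<longlonglongrightarrow> 0"
    and F: "\<And>t. (\<lambda>n. \<phi> n t) \<longlonglongrightarrow> F t" "continuous_on UNIV F" "AE t in lebesgue. f t = F t"
    by (rule dt_approximation[OF dt rho], rule that)
  have "AE t in lebesgue. f0 t = F t"
    using f(2) F(3) by eventually_elim simp
  then have "f0 = F"
    by (rule continuous_AE_eq[OF f(1) F(2)])
  interpret bounded_linear B by fact
  obtain K where K: "0 < K" "\<And>x. norm (B x) \<le> norm x * K"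
    using pos_bounded by blast
  have g: "g \<in> H_space \<rho>"
    using dt unfolding dt_def by auto
  have d: "(\<phi> n has_vector_derivative \<phi>' n t) (at t)" and c': "continuous_on UNIV (\<phi>' n)" for n t
    using C1 by (simp_all add: C1c_def)
  have cB: "continuous_on S (\<lambda>t. B (\<phi>' n t) - k t)" for S n
    by (intro continuous_on_diff bounded_linear.continuous_on[OF B] continuous_on_subset[OF c'] continuous_on_subset[OF k(1)]) auto
  define h where "h n = (H_norm \<rho> (\<lambda>t. \<phi>' n t - g t))\<^sup>2" for n
  define I where "I = integral {a..b} k"
  define D where "D n = norm (B (\<phi> n b) - B (\<phi> n a) - I)" for n
  have sq: "integral {a..b} (\<lambda>t. (norm (B (\<phi>' n t) - k t))\<^sup>2) \<le> exp (2 * \<rho> * b) * (K\<^sup>2 * h n)" for n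
  proof -
    let ?w = "\<lambda>t. exp (- 2 * \<rho> * t)"
    let ?v = "\<lambda>t. (norm (B (\<phi>' n t) - k t))\<^sup>2 * ?w t"
    have cv: "continuous_on {a..b} ?v"
      by (intro continuous_intros cB)
    have int: "integrable lebesgue (\<lambda>t. indicat_real {a..b} t * ?v t)"
      using borel_integrable_atLeastAtMost'[OF cv]
      by (subst integrable_completion) (auto simp: set_integrable_def intro: borel_measurable_integrable)
    have "integral {a..b} (\<lambda>t. (norm (B (\<phi>' n t) - k t))\<^sup>2) \<le> integral {a..b} (\<lambda>t. exp (2 * \<rho> * b) * ?v t)"
    proof (rule integral_le)
      fix t assume t: "t \<in> {a..b}"
      have "1 \<le> exp (2 * \<rho> * b) * ?w t"
        using t rho by (simp flip: exp_add)
      then have "(norm (B (\<phi>' n t) - k t))\<^sup>2 * 1 \<le> (norm (B (\<phi>' n t) - k t))\<^sup>2 * (exp (2 * \<rho> * b) * ?w t)"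
        by (rule mult_left_mono) simp
      then show "(norm (B (\<phi>' n t) - k t))\<^sup>2 \<le> exp (2 * \<rho> * b) * ?v t"
        by (simp add: mult_ac)
    qed (intro integrable_continuous_real continuous_intros cB)+
    also have "\<dots> = exp (2 * \<rho> * b) * integral {a..b} ?v"
      by simp
    \<comment> \<open>The comparison with \<open>g\<close> holds almost everywhere only, so it is
      made between Lebesgue integrals over the line, to which the indicator restricts the left
      side.\<close>
    also have "integral {a..b} ?v = integral {a..b} (\<lambda>t. indicat_real {a..b} t * ?v t)"
      by (rule Henstock_Kurzweil_Integration.integral_cong) simp
    also have "\<dots> \<le> (LINT t|lebesgue. indicat_real {a..b} t * ?v t)"
    proof (rule integral_le_LINT[OF int])
      show "(\<lambda>t. indicat_real {a..b} t * ?v t) integrable_on {a..b}"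
        by (rule integrable_eq[OF integrable_continuous_real[OF cv]]) simp
    qed simp
    also have "\<dots> \<le> (LINT t|lebesgue. K\<^sup>2 * ((norm (\<phi>' n t - g t))\<^sup>2 * ?w t))"
    proof (rule integral_mono_AE[OF int])
      show "integrable lebesgue (\<lambda>t. K\<^sup>2 * ((norm (\<phi>' n t - g t))\<^sup>2 * ?w t))"
        using sq_integrable_diff[OF g c' C1c_square_integrable(2)[OF C1]] by simp
      have "indicat_real {a..b} t * ?v t \<le> K\<^sup>2 * ((norm (\<phi>' n t - g t))\<^sup>2 * ?w t)" if "B (g t) = k t" for t
      proof -
        have "norm (B (\<phi>' n t) - k t) \<le> norm (\<phi>' n t - g t) * K"
          using K(2)[of "\<phi>' n t - g t"] that by (simp add: diff)
        then have "(norm (B (\<phi>' n t) - k t))\<^sup>2 \<le> (norm (\<phi>' n t - g t) * K)\<^sup>2"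
          by (rule power_mono) simp
        then have "?v t \<le> (norm (\<phi>' n t - g t) * K)\<^sup>2 * ?w t"
          by (rule mult_right_mono) simp
        moreover have "indicat_real {a..b} t * ?v t \<le> ?v t"
          by (intro mult_left_le_one_le) (auto simp: indicator_def)
        ultimately show ?thesis
          by (simp add: power_mult_distrib mult_ac)
      qed
      then show "AE t in lebesgue. indicat_real {a..b} t * ?v t \<le> K\<^sup>2 * ((norm (\<phi>' n t - g t))\<^sup>2 * ?w t)"
        using k(2) by (auto elim!: eventually_mono)
    qed
    also have "\<dots> = K\<^sup>2 * h n"
      by (simp add: h_def H_norm_sq)
    finally show ?thesis
      by simp
  qed
  \<comment> \<open>\<open>x \<le> r + x\<^sup>2 / r\<close> leads from the integral of a norm to
    that of its square without Cauchy-Schwarz for integrals. Later n tends to infinity first, and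
    then r to 0.\<close>
  have D: "D n \<le> r * (b - a) + exp (2 * \<rho> * b) * (K\<^sup>2 * h n) / r" if r: "0 < r" for n r
  proof -
    have "((\<lambda>t. B (\<phi>' n t)) has_integral B (\<phi> n b) - B (\<phi> n a)) {a..b}"
      by (rule fundamental_theorem_of_calculus[OF ab has_vector_derivative_at_within,
            OF bounded_linear.has_vector_derivative[OF B d]])
    moreover have "(k has_integral I) {a..b}"
      unfolding I_def by (intro integrable_integral integrable_continuous_real continuous_on_subset[OF k(1)]) auto
    ultimately have "((\<lambda>t. B (\<phi>' n t) - k t) has_integral B (\<phi> n b) - B (\<phi> n a) - I) {a..b}"
      by (rule has_integral_diff)
    then have "D n = norm (integral {a..b} (\<lambda>t. B (\<phi>' n t) - k t))"
      by (simp add: D_def integral_unique)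
    also have "\<dots> \<le> integral {a..b} (\<lambda>t. r + (norm (B (\<phi>' n t) - k t))\<^sup>2 / r)"
    proof (rule integral_norm_bound_integral)
      fix t
      let ?x = "norm (B (\<phi>' n t) - k t)"
      have "0 \<le> ?x * r"
        using r by simp
      then have "r * ?x \<le> r * r + ?x\<^sup>2"
        using sum_squares_bound[of ?x r] by (simp add: power2_eq_square mult.commute)
      then show "?x \<le> r + ?x\<^sup>2 / r"
        using r by (simp add: field_simps power2_eq_square)
      show "(\<lambda>t. B (\<phi>' n t) - k t) integrable_on {a..b}"
        by (rule integrable_continuous_real[OF cB])
      show "(\<lambda>t. r + (norm (B (\<phi>' n t) - k t))\<^sup>2 / r) integrable_on {a..b}"
        using r by (intro integrable_continuous_real continuous_intros cB) simp
    qed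
    also have "\<dots> = r * (b - a) + integral {a..b} (\<lambda>t. (norm (B (\<phi>' n t) - k t))\<^sup>2) / r"
    proof -
      have "(\<lambda>t. (norm (B (\<phi>' n t) - k t))\<^sup>2 / r) integrable_on {a..b}"
        using r by (intro integrable_continuous_real continuous_intros cB) simp
      then show ?thesis
        using ab by (subst Henstock_Kurzweil_Integration.integral_add) (auto simp: integrable_const_ivl mult.commute)
    qed
    also have "\<dots> \<le> r * (b - a) + exp (2 * \<rho> * b) * (K\<^sup>2 * h n) / r"
      using sq[of n] r by (simp add: divide_right_mono)
    finally show ?thesis .
  qed
  define L where "L = norm (B (f0 b) - B (f0 a) - I)"
  have Dlim: "D \<longlonglongrightarrow> L"
    unfolding D_def[abs_def] L_def
    using F(1) unfolding \<open>f0 = F\<close> by (intro tendsto_intros tendsto)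
  have "L \<le> r * (b - a)" if r: "0 < r" for r
  proof (rule LIMSEQ_le[OF Dlim])
    have "(\<lambda>n. r * (b - a) + exp (2 * \<rho> * b) * (K\<^sup>2 * h n) / r) \<longlonglongrightarrow> r * (b - a) + exp (2 * \<rho> * b) * (K\<^sup>2 * 0) / r"
      unfolding h_def using r by (intro tendsto_intros lim) auto
    then show "(\<lambda>n. r * (b - a) + exp (2 * \<rho> * b) * (K\<^sup>2 * h n) / r) \<longlonglongrightarrow> r * (b - a)"
      by simp
  qed (use D[OF r] in blast)
  then have "L \<le> 0 + e" if "0 < e" for e
  proof -
    have "e / (b - a + 1) * (b - a) \<le> e / (b - a + 1) * (b - a + 1)"
      using ab that by (intro mult_left_mono) auto
    then show ?thesis
      using \<open>\<And>r. 0 < r \<Longrightarrow> L \<le> r * (b - a)\<close>[of "e / (b - a + 1)"] ab that by simp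
  qed
  then have "L \<le> 0"
    by (rule field_le_epsilon)
  then have "I = B (f0 b) - B (f0 a)"
    by (simp add: L_def)
  then show ?thesis
    unfolding I_def
    using integrable_integral[OF integrable_continuous_real[OF continuous_on_subset[OF k(1)]], of a b] by simp
qed

text \<open>The remainder y of the first-order expansion is paired with itself. The mean value
  theorem bounds its squared norm by e times its norm times the increment, where e comes from the
  continuity of \<open>k\<close> in norm and hence does not depend on y.\<close>

lemma weak_derivative_imp_has_vector_derivative:
  fixes f k :: "real \<Rightarrow> 'h::real_inner"
  assumes f: "\<And>t y. ((\<lambda>t. inner (f t) y) has_real_derivative inner (k t) y) (at t)"
    and k: "continuous_on UNIV k"
  shows "(f has_vector_derivative k t) (at t)"
  unfolding has_vector_derivative_def has_derivative_at_alt
proof (intro conjI allI impI)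
  show "bounded_linear (\<lambda>x. x *\<^sub>R k t)"
    by (rule bounded_linear_scaleR_left)
  fix e :: real assume e: "0 < e"
  have "isCont k t"
    using k by (simp add: continuous_on_eq_continuous_at)
  then obtain d where d: "0 < d" "\<And>s. \<bar>s - t\<bar> < d \<Longrightarrow> norm (k s - k t) < e"
    using e unfolding continuous_at_eps_delta dist_norm real_norm_def by metis
  have "norm (f u - f t - (u - t) *\<^sub>R k t) \<le> e * norm (u - t)" if u: "norm (u - t) < d" for u
  proof -
    define y where "y = f u - f t - (u - t) *\<^sub>R k t"
    let ?g = "\<lambda>s. inner (f s) y - s * inner (k t) y"
    have "\<bar>?g u - ?g t\<bar> \<le> (e * norm y) * \<bar>u - t\<bar>"
    proof (rule field_differentiable_bound[of "ball t d" ?g "\<lambda>s. inner (k s - k t) y", unfolded real_norm_def])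
      show "(?g has_real_derivative inner (k s - k t) y) (at s within ball t d)" for s
        by (auto intro!: derivative_eq_intros has_field_derivative_at_within[OF f] simp: inner_diff_left)
      show "\<bar>inner (k s - k t) y\<bar> \<le> e * norm y" if "s \<in> ball t d" for s
      proof -
        have "norm (k s - k t) \<le> e"
          using d(2)[of s] that by (simp add: dist_real_def abs_minus_commute less_imp_le)
        then show ?thesis
          using Cauchy_Schwarz_ineq2[of "k s - k t" y] mult_right_mono[of "norm (k s - k t)" e "norm y"] by simp
      qed
    qed (use u d(1) in \<open>auto simp: dist_real_def abs_minus_commute\<close>)
    moreover have "?g u - ?g t = inner y y"
      by (simp add: y_def inner_diff_left algebra_simps)
    ultimately have "norm y * norm y \<le> norm y * (e * \<bar>u - t\<bar>)"
      by (simp add: mult_ac flip: power2_norm_eq_inner power2_eq_square)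
    then have "norm y \<le> e * \<bar>u - t\<bar>"
      using e by (cases "norm y = 0") auto
    then show ?thesis
      by (simp add: y_def)
  qed
  then show "\<exists>d>0. \<forall>u. norm (u - t) < d \<longrightarrow> norm (f u - f t - (u - t) *\<^sub>R k t) \<le> e * norm (u - t)"
    using d(1) by blast
qed

text \<open>In a chain of n + 1 derivatives all functions but the last have continuous
  representatives; \<open>V\<close> is merely square integrable. A value of \<open>G j\<close> is
  bounded by the norm of the next member of the chain, and n - j further uses of
  \<open>dt_bounds\<close> lead from there to \<open>V\<close>.\<close>

lemma dt_relpow_regular:
  fixes U V :: "real \<Rightarrow> 'h::{real_inner, complete_space}"
  assumes UV: "(U, V) \<in> dt \<rho> ^^ Suc n" and rho: "\<rho> > 0" and U: "continuous_on UNIV U"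
  obtains G where "G 0 = U" "\<And>j. j \<le> n \<Longrightarrow> continuous_on UNIV (G j)"
    "\<And>j t. j < n \<Longrightarrow> (G j has_vector_derivative G (Suc j) t) (at t)"
    "\<And>j t. j \<le> n \<Longrightarrow>
      (norm (G j t))\<^sup>2 * exp (- 2 * \<rho> * t) \<le> 2 / \<rho> * ((4 / \<rho>\<^sup>2) ^ (n - j) * (H_norm \<rho> V)\<^sup>2)"
proof -
  obtain u where u: "u 0 = U" "u (Suc n) = V" "\<And>j. j \<le> n \<Longrightarrow> (u j, u (Suc j)) \<in> dt \<rho>"
    using UV unfolding relpow_fun_conv by (auto simp: less_Suc_eq_le)
  have "\<exists>F. continuous_on UNIV F \<and> (AE t in lebesgue. u j t = F t) \<and>
      (\<forall>t. (norm (F t))\<^sup>2 * exp (- 2 * \<rho> * t) \<le> 2 / \<rho> * (H_norm \<rho> (u (Suc j)))\<^sup>2)" if "j \<le> n" for j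
    by (rule dt_bounds[OF u(3)[OF that] rho]) blast
  then obtain G where G: "\<And>j. j \<le> n \<Longrightarrow> continuous_on UNIV (G j)"
    "\<And>j. j \<le> n \<Longrightarrow> AE t in lebesgue. u j t = G j t"
    "\<And>j t. j \<le> n \<Longrightarrow> (norm (G j t))\<^sup>2 * exp (- 2 * \<rho> * t) \<le> 2 / \<rho> * (H_norm \<rho> (u (Suc j)))\<^sup>2"
    by metis
  have G0: "G 0 = U"
    using continuous_AE_eq[OF U G(1)[of 0]] G(2)[of 0] u(1) by simp
  have "(H_norm \<rho> (u (Suc n - j)))\<^sup>2 \<le> (4 / \<rho>\<^sup>2) ^ j * (H_norm \<rho> V)\<^sup>2" if "j \<le> n" for j
    using that
  proof (induction j)
    case (Suc j)
    have "(u (Suc n - Suc j), u (Suc n - j)) \<in> dt \<rho>"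
      using u(3)[of "n - j"] Suc.prems by (simp add: Suc_diff_le)
    then have "(H_norm \<rho> (u (Suc n - Suc j)))\<^sup>2 \<le> 4 / \<rho>\<^sup>2 * (H_norm \<rho> (u (Suc n - j)))\<^sup>2"
      by (rule dt_bounds[OF _ rho])
    also have "\<dots> \<le> 4 / \<rho>\<^sup>2 * ((4 / \<rho>\<^sup>2) ^ j * (H_norm \<rho> V)\<^sup>2)"
      using Suc by (intro mult_left_mono) auto
    finally show ?case
      by (simp add: mult.assoc)

  qed (simp add: u(2))
  note * = this
  have H: "(H_norm \<rho> (u (Suc j)))\<^sup>2 \<le> (4 / \<rho>\<^sup>2) ^ (n - j) * (H_norm \<rho> V)\<^sup>2" if "j \<le> n" for j
    using *[of "n - j"] that by (simp add: Suc_diff_le)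
  show ?thesis
  proof (rule that[of G, OF G0 G(1)])
    fix j t
    show "(norm (G j t))\<^sup>2 * exp (- 2 * \<rho> * t) \<le> 2 / \<rho> * ((4 / \<rho>\<^sup>2) ^ (n - j) * (H_norm \<rho> V)\<^sup>2)" if "j \<le> n"
      using G(3)[OF that, of t] mult_left_mono[OF H[OF that], of "2 / \<rho>"] rho by simp
    show "(G j has_vector_derivative G (Suc j) t) (at t)" if j: "j < n"
    proof (rule weak_derivative_imp_has_vector_derivative)
      show c: "continuous_on UNIV (G (Suc j))"
        using G(1) j by simp
      fix t y
      have k: "continuous_on UNIV (\<lambda>t. inner (G (Suc j) t) y)"
        by (intro continuous_intros c)
      have "AE t in lebesgue. inner (u (Suc j) t) y = inner (G (Suc j) t) y"
        using G(2)[of "Suc j"] j by (auto elim: eventually_mono)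
      then have "((\<lambda>t. inner (G (Suc j) t) y) has_integral inner (G j b) y - inner (G j a) y) {a..b}"
        if "a \<le> b" for a b
        using dt_has_integral[OF u(3)[of j] rho G(1)[of j] G(2)[of j] bounded_linear_inner_left k _ that] j by simp
      then show "((\<lambda>t. inner (G j t) y) has_real_derivative inner (G (Suc j) t) y) (at t)"
        unfolding has_real_derivative_iff_has_vector_derivative
        by (rule has_integral_imp_has_vector_derivative[OF k])
    qed
  qed
qed

text \<open>The equation is given almost everywhere, and \<open>A\<close> is not continuous. Paired
  with y in \<open>D\<close>, however, \<open>A\<close> moves over to y and all terms become
  continuous in time, so the weak equation holds at every time. The domain of the adjoint then shows
  that the solution stays in \<open>D\<close>.\<close>

lemma exact_solution_pointwise:
  fixes U :: "real \<Rightarrow> 'h::{real_inner, complete_space}"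
  assumes sol: "exact_solution \<rho> M0 M1 D A F U" and rho: "\<rho> > 0"
    and M0: "bounded_linear M0" and M1: "bounded_linear M1" and A: "skew_selfadjoint D A"
    and F: "continuous_on UNIV F" and dU: "\<And>t. (U has_vector_derivative U' t) (at t)"
  shows "U t \<in> D" and "M0 (U' t) + M1 (U t) + A (U t) = F t"
proof -
  obtain g w where U: "continuous_on UNIV U" and g: "(\<lambda>t. M0 (U t), g) \<in> dt \<rho>"
    and w: "(U, w) \<in> lifted_graph \<rho> D A" and eq: "AE t in lebesgue. g t + M1 (U t) + w t = F t"
    using sol unfolding exact_solution_def by blast
  have adj: "adjoint_graph D A = {(x, - A x) |x. x \<in> D}"
    using A by (simp add: skew_selfadjoint_def)
  have MU: "continuous_on UNIV (\<lambda>t. M0 (U t))" "continuous_on UNIV (\<lambda>t. M1 (U t))"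
    by (intro bounded_linear.continuous_on[OF M0 U] bounded_linear.continuous_on[OF M1 U])+
  have weak: "inner (M0 (U' t)) y = inner (F t - M1 (U t)) y + inner (U t) (A y)" if y: "y \<in> D" for y
  proof -
    define k where "k t = inner (F t - M1 (U t)) y + inner (U t) (A y)" for t
    have k: "continuous_on UNIV k"
      unfolding k_def by (intro continuous_intros F MU U)
    have "AE t in lebesgue. U t \<in> D \<and> w t = A (U t)"
      using w by (simp add: lifted_graph_def)
    with eq have "AE t in lebesgue. inner (g t) y = k t"
    proof eventually_elim
      case (elim t)
      have "(y, - A y) \<in> adjoint_graph D A"
        using y adj by blast
      then have "inner (A (U t)) y = inner (U t) (- A y)"
        using elim unfolding adjoint_graph_def by blast
      moreover have "g t = F t - M1 (U t) - A (U t)"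
        using elim by (simp add: algebra_simps)
      ultimately show ?case
        by (simp add: k_def inner_diff_left)
    qed
    then have "(k has_integral inner (M0 (U b)) y - inner (M0 (U a)) y) {a..b}" if "a \<le> b" for a b
      using dt_has_integral[OF g rho MU(1) AE_I2[OF refl] bounded_linear_inner_left k _ that] by blast
    then have "((\<lambda>t. inner (M0 (U t)) y) has_vector_derivative k t) (at t)"
      by (rule has_integral_imp_has_vector_derivative[OF k])
    moreover have "((\<lambda>t. inner (M0 (U t)) y) has_vector_derivative inner (M0 (U' t)) y) (at t)"
      by (intro bounded_linear.has_vector_derivative[OF bounded_linear_inner_left]
          bounded_linear.has_vector_derivative[OF M0] dU)
    ultimately show ?thesis
      unfolding k_def by (rule vector_derivative_unique_at[symmetric])
  qed
  \<comment> \<open>Here skew symmetry would not suffice: that every element of the adjoint graph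
    has its first component in \<open>D\<close> is what puts \<open>U t\<close> into the
    domain.\<close>
  have "(U t, M0 (U' t) - F t + M1 (U t)) \<in> adjoint_graph D A"
    unfolding adjoint_graph_def
    using weak by (auto simp: inner_diff_left inner_diff_right inner_add_right inner_commute)
  then have "U t \<in> D \<and> M0 (U' t) - F t + M1 (U t) = - A (U t)"
    unfolding adj by auto
  then show "U t \<in> D" "M0 (U' t) + M1 (U t) + A (U t) = F t"
    by (auto simp: algebra_simps add_eq_0_iff2)
qed

section \<open>Consistency\<close>

context radau_step begin

text \<open>\<open>n\<close> is free because two interpolants are compared with \<open>G 0\<close>:
  one with q + 1 coefficients at the nodes, one with q + 2 coefficients that also matches at
  \<open>a\<close>. The n-th derivative of either is zero, so only \<open>G n\<close>
  enters.\<close>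

lemma interpolation_chain_error:
  fixes G :: "nat \<Rightarrow> real \<Rightarrow> 'c::real_inner"
  assumes G: "\<And>j t. j < q + 2 \<Longrightarrow> (G j has_vector_derivative G (Suc j) t) (at t)"
    and K: "\<And>t. t \<in> {a..b} \<Longrightarrow> norm (G n t) \<le> K" and n: "n \<le> q + 2"
    and r: "vpoly n r" and r': "\<And>t. (r has_vector_derivative r' t) (at t)"
    and y: "\<And>i. Suc i < n \<Longrightarrow> y i < y (Suc i)" "\<And>i. i < n \<Longrightarrow> y i \<in> {a..b} \<and> G 0 (y i) = r (y i)"
    and t: "t \<in> {a..b}"
  shows "norm (G 0 t - r t) \<le> (b - a) ^ n * K"
    and "1 \<le> n \<Longrightarrow> norm (G 1 t - r' t) \<le> (b - a) ^ (n - 1) * K"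
proof -
  obtain P where P: "P 0 = r" "\<And>j. vpoly (n - j) (P j)"
    "\<And>j t. (P j has_vector_derivative P (Suc j) t) (at t)"
    using vpoly_chain[OF r] by metis
  have P1: "P 1 = r'"
    using P(3)[of 0] r' vector_derivative_unique_at unfolding P(1) One_nat_def by blast
  have Pn: "P n t = 0" for t
    using P(2)[of n] by (simp add: vpoly_def)
  have err: "norm (G j t - P j t) \<le> (b - a) ^ (n - j) * K" if "j \<le> n" for j
  proof (rule interpolation_error[of n "\<lambda>j t. G j t - P j t" y a b K j t])
    show "((\<lambda>t. G i t - P i t) has_vector_derivative G (Suc i) t - P (Suc i) t) (at t)" if "i < n" for i t
      using that n by (intro has_vector_derivative_diff G P(3)) auto
    show "norm (G n u - P n u) \<le> K" if "u \<in> {a..b}" for u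
      using K[OF that] by (simp add: Pn)
    show "y i \<in> {a..b} \<and> G 0 (y i) - P 0 (y i) = 0" if "i < n" for i
      using y(2)[OF that] by (simp add: P(1))
  qed (use y t that in auto)
  show "norm (G 0 t - r t) \<le> (b - a) ^ n * K"
    using err[of 0] by (simp add: P(1))
  show "norm (G 1 t - r' t) \<le> (b - a) ^ (n - 1) * K" if "1 \<le> n"
    using err[OF that] by (simp only: P1)
qed

text \<open>
  At the nodes the derivative of the interpolation error is only of order \<open>q\<close>. Splitting it at
  the interpolant \<open>r\<close> that also matches \<open>G 0\<close> at \<open>a\<close>, integration by parts moves the derivative
  off \<open>p - r\<close>, which gains one order, and absorbs the jump term.
\<close>

lemma consistency_error:
  assumes G: "\<And>j t. j < q + 2 \<Longrightarrow> (G j has_vector_derivative G (Suc j) t) (at t)"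
    and K: "\<And>t. t \<in> {a..b} \<Longrightarrow> norm (G (q + 1) t) \<le> K" "\<And>t. t \<in> {a..b} \<Longrightarrow> norm (G (q + 2) t) \<le> K"
    and \<kappa>: "(b - a) ^ (q + 1) * K \<le> \<kappa>" and T: "b - a \<le> T" and N: "onorm M0 \<le> N"
    and p: "vpoly (q + 1) p" "\<And>i. i \<le> q \<Longrightarrow> p (s i) = G 0 (s i)"
    and p': "\<And>t. (p has_vector_derivative p' t) (at t)" "vpoly q p'"
    and g: "vpoly (q + 1) g" and l: "0 < l"
  shows "Q (\<lambda>t. inner (M0 (p' t - G 1 t)) (g t)) + inner (M0 (p a - G 0 a)) (g a)
    \<le> l * Q (\<lambda>t. sqn (g t)) + (b - a) * ((1 + 2 * \<rho>)\<^sup>2 * N * (\<kappa> * (1 + T))\<^sup>2 / 4) / l"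
proof -
  \<comment> \<open>The left end is put in front of the nodes, which gives q + 2 interpolation
    points.\<close>
  define y where "y i = (case i of 0 \<Rightarrow> a | Suc k \<Rightarrow> s k)" for i
  have y: "y i < y (Suc i)" if "Suc i < q + 2" for i
    using that first_node nodes_less by (cases i) (auto simp: y_def)
  have y_in: "y i \<in> {a..b}" if "i < q + 2" for i
  proof (cases i)
    case (Suc k)
    then show ?thesis
      using node_in[of k] that by (simp add: y_def)
  qed (use ab in \<open>simp add: y_def\<close>)
  have "y i < y j" if "i < j" "j < q + 2" for i j
    using that
  proof (induction j)
    case (Suc j)
    then show ?case
      using y[of j] by (cases "i = j") auto
  qed simp
  then have inj: "inj_on y {..<q + 2}"
    by (intro inj_onI) (metis lessThan_iff less_irrefl linorder_neqE_nat)
  obtain r where r: "vpoly (q + 2) r" "\<And>i. i < q + 2 \<Longrightarrow> r (y i) = G 0 (y i)"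
    using interpolating_vpoly_exists[OF inj, of "\<lambda>i. G 0 (y i)"] by blast
  obtain r' where r': "vpoly (q + 1) r'" "\<And>t. (r has_vector_derivative r' t) (at t)"
    using vpoly_has_derivative[OF r(1)] by auto
  have ra: "r a = G 0 a"
    using r(2)[of 0] by (simp add: y_def)
  have rs: "r (s i) = G 0 (s i)" if "i \<le> q" for i
    using r(2)[of "Suc i"] that by (simp add: y_def)
  define D where "D t = p t - r t" for t
  define D' where "D' t = p' t - r' t" for t
  define \<tau> where "\<tau> = b - a"
  have K0: "0 \<le> K"
    using K(1)[of a] ab norm_ge_zero order_trans by (metis atLeastAtMost_iff less_imp_le order_refl)
  have \<kappa>0: "0 \<le> \<kappa>" and T0: "0 \<le> T" and N0: "0 \<le> N"
    using \<kappa> T N ab K0 onorm_pos_le[OF bounded_linear_M0] by (auto intro: order_trans[rotated])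
  have err_r: "norm (G 0 t - r t) \<le> \<kappa> * T" "norm (G 1 t - r' t) \<le> \<kappa>" if t: "t \<in> {a..b}" for t
  proof -
    have "norm (G 0 t - r t) \<le> (b - a) ^ (q + 2) * K"
      using y_in r(2)
      by (intro interpolation_chain_error(1)[where G = G and n = "q + 2" and r = r and r' = r' and y = y and K = K and t = t,
            OF G K(2) _ r(1) r'(2) y _ t]) auto
    also have "\<dots> = ((b - a) ^ (q + 1) * K) * (b - a)"
      by simp
    also have "\<dots> \<le> \<kappa> * T"
      using \<kappa> T ab \<kappa>0 by (intro mult_mono) auto
    finally show "norm (G 0 t - r t) \<le> \<kappa> * T" .
    have "norm (G 1 t - r' t) \<le> (b - a) ^ (q + 2 - 1) * K"
      using y_in r(2)
      by (intro interpolation_chain_error(2)[where G = G and n = "q + 2" and r = r and r' = r' and y = y and K = K and t = t,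
            OF G K(2) _ r(1) r'(2) y _ t]) auto
    then show "norm (G 1 t - r' t) \<le> \<kappa>"
      using \<kappa> by simp
  qed
  have err_p: "norm (G 0 t - p t) \<le> \<kappa>" if t: "t \<in> {a..b}" for t
  proof -
    have "norm (G 0 t - p t) \<le> (b - a) ^ (q + 1) * K"
      using node_in p(2) nodes_less
      by (intro interpolation_chain_error(1)[where G = G and n = "q + 1" and r = p and r' = p' and y = s and K = K and t = t,
            OF G K(1) _ p(1) p'(1) _ _ t]) (auto simp: less_Suc_eq_le less_imp_le)
    then show ?thesis
      using \<kappa> by linarith
  qed
  define \<epsilon> where "\<epsilon> = \<kappa> * (1 + T)"
  have D_le: "norm (D t) \<le> \<epsilon>" if t: "t \<in> {a..b}" for t
  proof -
    have "norm (D t) \<le> norm (G 0 t - r t) + norm (G 0 t - p t)"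
      using norm_triangle_ineq4[of "G 0 t - r t" "G 0 t - p t"] by (simp add: D_def)
    then show ?thesis
      using err_r(1)[OF t] err_p[OF t] by (simp add: \<epsilon>_def algebra_simps)
  qed
  have r'_le: "norm (r' t - G 1 t) \<le> \<epsilon>" if t: "t \<in> {a..b}" for t
  proof -
    have "norm (r' t - G 1 t) \<le> \<kappa>"
      using err_r(2)[OF t] by (simp add: norm_minus_commute)
    also have "\<kappa> \<le> \<epsilon>"
      using \<kappa>0 T0 by (simp add: \<epsilon>_def algebra_simps)
    finally show ?thesis .
  qed
  \<comment> \<open>Young's inequality acts twice, with factor 2\<rho> in the integral and factor 1
    in the nodal sum; this choice makes the two shares add up to \<open>l\<close>.\<close>
  define \<mu> where "\<mu> = l / (1 + 2 * \<rho>)"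
  have \<mu>: "0 < \<mu>" using l rho by (simp add: \<mu>_def)
  define S where "S = Q (\<lambda>t. sqn (g t))"
  define X where "X = N * \<epsilon>\<^sup>2 / (4 * \<mu>)"
  have X0: "0 \<le> X" using N0 \<mu> by (simp add: X_def)
  have young: "inner (M0 x) z \<le> \<mu> * sqn z + X" if "norm x \<le> \<epsilon>" for x z
  proof -
    have "sqn x \<le> onorm M0 * (norm x)\<^sup>2"
      by (rule sqn_le)
    also have "\<dots> \<le> N * \<epsilon>\<^sup>2"
      using N N0 that by (intro mult_mono power_mono) auto
    finally have "sqn x / (4 * \<mu>) \<le> X"
      unfolding X_def using \<mu> by (intro divide_right_mono) auto
    then show ?thesis
      using form_young[OF \<mu>, of x z] by simp
  qed
  have D: "vpoly (q + 2) D"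
    unfolding D_def by (intro vpoly_diff r(1) vpoly_mono[OF p(1)]) simp
  have dD: "(D has_vector_derivative D' t) (at t)" for t
    unfolding D_def D'_def by (intro has_vector_derivative_diff p'(1) r'(2))
  have D': "vpoly (q + 1) D'"
    unfolding D'_def by (intro vpoly_diff r'(1) vpoly_mono[OF p'(2)]) simp
  have D0: "D (s i) = 0" if "i \<le> q" for i
    using p(2)[OF that] rs[OF that] by (simp add: D_def)
  have parts: "((\<lambda>t. e t * (2 * \<rho> * inner (M0 (D t)) (g t))) has_integral
      Q (\<lambda>t. inner (M0 (D' t)) (g t)) + inner (M0 (D a)) (g a)) {a..b}"
    by (rule quadrature_by_parts[OF D dD D' D0 g])
  have "((\<lambda>t. 2 * \<rho> * (\<mu> * (e t * sqn (g t)) + X)) has_integral 2 * \<rho> * (\<mu> * S + (b - a) * X)) {a..b}"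
    unfolding S_def using has_integral_const_real[of X a b] ab
    by (intro has_integral_mult_right has_integral_add exact_form[OF g g]) auto
  then have 1: "Q (\<lambda>t. inner (M0 (D' t)) (g t)) + inner (M0 (D a)) (g a) \<le> 2 * \<rho> * (\<mu> * S + \<tau> * X)"
    unfolding \<tau>_def
  proof (rule has_integral_le[OF parts])
    fix t assume t: "t \<in> {a..b}"
    have "e t * inner (M0 (D t)) (g t) \<le> e t * (\<mu> * sqn (g t) + X)"
      by (intro mult_left_mono young D_le[OF t]) simp
    also have "\<dots> \<le> \<mu> * (e t * sqn (g t)) + X"
      using mult_right_mono[OF e_le_1[OF t] X0] by (simp add: algebra_simps)
    finally have "(2 * \<rho>) * (e t * inner (M0 (D t)) (g t)) \<le> (2 * \<rho>) * (\<mu> * (e t * sqn (g t)) + X)"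
      using rho by (intro mult_left_mono) auto
    then show "e t * (2 * \<rho> * inner (M0 (D t)) (g t)) \<le> 2 * \<rho> * (\<mu> * (e t * sqn (g t)) + X)"
      by (simp add: mult_ac)
  qed
  have "Q (\<lambda>t. inner (M0 (r' t - G 1 t)) (g t)) \<le> Q (\<lambda>t. \<mu> * sqn (g t) + X)"
  proof (rule Q_mono)
    show "inner (M0 (r' (s i) - G 1 (s i))) (g (s i)) \<le> \<mu> * sqn (g (s i)) + X" if "i \<le> q" for i
      using node_in[OF that] by (intro young r'_le) auto
  qed
  also have "\<dots> = \<mu> * S + (\<Sum>i\<le>q. W i) * X"
    by (simp add: S_def distrib_left sum.distrib sum_distrib_left sum_distrib_right mult_ac)
  also have "\<dots> \<le> \<mu> * S + \<tau> * X"
    unfolding \<tau>_def by (intro add_left_mono mult_right_mono sum_weights X0)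
  finally have 2: "Q (\<lambda>t. inner (M0 (r' t - G 1 t)) (g t)) \<le> \<mu> * S + \<tau> * X" .
  have "Q (\<lambda>t. inner (M0 (p' t - G 1 t)) (g t)) =
      Q (\<lambda>t. inner (M0 (D' t)) (g t)) + Q (\<lambda>t. inner (M0 (r' t - G 1 t)) (g t))"
    unfolding sum.distrib[symmetric] distrib_left[symmetric] form.add_left[symmetric] by (simp add: D'_def)
  moreover have "D a = p a - G 0 a"
    by (simp add: D_def ra)
  ultimately have "Q (\<lambda>t. inner (M0 (p' t - G 1 t)) (g t)) + inner (M0 (p a - G 0 a)) (g a) \<le>
      2 * \<rho> * (\<mu> * S + \<tau> * X) + (\<mu> * S + \<tau> * X)"
    using 1 2 by simp
  also have "\<dots> = (1 + 2 * \<rho>) * \<mu> * S + \<tau> * ((1 + 2 * \<rho>) * X)"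
    by (simp add: algebra_simps)
  also have "(1 + 2 * \<rho>) * \<mu> = l"
    using rho by (simp add: \<mu>_def)
  also have "(1 + 2 * \<rho>) * X = (1 + 2 * \<rho>)\<^sup>2 * N * \<epsilon>\<^sup>2 / 4 / l"
    using rho l by (simp add: X_def \<mu>_def power2_eq_square)
  finally show ?thesis
    by (simp add: S_def \<tau>_def \<epsilon>_def)
qed

text \<open>\<open>p - v\<close>, with \<open>p\<close> the nodal interpolant, is an instance of
  \<open>radau_equation\<close>. As \<open>p\<close> agrees with \<open>G 0\<close> at the nodes and
  thus at \<open>b\<close>, the first estimate already concerns the true error; in between, the
  interpolation error is added. \<open>A\<close> is present only through the vectors
  \<open>AU i\<close> and \<open>AV i\<close>, whose difference is orthogonal to the nodal
  error.\<close>

lemma time_step_error: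
  assumes gamma: "0 < \<gamma>" and coercive: "\<And>y. \<gamma> * (norm y)\<^sup>2 \<le> \<rho> * sqn y + inner (M1 y) y"
    and M1: "bounded_linear M1"
    and G: "\<And>j t. j < q + 2 \<Longrightarrow> (G j has_vector_derivative G (Suc j) t) (at t)"
    and K: "\<And>t. t \<in> {a..b} \<Longrightarrow> norm (G (q + 1) t) \<le> K" "\<And>t. t \<in> {a..b} \<Longrightarrow> norm (G (q + 2) t) \<le> K"
    and \<kappa>: "(b - a) ^ (q + 1) * K \<le> \<kappa>" and T: "b - a \<le> T" and N: "onorm M0 \<le> N"
    and v: "vpoly (q + 1) v" "\<And>t. (v has_vector_derivative v' t) (at t)" "vpoly q v'"
    and skew: "\<And>i. i \<le> q \<Longrightarrow> inner (AU i - AV i) (G 0 (s i) - v (s i)) = 0"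
    and exact_eq: "\<And>i. i \<le> q \<Longrightarrow> M0 (G 1 (s i)) + M1 (G 0 (s i)) + AU i = Fs i"
    and discrete_eq: "\<And>g. vpoly (q + 1) g \<Longrightarrow>
      (\<Sum>i\<le>q. W i * inner (M0 (v' (s i)) + M1 (v (s i)) + AV i) (g (s i))) + inner (M0 (v a - z)) (g a) =
      (\<Sum>i\<le>q. W i * inner (Fs i) (g (s i)))"
  defines "\<delta> \<equiv> (1 + 2 * \<rho>)\<^sup>2 * N * (\<kappa> * (1 + T))\<^sup>2 / 4"
  defines "c \<equiv> inverse_const (q + 1) * exp (2 * \<rho> * T)"
  shows "e b * sqn (G 0 b - v b) + \<gamma> * Q (\<lambda>t. (norm (G 0 t - v t))\<^sup>2) \<le>
      sqn (G 0 a - z) + 4 * (N + 1) * ((b - a) * \<delta>) / \<gamma>"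
    and "t \<in> {a..b} \<Longrightarrow>
      sqn (G 0 t - v t) \<le> 2 * (N * \<kappa>\<^sup>2) + 2 * (4 * c * (8 * T\<^sup>2 * \<delta> + 2 * c * sqn (G 0 a - z)))"
proof -
  obtain p where p: "vpoly (Suc q) p" "\<And>i. i < Suc q \<Longrightarrow> p (s i) = G 0 (s i)"
    using interpolating_vpoly_exists[OF inj_nodes, of "\<lambda>i. G 0 (s i)"] by blast
  obtain p' where p': "vpoly q p'" "\<And>t. (p has_vector_derivative p' t) (at t)"
    using vpoly_has_derivative[OF p(1)] by auto
  have ps: "p (s i) = G 0 (s i)" if "i \<le> q" for i
    using p(2) that by simp
  have p1: "vpoly (q + 1) p" using p(1) by simp
  have N0: "0 \<le> N"
    using N onorm_pos_le[OF bounded_linear_M0] by linarith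
  have \<delta>0: "0 \<le> \<delta>"
    unfolding \<delta>_def using N0 by (intro divide_nonneg_nonneg mult_nonneg_nonneg) auto
  let ?f = "\<lambda>t. p t - v t"
  let ?z = "G 0 a - z"
  define B where "B i = M1 (?f (s i)) + (AU i - AV i)" for i
  interpret eq: radau_equation \<rho> a b q s W M0 ?f "\<lambda>t. p' t - v' t" ?z B \<gamma> \<delta>
  proof unfold_locales
    show "vpoly (q + 1) ?f"
      by (intro vpoly_diff v(1) p1)
    show "(?f has_vector_derivative p' t - v' t) (at t)" for t
      by (intro has_vector_derivative_diff p'(2) v(2))
    show "vpoly q (\<lambda>t. p' t - v' t)"
      by (intro vpoly_diff p'(1) v(3))
    show "\<gamma> * (norm (?f (s i)))\<^sup>2 \<le> \<rho> * sqn (?f (s i)) + inner (B i) (?f (s i))" if "i \<le> q" for i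
      using coercive[of "?f (s i)"] skew[OF that] ps[OF that] by (simp add: B_def inner_add_left)
    fix g :: "real \<Rightarrow> 'h" and l :: real
    assume g: "vpoly (q + 1) g" and l: "0 < l"
    have "M0 (p' (s i) - v' (s i)) + B i =
        M0 (p' (s i) - G 1 (s i)) + Fs i - (M0 (v' (s i)) + M1 (v (s i)) + AV i)" if "i \<le> q" for i
      unfolding exact_eq[OF that, symmetric] B_def ps[OF that]
      by (simp add: linear_diff[OF bounded_linear.linear[OF M1]]
          linear_diff[OF bounded_linear.linear[OF bounded_linear_M0]])
    then have "(\<Sum>i\<le>q. W i * inner (M0 (p' (s i) - v' (s i)) + B i) (g (s i))) =
        (\<Sum>i\<le>q. W i * inner (M0 (p' (s i) - G 1 (s i)) + Fs i - (M0 (v' (s i)) + M1 (v (s i)) + AV i)) (g (s i)))"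
      by (intro sum.cong) auto
    also have "\<dots> = Q (\<lambda>t. inner (M0 (p' t - G 1 t)) (g t)) + (\<Sum>i\<le>q. W i * inner (Fs i) (g (s i))) -
        (\<Sum>i\<le>q. W i * inner (M0 (v' (s i)) + M1 (v (s i)) + AV i) (g (s i)))"
      by (simp only: inner_diff_left inner_add_left right_diff_distrib distrib_left sum_subtractf sum.distrib)
    also have "\<dots> = Q (\<lambda>t. inner (M0 (p' t - G 1 t)) (g t)) + inner (M0 (v a - z)) (g a)"
      using discrete_eq[OF g] by simp
    finally have "(\<Sum>i\<le>q. W i * inner (M0 (p' (s i) - v' (s i)) + B i) (g (s i))) + inner (M0 (?f a - ?z)) (g a) =
        Q (\<lambda>t. inner (M0 (p' t - G 1 t)) (g t)) + inner (M0 (p a - G 0 a)) (g a)"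
      by (simp add: form.diff_left)
    also have "\<dots> \<le> l * Q (\<lambda>t. sqn (g t)) + (b - a) * \<delta> / l"
      unfolding \<delta>_def by (rule consistency_error[OF G K \<kappa> T N p1 ps p'(2,1) g l])
    finally show "(\<Sum>i\<le>q. W i * inner (M0 (p' (s i) - v' (s i)) + B i) (g (s i))) + inner (M0 (?f a - ?z)) (g a)
        \<le> l * Q (\<lambda>t. sqn (g t)) + (b - a) * \<delta> / l" .
  qed (use gamma \<delta>0 in auto)
  have "Q (\<lambda>t. (norm (?f t))\<^sup>2) = Q (\<lambda>t. (norm (G 0 t - v t))\<^sup>2)"
    by (intro sum.cong) (auto simp: ps)
  moreover have "p b = G 0 b"
    using ps[of q] last_node by simp
  ultimately show "e b * sqn (G 0 b - v b) + \<gamma> * Q (\<lambda>t. (norm (G 0 t - v t))\<^sup>2) \<le>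
      sqn ?z + 4 * (N + 1) * ((b - a) * \<delta>) / \<gamma>"
    using eq.step_energy[OF N N0] by simp
  assume t: "t \<in> {a..b}"
  \<comment> \<open>The weight at \<open>b\<close> depends on the step; bounding the step by
    \<open>T\<close> gives one constant for all steps.\<close>
  define c' where "c' = inverse_const (q + 1) / e b"
  have i0: "0 \<le> inverse_const (q + 1)"
    by (simp add: inverse_const_def)
  have c': "0 \<le> c'" "c' \<le> c"
  proof -
    have "c' = inverse_const (q + 1) * exp (2 * \<rho> * (b - a))"
      unfolding c'_def divide_inverse exp_minus[symmetric] by simp
    also have "\<dots> \<le> c"
      unfolding c_def using i0 T rho by (intro mult_left_mono) auto
    finally show "c' \<le> c" .
  qed (use i0 in \<open>simp add: c'_def\<close>)
  have "sqn (?f t) \<le> 4 * c' * (8 * (b - a)\<^sup>2 * \<delta> + 2 * c' * sqn ?z)"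
    unfolding c'_def by (rule eq.step_sup[OF t])
  also have "\<dots> \<le> 4 * c * (8 * T\<^sup>2 * \<delta> + 2 * c * sqn ?z)"
    using c' T ab \<delta>0 nonneg[of ?z] by (intro mult_mono add_mono power_mono) auto
  finally have 1: "sqn (?f t) \<le> 4 * c * (8 * T\<^sup>2 * \<delta> + 2 * c * sqn ?z)" .
  have "norm (G 0 t - p t) \<le> (b - a) ^ (q + 1) * K"
    using node_in ps nodes_less
    by (intro interpolation_chain_error(1)[where G = G and n = "q + 1" and r = p and r' = p' and y = s and K = K and t = t,
          OF G K(1) _ p1 p'(2) _ _ t]) (auto simp: less_Suc_eq_le less_imp_le)
  then have "norm (G 0 t - p t) \<le> \<kappa>"
    using \<kappa> by linarith
  then have "onorm M0 * (norm (G 0 t - p t))\<^sup>2 \<le> N * \<kappa>\<^sup>2"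
    using N N0 by (intro mult_mono power_mono) auto
  then have 2: "sqn (G 0 t - p t) \<le> N * \<kappa>\<^sup>2"
    using sqn_le order_trans by blast
  have "sqn (G 0 t - v t) \<le> 2 * sqn (G 0 t - p t) + 2 * sqn (?f t)"
    using sqn_add_le[of "G 0 t - p t" "?f t"] by simp
  then show "sqn (G 0 t - v t) \<le> 2 * (N * \<kappa>\<^sup>2) + 2 * (4 * c * (8 * T\<^sup>2 * \<delta> + 2 * c * sqn ?z))"
    using 1 2 by linarith
qed

end

text \<open>The affine map to the time step turns (b - a) (s + 1) into 2 (t - a), so the reference
  weight becomes exactly the weight of the space, relative to the left end.\<close>

lemma gauss_radau_imp_radau:
  assumes rho: "0 < \<rho>" and ab: "a < b" and gr: "gauss_radau \<rho> q (b - a) x w"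
  shows "radau \<rho> a b q (\<lambda>i. (a + b) / 2 + (b - a) / 2 * x i) (\<lambda>i. (b - a) / 2 * w i)"
proof
  let ?s = "\<lambda>i. (a + b) / 2 + (b - a) / 2 * x i"
  have gr': "-1 < x 0" "\<And>i. i < q \<Longrightarrow> x i < x (Suc i)" "x q = 1"
    "\<And>p. degree p \<le> 2 * q \<Longrightarrow>
      integral {-1..1} (\<lambda>s. exp (- \<rho> * (b - a) * (s + 1)) * poly p s) = (\<Sum>i\<le>q. w i * poly p (x i))"
    using gr unfolding gauss_radau_def by auto
  show "0 < \<rho>" "a < b" by fact+
  have "(b - a) * -1 < (b - a) * x 0"
    using ab gr'(1) by (intro mult_strict_left_mono) auto
  then show "a < ?s 0"
    by (simp add: field_simps)
  show "?s i < ?s (Suc i)" if "i < q" for i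
    using ab gr'(2)[OF that] by simp
  show "?s q = b"
    by (simp add: gr'(3) field_simps)
  fix f :: "real \<Rightarrow> real" assume "vpoly (2 * q + 1) f"
  then obtain p where p: "degree p \<le> 2 * q" "f = poly p"
    using vpoly_real_poly[of "2 * q" f] by auto
  define p' where "p' = pcompose p [:(a + b) / 2, (b - a) / 2:]"
  have p': "poly p' s = f ((a + b) / 2 + (b - a) / 2 * s)" for s
    by (simp add: p'_def p(2) poly_pcompose mult.commute)
  let ?m = "2 / (b - a)" and ?c = "- (a + b) / (b - a)"
  let ?h = "\<lambda>s. exp (- \<rho> * (b - a) * (s + 1)) * poly p' s"
  have "degree p' \<le> 2 * q"
    using p(1) ab by (simp add: p'_def degree_pcompose)
  from gr'(4)[OF this] have "integral {-1..1} ?h = (\<Sum>i\<le>q. w i * f (?s i))"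
    by (simp only: p')
  moreover have "(?h has_integral integral {-1..1} ?h) {-1..1}"
    by (intro integrable_integral integrable_continuous_real continuous_intros)
  ultimately have "(?h has_integral (\<Sum>i\<le>q. w i * f (?s i))) (cbox (-1) 1)"
    by (simp only: box_real)
  then have "((\<lambda>t. ?h (?m *\<^sub>R t + ?c)) has_integral (\<Sum>i\<le>q. w i * f (?s i)) /\<^sub>R ?m ^ DIM(real))
      (cbox ((-1 - ?c) /\<^sub>R ?m) ((1 - ?c) /\<^sub>R ?m))"
    using ab by (intro has_integral_affinity') auto
  moreover have "(\<Sum>i\<le>q. w i * f (?s i)) /\<^sub>R ?m ^ DIM(real) = (\<Sum>i\<le>q. (b - a) / 2 * w i * f (?s i))"
    by (simp add: sum_distrib_left mult.assoc)
  moreover have "(-1 - ?c) /\<^sub>R ?m = a" "(1 - ?c) /\<^sub>R ?m = b"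
    using ab by (auto simp: field_simps)
  moreover have "?h (?m *\<^sub>R t + ?c) = exp (- 2 * \<rho> * (t - a)) * f t" for t
  proof -
    have "(b - a) * (2 / (b - a) * t + - (a + b) / (b - a) + 1) = 2 * (t - a)"
    proof -
      have "(b - a) * (2 / (b - a) * t) = 2 * t" "(b - a) * (- (a + b) / (b - a)) = - (a + b)"
        using ab by simp_all
      then show ?thesis
        by (simp only: distrib_left) simp
    qed
    then have "- \<rho> * (b - a) * (2 / (b - a) * t + - (a + b) / (b - a) + 1) = - 2 * \<rho> * (t - a)"
      by (simp only: mult.assoc, simp?)
    moreover have "(a + b) / 2 + (b - a) / 2 * (2 / (b - a) * t + - (a + b) / (b - a)) = t"
    proof -
      have cancel: "x / 2 * (y / x) = y / 2" if "x \<noteq> 0" for x y :: real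
        using that by simp
      have "(b - a) / 2 * (2 / (b - a) * t) = t"
        using ab by simp
      then show ?thesis
        using cancel[of "b - a" "- (a + b)"] ab by (simp only: distrib_left)
    qed
    ultimately show ?thesis
      by (simp only: p' real_scaleR_def)
  qed
  ultimately show "((\<lambda>t. exp (- 2 * \<rho> * (t - a)) * f t) has_integral (\<Sum>i\<le>q. (b - a) / 2 * w i * f (?s i))) {a..b}"
    by (simp only: box_real)
qed

section \<open>The global error\<close>

lemma time_partition_mono:
  assumes "time_partition T M t" "i \<le> j" "j \<le> M"
  shows "t i \<le> t j"
  using assms(2,3)
proof (induction j)
  case (Suc j)
  then show ?case
    using assms(1) unfolding time_partition_def by (cases "i = Suc j") (force simp: le_Suc_eq)+
qed simp

lemma time_partition_cover:
  assumes "time_partition T M t" "s \<in> {0<..T}"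
  obtains m where "m \<in> {1..M}" "s \<in> ivl t m"
proof -
  have tM: "s \<le> t M" and t0: "t 0 < s"
    using assms by (auto simp: time_partition_def)
  define m where "m = (LEAST m. s \<le> t m)"
  have m: "s \<le> t m" "m \<le> M"
    unfolding m_def using tM by (auto intro: LeastI Least_le)
  then have "m \<noteq> 0"
    using t0 by (auto intro: ccontr)
  then have "\<not> s \<le> t (m - 1)"
    using not_less_Least[of "m - 1" "\<lambda>m. s \<le> t m"] by (simp add: m_def[symmetric])
  then show ?thesis
    using that[of m] m \<open>m \<noteq> 0\<close> by (simp add: ivl_def)
qed

lemma vpoly_pw_poly:
  assumes "vpoly (q + 1) g"
  shows "g \<in> pw_poly q M t"
proof -
  obtain c where "\<And>s. g s = (\<Sum>k<q + 1. s ^ k *\<^sub>R c k)"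
    using assms unfolding vpoly_def by blast
  then show ?thesis
    unfolding pw_poly_def by (auto simp: lessThan_Suc_atMost)
qed

lemma pw_poly_vpoly:
  assumes "u \<in> pw_poly q M t" "m \<in> {1..M}"
  obtains v where "vpoly (q + 1) v" "\<And>s. s \<in> ivl t m \<Longrightarrow> u s = v s"
proof -
  obtain c where "\<And>s. s \<in> ivl t m \<Longrightarrow> u s = (\<Sum>k\<le>q. s ^ k *\<^sub>R c k)"
    using assms unfolding pw_poly_def by blast
  then show ?thesis
    by (intro that[of "\<lambda>s. \<Sum>k\<le>q. s ^ k *\<^sub>R c k"]) (auto simp: vpoly_def lessThan_Suc_atMost)
qed

lemma Lim_at_right_eq:
  fixes u v :: "real \<Rightarrow> 'h::real_normed_vector"
  assumes "continuous_on UNIV v" "a < b" "\<And>s. s \<in> {a<..b} \<Longrightarrow> u s = v s"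
  shows "Lim (at_right a) u = v a"
proof (rule tendsto_Lim)
  have "(v \<longlongrightarrow> v a) (at_right a)"
    using assms(1) by (auto simp: continuous_on_def intro: tendsto_within_subset)
  moreover have "\<forall>\<^sub>F s in at_right a. v s = u s"
    using assms(2,3) unfolding eventually_at_right_field by (intro exI[of _ b]) auto
  ultimately show "(u \<longlongrightarrow> v a) (at_right a)"
    by (rule Lim_transform_eventually)
qed simp

lemma Lim_at_left_eq:
  fixes u v :: "real \<Rightarrow> 'h::real_normed_vector"
  assumes "continuous_on UNIV v" "a < b" "\<And>s. s \<in> {a<..b} \<Longrightarrow> u s = v s"
  shows "Lim (at_left b) u = u b"
proof (rule tendsto_Lim)
  have "(v \<longlongrightarrow> v b) (at_left b)"
    using assms(1) by (auto simp: continuous_on_def intro: tendsto_within_subset)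
  moreover have "\<forall>\<^sub>F s in at_left b. v s = u s"
    using assms(2,3) unfolding eventually_at_left_field by (intro exI[of _ a]) auto
  ultimately have "(u \<longlongrightarrow> v b) (at_left b)"
    by (rule Lim_transform_eventually)
  then show "(u \<longlongrightarrow> u b) (at_left b)"
    using assms(2,3) by simp
qed simp

text \<open>At s = b the interval reaches \<open>s\<close> from the left only; points on that side
  already make the filter nontrivial, so the derivative within the interval is unique.\<close>

lemma vector_derivative_Ioc:
  fixes u v :: "real \<Rightarrow> 'h::real_normed_vector"
  assumes "(v has_vector_derivative v') (at s)" "s \<in> {a<..b}" "\<And>r. r \<in> {a<..b} \<Longrightarrow> u r = v r"
  shows "vector_derivative u (at s within {a<..b}) = v'"
proof (rule vector_derivative_within)
  have "at s within {a<..<s} = at_left s"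
    using assms(2) by (intro at_within_nhd[of _ "{a<..}"]) auto
  then have "at s within {a<..<s} \<noteq> bot"
    by simp
  moreover have "at s within {a<..<s} \<le> at s within {a<..b}"
    using assms(2) by (intro at_le) auto
  ultimately show "at s within {a<..b} \<noteq> bot"
    using bot_unique by metis
  show "(u has_vector_derivative v') (at s within {a<..b})"
    using assms by (intro has_vector_derivative_transform[OF _ _ has_vector_derivative_at_within[OF assms(1)]]) auto
qed

text \<open>Dividing by r and letting r grow leaves \<open>a\<close>. This is how the
  semidefiniteness of \<open>M0\<close> follows from coercivity for all large r.\<close>

lemma nonneg_if_eventually_coercive:
  fixes a b c r0 :: real
  assumes "\<And>r. r \<ge> r0 \<Longrightarrow> r * a + b \<ge> c" "0 \<le> c"
  shows "0 \<le> a"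
proof (rule ccontr)
  assume "\<not> 0 \<le> a"
  then have a: "a < 0" by simp
  define r where "r = max r0 ((\<bar>b\<bar> + 1) / (- a))"
  have "(\<bar>b\<bar> + 1) / (- a) * a \<ge> r * a"
    using a by (intro mult_right_mono_neg) (auto simp: r_def)
  then have "r * a \<le> - (\<bar>b\<bar> + 1)"
    using a by simp
  then show False
    using assms(1)[of r] assms(2) by (simp add: r_def)
qed

lemma skew_selfadjoint_inner_zero:
  assumes A: "skew_selfadjoint D A" and x: "x \<in> D" "y \<in> D"
  shows "inner (A x - A y) (x - y) = 0"
proof -
  have "inner (A u) v = - inner u (A v)" if "u \<in> D" "v \<in> D" for u v
  proof -
    have "(v, - A v) \<in> adjoint_graph D A"
      using A that unfolding skew_selfadjoint_def by blast
    then show ?thesis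
      using that unfolding adjoint_graph_def by simp
  qed
  from this[of x x] this[of x y] this[of y y] this[of y x] x show ?thesis
    by (simp add: inner_diff_left inner_diff_right inner_commute)
qed

section \<open>Summation over the time steps\<close>

text \<open>\<open>G\<close> is the tower of derivatives of the exact solution \<open>G 0\<close>.
  The single bound \<open>\<kappa>\<close> for the interpolation errors of all steps keeps the
  constants of the sum independent of the partition.\<close>

locale discretisation = psd_operator M0 for M0 :: "'h::{real_inner, complete_space} \<Rightarrow> 'h" +
  fixes \<rho> T \<gamma> N \<kappa> :: real and q M :: nat and M1 A :: "'h \<Rightarrow> 'h" and D :: "'h set"
    and G :: "nat \<Rightarrow> real \<Rightarrow> 'h" and F PF V :: "real \<Rightarrow> 'h" and t :: "nat \<Rightarrow> real"
    and x w :: "nat \<Rightarrow> nat \<Rightarrow> real" and K :: real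
  assumes rho: "0 < \<rho>" and T: "0 < T" and gamma: "0 < \<gamma>"
    and M1: "bounded_linear M1"
    and coercive: "\<gamma> * (norm y)\<^sup>2 \<le> \<rho> * inner (M0 y) y + inner (M1 y) y"
    and A: "skew_selfadjoint D A"
    and N: "onorm M0 \<le> N"
    and G: "j < q + 2 \<Longrightarrow> (G j has_vector_derivative G (Suc j) s) (at s)"
    and K: "s \<in> {0..T} \<Longrightarrow> norm (G (q + 1) s) \<le> K" "s \<in> {0..T} \<Longrightarrow> norm (G (q + 2) s) \<le> K"
    and exact_eq: "G 0 s \<in> D" "M0 (G 1 s) + M1 (G 0 s) + A (G 0 s) = F s"
    and part: "time_partition T M t"
    and quadrature: "m \<in> {1..M} \<Longrightarrow> gauss_radau \<rho> q (step t m) (x m) (w m)"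
    and PF: "interpolant q M t x F PF"
    and V: "discrete_solution q M t x w T M0 M1 D A PF (G 0 0) V"
    and \<kappa>: "m \<in> {1..M} \<Longrightarrow> step t m ^ (q + 1) * K \<le> \<kappa>"
begin

text \<open>The elements of \<open>pw_poly\<close> are unconstrained at 0. The update supplies the
  initial value there, so the recursion over the steps starts with zero error.\<close>

definition E :: "real \<Rightarrow> 'h" where
  "E s = G 0 s - (V(0 := G 0 0)) s"

definition \<delta> :: real where
  "\<delta> = (1 + 2 * \<rho>)\<^sup>2 * N * (\<kappa> * (1 + T))\<^sup>2 / 4"

definition c :: real where
  "c = inverse_const (q + 1) * exp (2 * \<rho> * T)"

lemma t_0: "t 0 = 0" and t_M: "t M = T"
  using part by (auto simp: time_partition_def)

lemma t_less: "m \<in> {1..M} \<Longrightarrow> t (m - 1) < t m"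
  using part by (auto simp: time_partition_def)

lemma t_bounds: "m \<le> M \<Longrightarrow> 0 \<le> t m" "m \<le> M \<Longrightarrow> t m \<le> T"
  using time_partition_mono[OF part, of 0 m] time_partition_mono[OF part, of m M] t_0 t_M by auto

lemma N_nonneg: "0 \<le> N"
  using N onorm_pos_le[OF bounded_linear_M0] by linarith

lemma \<delta>_nonneg: "0 \<le> \<delta>"
  unfolding \<delta>_def using N_nonneg by (intro divide_nonneg_nonneg mult_nonneg_nonneg) auto

lemma step_estimates:
  assumes m: "m \<in> {1..M}"
  shows "exp (- 2 * \<rho> * (t m - t (m - 1))) * sqn (E (t m)) + \<gamma> * quad q t x w m (\<lambda>s. inner (E s) (E s)) \<le>
      sqn (E (t (m - 1))) + 4 * (N + 1) * ((t m - t (m - 1)) * \<delta>) / \<gamma>"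
    and "s \<in> ivl t m \<Longrightarrow>
      sqn (E s) \<le> 2 * (N * \<kappa>\<^sup>2) + 2 * (4 * c * (8 * T\<^sup>2 * \<delta> + 2 * c * sqn (E (t (m - 1)))))"
    and "0 \<le> quad q t x w m (\<lambda>s. inner (E s) (E s))"
proof -
  let ?a = "t (m - 1)" and ?b = "t m"
  let ?s = "\<lambda>i. (?a + ?b) / 2 + (?b - ?a) / 2 * x m i" and ?W = "\<lambda>i. (?b - ?a) / 2 * w m i"
  have ab: "?a < ?b" by (rule t_less[OF m])
  interpret radau_step \<rho> ?a ?b q ?s ?W M0
    using gauss_radau_imp_radau[OF rho ab] quadrature[OF m]
    by (simp add: radau_step_def step_def psd_operator_axioms)
  have node: "node t x m i = ?s i" for i
    by (simp add: node_def step_def)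
  have quad_eq: "quad q t x w m f = (\<Sum>i\<le>q. ?W i * f (?s i))" for f
    by (simp add: quad_def node step_def sum_distrib_left mult.assoc)
  have a0: "0 \<le> ?a" and bT: "?b \<le> T"
    using t_bounds[of "m - 1"] t_bounds[of m] m by auto
  have Vpw: "V \<in> pw_poly q M t" and VD: "\<And>s. s \<in> {0<..T} \<Longrightarrow> V s \<in> D"
    and Veq: "\<And>g. g \<in> pw_poly q M t \<Longrightarrow> quad q t x w m (\<lambda>s. inner
          (vector_derivative (\<lambda>r. M0 (V r)) (at s within ivl t m) + M1 (V s) + A (V s)) (g s))
        + inner (M0 (jump t V (G 0 0) m)) (Lim (at_right ?a) g) = quad q t x w m (\<lambda>s. inner (PF s) (g s))"
    using V m unfolding discrete_solution_def by auto
  obtain v where v: "vpoly (q + 1) v" "\<And>s. s \<in> ivl t m \<Longrightarrow> V s = v s"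
    using pw_poly_vpoly[OF Vpw m] by blast
  obtain v' where v': "vpoly q v'" "\<And>s. (v has_vector_derivative v' s) (at s)"
    using vpoly_has_derivative[OF v(1)] by auto
  have node_ivl: "?s i \<in> ivl t m" if "i \<le> q" for i
    using node_in[OF that] by (simp add: ivl_def)
  have ivl_T: "s \<in> {0<..T}" if "s \<in> ivl t m" for s
    using that a0 bT by (auto simp: ivl_def)
  have E_ivl: "E s = G 0 s - v s" if "s \<in> ivl t m" for s
    using ivl_T[OF that] v(2)[OF that] by (simp add: E_def)
  define z where "z = (V(0 := G 0 0)) ?a"
  have Ea: "E ?a = G 0 ?a - z"
    by (simp add: E_def z_def)
  \<comment> \<open>For m = 1 the left value is the initial datum. Otherwise it is the limit from
    the preceding step, and equals \<open>V ?a\<close> because that step contains its right end. The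
    update inside \<open>z\<close> covers both cases.\<close>
  have left: "(if m = 1 then G 0 0 else Lim (at_left ?a) V) = z"
  proof (cases "m = 1")
    case True
    then show ?thesis by (simp add: z_def t_0)
  next
    case False
    then have m': "m - 1 \<in> {1..M}" using m by auto
    obtain u where u: "vpoly (q + 1) u" "\<And>s. s \<in> ivl t (m - 1) \<Longrightarrow> V s = u s"
      using pw_poly_vpoly[OF Vpw m'] by blast
    have "Lim (at_left ?a) V = V ?a"
      using t_less[OF m'] u by (intro Lim_at_left_eq[OF vpoly_continuous_on[OF u(1)], of "t (m - 1 - 1)"]) (auto simp: ivl_def)
    moreover have "m - 1 - 1 \<le> M"
      using m' by auto
    then have "0 < ?a"
      using t_bounds(1) t_less[OF m'] le_less_trans by blast
    ultimately show ?thesis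
      using False by (simp add: z_def)
  qed
  have jump: "jump t V (G 0 0) m = v ?a - z"
    unfolding jump_def left using v(2) ab
    by (subst Lim_at_right_eq[OF vpoly_continuous_on[OF v(1)], of _ ?b]) (auto simp: ivl_def)
  have discrete: "(\<Sum>i\<le>q. ?W i * inner (M0 (v' (?s i)) + M1 (v (?s i)) + A (v (?s i))) (g (?s i))) +
      inner (M0 (v ?a - z)) (g ?a) = (\<Sum>i\<le>q. ?W i * inner (F (?s i)) (g (?s i)))"
    if g: "vpoly (q + 1) g" for g
  proof -
    have deriv: "vector_derivative (\<lambda>r. M0 (V r)) (at s within ivl t m) = M0 (v' s)" if "s \<in> ivl t m" for s
      using that v(2) unfolding ivl_def
      by (intro vector_derivative_Ioc[OF bounded_linear.has_vector_derivative[OF bounded_linear_M0 v'(2)]]) auto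
    have "Lim (at_right ?a) g = g ?a"
      by (rule Lim_at_right_eq[OF vpoly_continuous_on[OF g] ab]) simp
    moreover have "quad q t x w m (\<lambda>s. inner
          (vector_derivative (\<lambda>r. M0 (V r)) (at s within ivl t m) + M1 (V s) + A (V s)) (g s)) =
        (\<Sum>i\<le>q. ?W i * inner (M0 (v' (?s i)) + M1 (v (?s i)) + A (v (?s i))) (g (?s i)))"
      unfolding quad_eq using node_ivl by (intro sum.cong) (auto simp: deriv v(2))
    moreover have "quad q t x w m (\<lambda>s. inner (PF s) (g s)) = (\<Sum>i\<le>q. ?W i * inner (F (?s i)) (g (?s i)))"
    proof -
      have "PF (?s i) = F (?s i)" if "i \<le> q" for i
        using PF m that unfolding interpolant_def node[symmetric] by blast
      then show ?thesis
        unfolding quad_eq by (intro sum.cong) auto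
    qed
    ultimately show ?thesis
      using Veq[OF vpoly_pw_poly[OF g]] by (simp add: jump)
  qed
  have Gab: "norm (G (q + 1) s) \<le> K" "norm (G (q + 2) s) \<le> K" if "s \<in> {?a..?b}" for s
    using K that a0 bT by auto
  have skew: "inner (A (G 0 (?s i)) - A (v (?s i))) (G 0 (?s i) - v (?s i)) = 0" if "i \<le> q" for i
    using exact_eq(1) VD[OF ivl_T[OF node_ivl[OF that]]] v(2)[OF node_ivl[OF that]]
    by (intro skew_selfadjoint_inner_zero[OF A]) auto
  have \<kappa>m: "(?b - ?a) ^ (q + 1) * K \<le> \<kappa>" and abT: "?b - ?a \<le> T"
    using \<kappa>[OF m] a0 bT by (auto simp: step_def)
  note est = time_step_error[where G = G and \<gamma> = \<gamma> and v = v and v' = v' and z = z and K = K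
      and \<kappa> = \<kappa> and T = T and N = N and ?M1.0 = M1
      and AU = "\<lambda>i. A (G 0 (?s i))" and AV = "\<lambda>i. A (v (?s i))" and Fs = "\<lambda>i. F (?s i)",
      OF gamma coercive M1 G Gab \<kappa>m abT N v(1) v'(2,1) skew exact_eq(2) discrete,
      folded \<delta>_def c_def Ea]
  have Eb: "E ?b = G 0 ?b - v ?b"
    using ab by (intro E_ivl) (simp add: ivl_def)
  have Eq: "quad q t x w m (\<lambda>s. inner (E s) (E s)) = (\<Sum>i\<le>q. ?W i * (norm (G 0 (?s i) - v (?s i)))\<^sup>2)"
    unfolding quad_eq using node_ivl by (intro sum.cong) (auto simp: E_ivl power2_norm_eq_inner)
  show "exp (- 2 * \<rho> * (t m - t (m - 1))) * sqn (E (t m)) + \<gamma> * quad q t x w m (\<lambda>s. inner (E s) (E s)) \<le>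
      sqn (E (t (m - 1))) + 4 * (N + 1) * ((t m - t (m - 1)) * \<delta>) / \<gamma>"
    unfolding Eb Eq by (rule est(1))
  show "sqn (E s) \<le> 2 * (N * \<kappa>\<^sup>2) + 2 * (4 * c * (8 * T\<^sup>2 * \<delta> + 2 * c * sqn (E (t (m - 1)))))" if "s \<in> ivl t m"
    unfolding E_ivl[OF that] using that by (intro est(2)) (auto simp: ivl_def)
  show "0 \<le> quad q t x w m (\<lambda>s. inner (E s) (E s))"
    unfolding Eq by (intro sum_nonneg mult_nonneg_nonneg weight_nonneg) auto
qed

lemma E_0: "E 0 = 0"
  by (simp add: E_def)

text \<open>Each step estimate is multiplied by the weight at its left end, which makes the nodal
  errors telescope. The weight on the residuals is at most 1 and is dropped, so the step lengths add
  up to \<open>t m\<close>.\<close>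

lemma accumulated:
  assumes "m \<le> M"
  shows "exp (- 2 * \<rho> * t m) * sqn (E (t m)) +
      \<gamma> * (\<Sum>k=1..m. quad q t x w k (\<lambda>s. inner (E s) (E s)) * exp (- 2 * \<rho> * t (k - 1))) \<le>
    4 * (N + 1) * (t m * \<delta>) / \<gamma>"
  using assms
proof (induction m)
  case 0
  then show ?case
    by (simp add: t_0 E_0 form.zero_left)
next
  case (Suc m)
  let ?q = "quad q t x w (Suc m) (\<lambda>s. inner (E s) (E s))" and ?w = "exp (- 2 * \<rho> * t m)"
  let ?r = "4 * (N + 1) * ((t (Suc m) - t m) * \<delta>) / \<gamma>"
  have "0 \<le> ?r"
    using t_less[of "Suc m"] Suc.prems N_nonneg \<delta>_nonneg gamma by simp
  moreover have "?w \<le> 1"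
    using t_bounds(1)[of m] rho Suc.prems by simp
  ultimately have r: "?w * ?r \<le> ?r"
    by (intro mult_left_le_one_le) auto
  have "exp (- 2 * \<rho> * (t (Suc m) - t m)) * sqn (E (t (Suc m))) + \<gamma> * ?q \<le> sqn (E (t m)) + ?r"
    using step_estimates(1)[of "Suc m"] Suc.prems by simp
  then have "?w * (exp (- 2 * \<rho> * (t (Suc m) - t m)) * sqn (E (t (Suc m))) + \<gamma> * ?q) \<le> ?w * (sqn (E (t m)) + ?r)"
    by (rule mult_left_mono) simp
  also have "\<dots> \<le> ?w * sqn (E (t m)) + ?r"
    using r by (simp only: distrib_left)
  finally have "?w * (exp (- 2 * \<rho> * (t (Suc m) - t m)) * sqn (E (t (Suc m))) + \<gamma> * ?q) \<le> ?w * sqn (E (t m)) + ?r" .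
  moreover have "exp (- 2 * \<rho> * t (Suc m)) = ?w * exp (- 2 * \<rho> * (t (Suc m) - t m))"
    by (simp add: algebra_simps flip: exp_add)
  then have "?w * (exp (- 2 * \<rho> * (t (Suc m) - t m)) * sqn (E (t (Suc m))) + \<gamma> * ?q) =
      exp (- 2 * \<rho> * t (Suc m)) * sqn (E (t (Suc m))) + \<gamma> * (?q * ?w)"
    by (simp only: distrib_left) (simp only: mult_ac)
  ultimately have "exp (- 2 * \<rho> * t (Suc m)) * sqn (E (t (Suc m))) + \<gamma> * (?q * ?w) \<le> ?w * sqn (E (t m)) + ?r"
    by simp
  moreover have "4 * (N + 1) * (t (Suc m) * \<delta>) / \<gamma> = 4 * (N + 1) * (t m * \<delta>) / \<gamma> + ?r"
    by (simp add: algebra_simps add_divide_distrib[symmetric] diff_divide_distrib[symmetric])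
  ultimately show ?case
    using Suc by (simp add: distrib_left)
qed

lemma error_at_partition:
  assumes "m \<le> M"
  shows "sqn (E (t m)) \<le> exp (2 * \<rho> * T) * (4 * (N + 1) * (T * \<delta>) / \<gamma>)"
proof -
  have "0 \<le> \<gamma> * (\<Sum>k=1..m. quad q t x w k (\<lambda>s. inner (E s) (E s)) * exp (- 2 * \<rho> * t (k - 1)))"
    using gamma step_estimates(3) assms by (intro mult_nonneg_nonneg sum_nonneg) auto
  then have "exp (- 2 * \<rho> * t m) * sqn (E (t m)) \<le> 4 * (N + 1) * (t m * \<delta>) / \<gamma>"
    using accumulated[OF assms] by linarith
  also have "\<dots> \<le> 4 * (N + 1) * (T * \<delta>) / \<gamma>"
    using gamma N_nonneg \<delta>_nonneg t_bounds(2)[OF assms]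
    by (intro divide_right_mono mult_left_mono mult_right_mono) auto
  finally have "exp (2 * \<rho> * t m) * (exp (- 2 * \<rho> * t m) * sqn (E (t m))) \<le>
      exp (2 * \<rho> * T) * (4 * (N + 1) * (T * \<delta>) / \<gamma>)"
    using nonneg rho t_bounds(2)[OF assms] by (intro mult_mono) auto
  moreover have "exp (2 * \<rho> * t m) * exp (- 2 * \<rho> * t m) = 1"
    by (simp flip: exp_add)
  then have "exp (2 * \<rho> * t m) * (exp (- 2 * \<rho> * t m) * sqn (E (t m))) = sqn (E (t m))"
    by (simp only: mult.assoc[symmetric] mult_1_left)
  ultimately show ?thesis
    by (simp only:)
qed

lemma quad_norm_bound: "quad_norm_sq \<rho> q M t x w E \<le> 4 * (N + 1) * (T * \<delta>) / \<gamma> / \<gamma>"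
proof -
  have "0 \<le> exp (- 2 * \<rho> * t M) * sqn (E (t M))"
    using nonneg by simp
  then have "\<gamma> * quad_norm_sq \<rho> q M t x w E \<le> 4 * (N + 1) * (T * \<delta>) / \<gamma>"
    using accumulated[of M] unfolding quad_norm_sq_def t_M by linarith
  then show ?thesis
    using gamma by (simp add: pos_le_divide_eq mult.commute)
qed

lemma sup_bound:
  assumes s: "s \<in> {0..T}"
  shows "sqn (E s) \<le> 2 * (N * \<kappa>\<^sup>2) +
    2 * (4 * c * (8 * T\<^sup>2 * \<delta> + 2 * c * (exp (2 * \<rho> * T) * (4 * (N + 1) * (T * \<delta>) / \<gamma>))))"
proof -
  have c0: "0 \<le> c"
    by (simp add: c_def inverse_const_def)
  have X0: "0 \<le> exp (2 * \<rho> * T) * (4 * (N + 1) * (T * \<delta>) / \<gamma>)"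
    using N_nonneg \<delta>_nonneg gamma T by simp
  show ?thesis
  proof (cases "s = 0")
    case True
    then have "sqn (E s) = 0"
      by (simp add: E_0 form.zero_left)
    also have "0 \<le> 2 * (N * \<kappa>\<^sup>2) +
        2 * (4 * c * (8 * T\<^sup>2 * \<delta> + 2 * c * (exp (2 * \<rho> * T) * (4 * (N + 1) * (T * \<delta>) / \<gamma>))))"
      by (intro add_nonneg_nonneg mult_nonneg_nonneg c0 X0 N_nonneg \<delta>_nonneg) auto
    finally show ?thesis .
  next
    case False
    then have "s \<in> {0<..T}" using s by simp
    then obtain m where m: "m \<in> {1..M}" "s \<in> ivl t m"
      by (rule time_partition_cover[OF part])
    have "sqn (E s) \<le> 2 * (N * \<kappa>\<^sup>2) + 2 * (4 * c * (8 * T\<^sup>2 * \<delta> + 2 * c * sqn (E (t (m - 1)))))"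
      by (rule step_estimates(2)[OF m])
    also have "\<dots> \<le> 2 * (N * \<kappa>\<^sup>2) +
        2 * (4 * c * (8 * T\<^sup>2 * \<delta> + 2 * c * (exp (2 * \<rho> * T) * (4 * (N + 1) * (T * \<delta>) / \<gamma>))))"
      using c0 m(1) by (intro add_left_mono mult_left_mono error_at_partition) auto
    finally show ?thesis .
  qed
qed

end

theorem theorem3p13:
  fixes norm_M0 norm_M1 \<rho> T \<gamma> :: real and q :: nat
  assumes "\<gamma> > 0" and "T > 0"
  shows "\<exists>C\<ge>0.
    \<forall>(M0 :: 'h::{real_inner, complete_space} \<Rightarrow> 'h) M1 D A \<rho>0 F U V M t x w PF U\<tau> x0.
      selfadjoint_bounded M0 \<and> bounded_linear M1 \<and>
      onorm M0 = norm_M0 \<and> onorm M1 = norm_M1 \<and>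
      skew_selfadjoint D A \<and>
      \<rho>0 > 0 \<and> (\<forall>r\<ge>\<rho>0. \<forall>y. inner (r *\<^sub>R M0 y + M1 y) y \<ge> \<gamma> * inner y y) \<and>
      \<rho> \<ge> \<rho>0 \<and>
      F \<in> Hk_space 2 \<rho> \<and> continuous_on UNIV F \<and>
      exact_solution \<rho> M0 M1 D A F U \<and>
      (U, V) \<in> dt \<rho> ^^ (q + 3) \<and>
      time_partition T M t \<and>
      (\<forall>m\<in>{1..M}. gauss_radau \<rho> q (step t m) (x m) (w m)) \<and>
      interpolant q M t x F PF \<and>
      x0 = Lim (at_right 0) U \<and>
      discrete_solution q M t x w T M0 M1 D A PF x0 U\<tau>
      \<longrightarrow>
      (let E = (\<lambda>s. U s - (U\<tau>(0 := x0)) s) in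
        (SUP s\<in>{0..T}. ereal (inner (M0 (E s)) (E s))) + ereal (quad_norm_sq \<rho> q M t x w E)
          \<le> ereal (C * max_step M t ^ (2 * (q + 1)) * (H_norm \<rho> V)\<^sup>2))"
proof -
  define N where "N = norm_M0"
  \<comment> \<open>Bounds the squared sup on [0, T] of the derivatives of order q + 1 and q + 2 by
    the squared norm of \<open>V\<close>: the exponential removes the weight, 2 / \<rho> comes from
    \<open>dt_bounds\<close>, and the last factor covers the exponents 1 and 0 of 4 /
    \<rho>^2.\<close>
  define C3 where "C3 = exp (2 * \<rho> * T) * (2 / \<rho> * (1 + 4 / \<rho>\<^sup>2))"
  \<comment> \<open>\<open>d\<close> and \<open>X\<close> are the residual and the accumulated bound
    with the square of \<open>\<kappa>\<close> taken out.\<close>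
  define d where "d = (1 + 2 * \<rho>)\<^sup>2 * N * (1 + T)\<^sup>2 / 4"
  define c0 where "c0 = inverse_const (q + 1) * exp (2 * \<rho> * T)"
  define X where "X = 4 * (N + 1) * (T * d) / \<gamma>"
  define C where "C = (2 * N + 2 * (4 * c0 * (8 * T\<^sup>2 * d + 2 * c0 * (exp (2 * \<rho> * T) * X))) + X / \<gamma>) * C3"
  show ?thesis
  \<comment> \<open>The modulus is taken because \<open>\<rho>\<close> and \<open>norm_M0\<close>
    have no sign yet, so \<open>C\<close> could be negative.\<close>
  proof (intro exI[of _ "\<bar>C\<bar>"] conjI allI impI abs_ge_zero, elim conjE)
    fix M0 M1 A :: "'h \<Rightarrow> 'h" and D \<rho>0 F U V M t x w PF U\<tau> x0
    assume M0: "selfadjoint_bounded M0" and M1: "bounded_linear M1"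
      and norms: "onorm M0 = norm_M0" "onorm M1 = norm_M1"
      and A: "skew_selfadjoint D A"
      and \<rho>0: "\<rho>0 > 0" "\<rho> \<ge> \<rho>0"
      and coercive: "\<forall>r\<ge>\<rho>0. \<forall>y. inner (r *\<^sub>R M0 y + M1 y) y \<ge> \<gamma> * inner y y"
      and F: "F \<in> Hk_space 2 \<rho>" "continuous_on UNIV F"
      and U: "exact_solution \<rho> M0 M1 D A F U" "(U, V) \<in> dt \<rho> ^^ (q + 3)"
      and part: "time_partition T M t"
      and gr: "\<forall>m\<in>{1..M}. gauss_radau \<rho> q (step t m) (x m) (w m)"
      and PF: "interpolant q M t x F PF"
      and x0: "x0 = Lim (at_right 0) U"
      and U\<tau>: "discrete_solution q M t x w T M0 M1 D A PF x0 U\<tau>"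
    have rho: "0 < \<rho>" using \<rho>0 by linarith
    have cU: "continuous_on UNIV U"
      using U(1) by (simp add: exact_solution_def)
    have "(U, V) \<in> dt \<rho> ^^ Suc (q + 2)"
      using U(2) by (simp add: eval_nat_numeral)
    then obtain G where Gs: "G 0 = U"
      "\<And>j s. j < q + 2 \<Longrightarrow> (G j has_vector_derivative G (Suc j) s) (at s)"
      "\<And>j s. j \<le> q + 2 \<Longrightarrow>
        (norm (G j s))\<^sup>2 * exp (- 2 * \<rho> * s) \<le> 2 / \<rho> * ((4 / \<rho>\<^sup>2) ^ (q + 2 - j) * (H_norm \<rho> V)\<^sup>2)"
      using dt_relpow_regular[OF _ rho cU] by metis
    define K where "K = sqrt C3 * H_norm \<rho> V"
    have C3: "0 \<le> C3"
      using rho by (simp add: C3_def)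
    have K2: "K\<^sup>2 = C3 * (H_norm \<rho> V)\<^sup>2"
      using C3 by (simp add: K_def power_mult_distrib)
    have H0: "0 \<le> H_norm \<rho> V"
      unfolding H_norm_def by (intro real_sqrt_ge_zero integral_nonneg_AE) auto
    have K0: "0 \<le> K"
      using C3 H0 by (simp add: K_def)
    have GK: "norm (G j s) \<le> K" if j: "j \<in> {q + 1, q + 2}" and s: "s \<in> {0..T}" for j s
    proof -
      have "(4 / \<rho>\<^sup>2) ^ (q + 2 - j) \<le> 1 + 4 / \<rho>\<^sup>2"
        using j by auto
      then have le: "2 / \<rho> * ((4 / \<rho>\<^sup>2) ^ (q + 2 - j) * (H_norm \<rho> V)\<^sup>2) \<le> 2 / \<rho> * ((1 + 4 / \<rho>\<^sup>2) * (H_norm \<rho> V)\<^sup>2)"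
        using rho by (intro mult_left_mono mult_right_mono) auto
      have "(norm (G j s))\<^sup>2 = exp (2 * \<rho> * s) * ((norm (G j s))\<^sup>2 * exp (- 2 * \<rho> * s))"
        by (simp add: exp_minus)
      also have "\<dots> \<le> exp (2 * \<rho> * T) * (2 / \<rho> * ((1 + 4 / \<rho>\<^sup>2) * (H_norm \<rho> V)\<^sup>2))"
      proof (rule mult_mono)
        show "(norm (G j s))\<^sup>2 * exp (- 2 * \<rho> * s) \<le> 2 / \<rho> * ((1 + 4 / \<rho>\<^sup>2) * (H_norm \<rho> V)\<^sup>2)"
          using Gs(3)[of j s] le j by (auto intro: order_trans)
      qed (use s rho in auto)
      also have "\<dots> = K\<^sup>2"
        by (simp add: K2 C3_def mult_ac)
      finally show ?thesis
        using K0 by (rule power2_le_imp_le)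
    qed
    have dU: "(U has_vector_derivative G 1 s) (at s)" for s
      using Gs(2)[of 0 s] Gs(1) by simp
    \<comment> \<open>By continuity the discrete problem starts from the exact value, so there is no
      initial error to propagate.\<close>
    have x0_eq: "x0 = U 0"
      unfolding x0 using Lim_at_right_eq[OF cU zero_less_one] by simp
    define \<tau> where "\<tau> = max_step M t"
    have step_le: "step t m \<le> \<tau>" if "m \<in> {1..M}" for m
      unfolding \<tau>_def max_step_def using that by (intro Max_ge) auto
    have step_pos: "0 \<le> step t m" if "m \<in> {1..M}" for m
      using part that by (auto simp: time_partition_def step_def less_imp_le)
    define \<kappa> where "\<kappa> = \<tau> ^ (q + 1) * K"
    interpret M0: psd_operator M0
    proof
      show "selfadjoint_bounded M0" by fact
      show "0 \<le> inner (M0 y) y" for y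
      proof (rule nonneg_if_eventually_coercive[where ?r0.0 = \<rho>0 and b = "inner (M1 y) y" and c = "\<gamma> * inner y y"])
        show "\<gamma> * inner y y \<le> r * inner (M0 y) y + inner (M1 y) y" if "\<rho>0 \<le> r" for r
          using coercive that by (simp add: inner_add_left)
      qed (use \<open>\<gamma> > 0\<close> in simp)
    qed
    interpret discretisation M0 \<rho> T \<gamma> N \<kappa> q M M1 A D G F PF U\<tau> t x w K
    proof (intro discretisation.intro discretisation_axioms.intro M0.psd_operator_axioms)
      show "0 < \<rho>" "0 < T" "0 < \<gamma>" by fact+
      show "bounded_linear M1" "skew_selfadjoint D A" "time_partition T M t" "interpolant q M t x F PF" by fact+
      show "\<gamma> * (norm y)\<^sup>2 \<le> \<rho> * inner (M0 y) y + inner (M1 y) y" for y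
        using coercive \<rho>0(2) by (auto simp: inner_add_left power2_norm_eq_inner)
      show "onorm M0 \<le> N" by (simp add: N_def norms)
      show "(G j has_vector_derivative G (Suc j) s) (at s)" if "j < q + 2" for j s
        by (rule Gs(2)[OF that])
      show "norm (G (q + 1) s) \<le> K" "norm (G (q + 2) s) \<le> K" if "s \<in> {0..T}" for s
        using GK that by auto
      show "G 0 s \<in> D" "M0 (G 1 s) + M1 (G 0 s) + A (G 0 s) = F s" for s
        unfolding Gs(1)
        using exact_solution_pointwise[OF U(1) rho M0.bounded_linear_M0 M1 A F(2) dU] by auto
      show "gauss_radau \<rho> q (step t m) (x m) (w m)" if "m \<in> {1..M}" for m
        using gr that by blast
      show "discrete_solution q M t x w T M0 M1 D A PF (G 0 0) U\<tau>"
        using U\<tau> by (simp add: Gs(1) x0_eq)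
      show "step t m ^ (q + 1) * K \<le> \<kappa>" if "m \<in> {1..M}" for m
        unfolding \<kappa>_def using step_le[OF that] step_pos[OF that] K0 by (intro mult_right_mono power_mono)
    qed
    have \<kappa>2: "\<kappa>\<^sup>2 = \<tau> ^ (2 * (q + 1)) * (C3 * (H_norm \<rho> V)\<^sup>2)"
      unfolding \<kappa>_def power_mult_distrib K2 by (simp only: power_mult[symmetric] mult.commute[of "q + 1" 2])
    have \<delta>: "\<delta> = d * \<kappa>\<^sup>2"
      by (simp add: \<delta>_def d_def power_mult_distrib)
    have X: "4 * (N + 1) * (T * \<delta>) / \<gamma> = X * \<kappa>\<^sup>2"
      by (simp add: \<delta> X_def)
    have E: "(\<lambda>s. U s - (U\<tau>(0 := x0)) s) = E"
      by (rule ext) (simp add: E_def Gs(1) x0_eq)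
    define S where "S = 2 * (N * \<kappa>\<^sup>2) + 2 * (4 * c0 * (8 * T\<^sup>2 * \<delta> + 2 * c0 * (exp (2 * \<rho> * T) * (X * \<kappa>\<^sup>2))))"
    have "(SUP s\<in>{0..T}. ereal (inner (M0 (E s)) (E s))) \<le> ereal S"
      using sup_bound unfolding X S_def c_def c0_def by (intro SUP_least) simp
    moreover have "ereal (quad_norm_sq \<rho> q M t x w E) \<le> ereal (X * \<kappa>\<^sup>2 / \<gamma>)"
      using quad_norm_bound unfolding X by simp
    ultimately have "(SUP s\<in>{0..T}. ereal (inner (M0 (E s)) (E s))) + ereal (quad_norm_sq \<rho> q M t x w E) \<le>
        ereal S + ereal (X * \<kappa>\<^sup>2 / \<gamma>)"
      by (rule add_mono)
    also have "\<dots> = ereal (C * \<tau> ^ (2 * (q + 1)) * (H_norm \<rho> V)\<^sup>2)"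
    proof -
      have "S + X * \<kappa>\<^sup>2 / \<gamma> =
          (2 * N + 2 * (4 * c0 * (8 * T\<^sup>2 * d + 2 * c0 * (exp (2 * \<rho> * T) * X))) + X / \<gamma>) * \<kappa>\<^sup>2"
        unfolding S_def \<delta> by (simp add: algebra_simps)
      then show ?thesis
        unfolding \<kappa>2 C_def by (simp add: mult_ac)
    qed
    also have "\<dots> \<le> ereal (\<bar>C\<bar> * \<tau> ^ (2 * (q + 1)) * (H_norm \<rho> V)\<^sup>2)"
      unfolding mult.assoc ereal_less_eq(3)
      by (intro mult_right_mono mult_nonneg_nonneg zero_le_even_power) auto
    finally show "let E = \<lambda>s. U s - (U\<tau>(0 := x0)) s in
        (SUP s\<in>{0..T}. ereal (inner (M0 (E s)) (E s))) + ereal (quad_norm_sq \<rho> q M t x w E)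
          \<le> ereal (\<bar>C\<bar> * max_step M t ^ (2 * (q + 1)) * (H_norm \<rho> V)\<^sup>2)"
      unfolding Let_def E \<tau>_def .
  qed
qed

end
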